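(* Let $H$ be a separable infinite-dimensional Hilbert space, let $T\in B(H)$ be a quasidiagonal operator and assume that $C^*(T)$, the unital C$^*$-algebra generated by $T$, is exact. Then there exists a filtration $P_1\le P_2\le\cdots$ of $H$ such that: (1) The finite section method (for $T$ with respect to $\{P_n\}$) is stable if and only if $T$ is invertible. (2) $\sigma(T)=\bigcap_{\varepsilon>0}\Big(\limsup_{n\to\infty}\sigma^{(\varepsilon)}(P_nTP_n)\Big)$. (3) For every quasidiagonal trace $\tau$ on $C^*(\pi(T))$ there exists a subsequence $\{n(k)\}$ such that $\varphi_{n(k)}\to\tau\circ\pi|_{C^*(T)}$ in the weak-$*$ topology, where $\pi : B(H)\to Q(H)$ is the quotient map onto the Calkin algebra and $\varphi_n$ is the state on $C^*(T)$ given by $\varphi_n(X)=\mathrm{tr}_{\mathrm{rank}(P_n)}(P_nXP_n)$.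
   Context: A filtration of $H$ is an increasing sequence of finite rank projections $P_1\le P_2\le\cdots$ with $\|P_nx-x\|\to0$ for every $x\in H$. $T$ is quasidiagonal if there is a filtration $\{Q_n\}$ with $\|TQ_n-Q_nT\|\to0$. $P_nTP_n$ is regarded as an operator on $P_nH$; $\mathrm{tr}_k$ is the normalized trace on $k\times k$ matrices, with $P_nB(H)P_n\cong M_{\mathrm{rank}(P_n)}(\mathbb{C})$. The finite section method (with respect to $\{P_n\}$) is stable for $T$ if there is $n_0$ such that for all $n\ge n_0$ the operators $P_nTP_n : P_nH\to P_nH$ are invertible and $\sup_{n\ge n_0}\|(P_nTP_n)^{-1}\|<\infty$. For $\varepsilon>0$, the $\varepsilon$-pseudospectrum $\sigma^{(\varepsilon)}(S)$ of an operator $S$ is the union of $\sigma(S)$ and $\{\lambda\in\mathbb{C}\setminus\sigma(S):\|(\lambda-S)^{-1}\|\ge1/\varepsilon\}$. For subsets $X_n\subset\mathbb{C}$, $\limsup_{n\to\infty}X_n$ is the set of all cluster points of sequences $\{x_n\}$ with $x_n\in X_n$. A tracial state $\tau$ on a unital C$^*$-algebra $A$ is quasidiagonal if there exist unital completely positive maps $\phi_n : A\to M_{k(n)}(\mathbb{C})$ with $\mathrm{tr}_{k(n)}\circ\phi_n\to\tau$ weak-$*$ and $\|\phi_n(ab)-\phi_n(a)\phi_n(b)\|\to0$ for all $a,b\in A$. *)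

theory Defs
  imports "HOL-Analysis.Analysis" "Jordan_Normal_Form.Matrix"
begin

class scaleC = scaleR +
  fixes scaleC :: "complex \<Rightarrow> 'a \<Rightarrow> 'a" (infixr \<open>*\<^sub>C\<close> 75)

class complex_vector = scaleC + real_vector +
  assumes scaleC_add_right: "a *\<^sub>C (x + y) = a *\<^sub>C x + a *\<^sub>C y"
    and scaleC_add_left: "(a + b) *\<^sub>C x = a *\<^sub>C x + b *\<^sub>C x"
    and scaleC_scaleC: "a *\<^sub>C b *\<^sub>C x = (a * b) *\<^sub>C x"
    and scaleC_one: "1 *\<^sub>C x = x"
    and scaleR_scaleC: "r *\<^sub>R x = complex_of_real r *\<^sub>C x"

global_interpretation complex_vector: vector_space "scaleC :: complex \<Rightarrow> 'a \<Rightarrow> 'a::complex_vector"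
  defines cspan = complex_vector.span
    and cdim = complex_vector.dim
    and cdependent = complex_vector.dependent
    and crepresentation = complex_vector.representation
    and csubspace = complex_vector.subspace
  by unfold_locales (simp_all add: scaleC_add_right scaleC_add_left scaleC_scaleC scaleC_one)

text \<open>The inner product is linear in the first argument. The inherited real inner product (and hence
  the norm) is the one induced by its real part.\<close>

class complex_inner = complex_vector + real_inner +
  fixes cinner :: "'a \<Rightarrow> 'a \<Rightarrow> complex"
  assumes cinner_commute: "cinner x y = cnj (cinner y x)"
    and cinner_add_left: "cinner (x + y) z = cinner x z + cinner y z"
    and cinner_scaleC_left: "cinner (c *\<^sub>C x) y = c * cinner x y"
    and inner_cinner: "inner x y = Re (cinner x y)"

class chilbert_space = complex_inner + complete_space

subclass (in chilbert_space) banach ..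

lemma cinner_inner: "cinner x y = Complex (inner x y) (- inner (\<i> *\<^sub>C x) y)"
  by (simp add: complex_eq_iff inner_cinner cinner_scaleC_left)

lemma cinner_eqI: 
  fixes x y x' y' :: "'a::complex_inner"
  assumes "inner x y = inner x' y'" "inner (\<i> *\<^sub>C x) y = inner (\<i> *\<^sub>C x') y'"
  shows "cinner x y = cinner x' y'"
  using assms by (simp add: cinner_inner)

lemma cinner_add_right: "cinner x (y + z) = cinner x y + cinner x z"
  by (metis cinner_add_left cinner_commute complex_cnj_add)

lemma cinner_scaleC_right: "cinner x (c *\<^sub>C y) = cnj c * cinner x y"
  by (metis cinner_scaleC_left cinner_commute complex_cnj_mult)

lemma cinner_ext_right:
  fixes y z :: "'a::complex_inner"
  assumes "\<And>x. cinner x y = cinner x z"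
  shows "y = z"
proof -
  have "inner x y = inner x z" for x
    using assms[of x] by (simp add: inner_cinner)
  from this[of "y - z"] have "inner (y - z) (y - z) = 0" by (simp add: inner_diff_right)
  then show ?thesis by simp
qed

lemma cinner_ext_left:
  fixes y z :: "'a::complex_inner"
  assumes "\<And>x. cinner y x = cinner z x"
  shows "y = z"
  by (rule cinner_ext_right) (metis assms cinner_commute)

lemma norm_scaleC: "norm (c *\<^sub>C (x::'a::complex_inner)) = cmod c * norm x"
proof -
  have xx: "cinner x x = complex_of_real (inner x x)"
    using cinner_commute[of x x] by (simp add: complex_eq_iff inner_cinner)
  have "cinner (c *\<^sub>C x) (c *\<^sub>C x) = (c * cnj c) * cinner x x"
    by (simp add: cinner_scaleC_left cinner_scaleC_right)
  also have "\<dots> = complex_of_real ((cmod c)\<^sup>2 * inner x x)"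
    by (simp add: xx complex_mult_cnj cmod_power2)
  finally have "inner (c *\<^sub>C x) (c *\<^sub>C x) = (cmod c)\<^sup>2 * inner x x"
    by (metis inner_cinner Re_complex_of_real)
  then show ?thesis
    by (simp add: norm_eq_sqrt_inner real_sqrt_mult)
qed

lemma riesz_real:
  fixes f :: "'a::{real_inner, complete_space} \<Rightarrow> real"
  assumes f: "bounded_linear f"
  shows "\<exists>y. \<forall>x. f x = inner x y"
proof (cases "\<forall>x. f x = 0")
  case True
  then show ?thesis by (intro exI[of _ 0]) simp
next
  case False
  interpret f: bounded_linear f by fact
  define N where "N = onorm f"
  have N: "N > 0" unfolding N_def using False f onorm_pos_lt by blast
  have bd: "f x \<le> N * norm x" for x
    unfolding N_def using onorm[OF f, of x] by simp
  have "\<exists>u. norm u \<le> 1 \<and> f u > N - 1 / real (Suc n)" for n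
  proof (rule ccontr)
    assume "\<not> ?thesis"
    then have A: "norm u \<le> 1 \<Longrightarrow> f u \<le> N - 1 / real (Suc n)" for u by force
    have P: "N - 1 / real (Suc n) \<ge> 0" using A[of 0] by (simp add: f.zero)
    have "norm (f x) \<le> (N - 1 / real (Suc n)) * norm x" for x
    proof (cases "x = 0")
      case True
      then show ?thesis by (simp add: f.zero)
    next
      case False
      have "f ((1 / norm x) *\<^sub>R x) \<le> N - 1 / real (Suc n)" by (rule A) (use False in simp)
      moreover have "f ((- 1 / norm x) *\<^sub>R x) \<le> N - 1 / real (Suc n)" by (rule A) (use False in simp)
      ultimately have "\<bar>f x\<bar> / norm x \<le> N - 1 / real (Suc n)"
        unfolding f.scaleR by (auto simp: abs_if)
      then show ?thesis using False by (simp add: pos_divide_le_eq)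
    qed
    then have "onorm f \<le> N - 1 / real (Suc n)" by (intro onorm_bound P)
    then show False by (simp add: N_def divide_le_0_iff)
  qed
  then obtain u where u1: "\<And>n. norm (u n) \<le> 1" and u2: "\<And>n. f (u n) > N - 1 / real (Suc n)"
    by metis
  have key: "(norm (u n - u m))\<^sup>2 \<le> 8 / (N * real (Suc M))" if "n \<ge> M" "m \<ge> M" for n m M
  proof -
    define d where "d = 1 / (N * real (Suc M))"
    have d: "1 / real (Suc M) = N * d" "d > 0" using N by (auto simp: d_def)
    have "1 / real (Suc n) \<le> N * d" "1 / real (Suc m) \<le> N * d"
      unfolding d(1)[symmetric] using that by (auto intro!: divide_left_mono)
    then have "2 * N - 2 * (N * d) \<le> f (u n + u m)"
      using u2[of n] u2[of m] by (simp add: f.add)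
    also have "\<dots> \<le> N * norm (u n + u m)" by (rule bd)
    finally have "N * (2 - 2 * d) \<le> N * norm (u n + u m)" by (simp add: algebra_simps)
    then have s: "2 - 2 * d \<le> norm (u n + u m)" using N by simp
    have s2: "4 - 8 * d \<le> (norm (u n + u m))\<^sup>2"
    proof (cases "2 - 2 * d \<ge> 0")
      case True
      then have "(2 - 2 * d)\<^sup>2 \<le> (norm (u n + u m))\<^sup>2" using s by (intro power_mono)
      moreover have "(2 - 2 * d)\<^sup>2 = 4 - 8 * d + (2 * d)\<^sup>2" by (simp add: power2_eq_square algebra_simps)
      ultimately show ?thesis using zero_le_power2[of "2 * d"] by linarith
    next
      case False
      then have "4 - 8 * d \<le> 0" by simp
      then show ?thesis by (smt (verit) zero_le_power2)
    qed
    have "(norm (u n - u m))\<^sup>2 + (norm (u n + u m))\<^sup>2 = 2 * (norm (u n))\<^sup>2 + 2 * (norm (u m))\<^sup>2"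
      by (simp add: power2_norm_eq_inner inner_add_left inner_add_right inner_diff_left inner_diff_right)
    moreover have "(norm (u n))\<^sup>2 \<le> 1" "(norm (u m))\<^sup>2 \<le> 1"
      using u1[of n] u1[of m] by (simp_all add: power_le_one)
    ultimately have "(norm (u n - u m))\<^sup>2 \<le> 8 * d" using s2 by linarith
    then show ?thesis by (simp add: d_def)
  qed
  have "Cauchy u"
  proof (rule CauchyI)
    fix e :: real assume e: "0 < e"
    obtain M where M: "8 / (N * e\<^sup>2) < real M" using reals_Archimedean2 by blast
    have "8 / (N * real (Suc M)) < e\<^sup>2"
    proof -
      have "8 < real M * (N * e\<^sup>2)" using M N e by (simp add: pos_divide_less_eq)
      also have "\<dots> \<le> real (Suc M) * (N * e\<^sup>2)" using N by (intro mult_right_mono) auto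
      finally show ?thesis using N by (simp add: pos_divide_less_eq algebra_simps del: of_nat_Suc)
    qed
    then have "norm (u m - u n) < e" if "m \<ge> M" "n \<ge> M" for m n
      using key[OF that] e by (metis order_le_less_trans power_less_imp_less_base less_imp_le)
    then show "\<exists>M. \<forall>m\<ge>M. \<forall>n\<ge>M. norm (u m - u n) < e" by blast
  qed
  then obtain w where w: "u \<longlonglongrightarrow> w" using Cauchy_convergent convergent_def by blast
  have w1: "norm w \<le> 1"
    using tendsto_norm[OF w] u1 by (intro LIMSEQ_le_const2[where x="norm w"]) auto
  have "(\<lambda>n. N - 1 / real (Suc n)) \<longlonglongrightarrow> N - 0"
    by (intro tendsto_diff tendsto_const LIMSEQ_Suc lim_1_over_n)
  then have wN: "N \<le> f w"
    using f.tendsto[OF w] u2 by (intro LIMSEQ_le[where Y="\<lambda>n. f (u n)"]) (auto intro: less_imp_le)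
  have "f x = inner x (N *\<^sub>R w)" for x
  proof -
    define c where "c = f x - N * inner w x"
    define D where "D = N\<^sup>2 * (norm x)\<^sup>2 - (f x)\<^sup>2"
    have ineq: "2 * N * t * c \<le> t\<^sup>2 * D" if t: "\<bar>t\<bar> * \<bar>f x\<bar> \<le> N" for t
    proof -
      have "N + t * f x \<le> f (w + t *\<^sub>R x)" using wN by (simp add: f.add f.scaleR)
      also have "\<dots> \<le> N * norm (w + t *\<^sub>R x)" by (rule bd)
      finally have *: "N + t * f x \<le> N * norm (w + t *\<^sub>R x)" .
      have "\<bar>t * f x\<bar> \<le> N" using t by (simp add: abs_mult)
      then have "(N + t * f x)\<^sup>2 \<le> (N * norm (w + t *\<^sub>R x))\<^sup>2" using * by (intro power_mono) linarith+
      also have "\<dots> = N\<^sup>2 * ((norm w)\<^sup>2 + 2 * t * inner w x + t\<^sup>2 * (norm x)\<^sup>2)"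
        unfolding power_mult_distrib power2_norm_eq_inner
        by (simp add: inner_add_left inner_add_right inner_commute power2_eq_square algebra_simps)
      also have "\<dots> \<le> N\<^sup>2 * (1 + 2 * t * inner w x + t\<^sup>2 * (norm x)\<^sup>2)"
        using w1 by (intro mult_left_mono) (auto simp: power_le_one)
      finally show ?thesis by (simp add: c_def D_def power2_eq_square algebra_simps)
    qed
    have "c = 0"
    proof (rule ccontr)
      assume c: "c \<noteq> 0"
      define s where "s = min (N / (\<bar>f x\<bar> + 1)) (N * \<bar>c\<bar> / (\<bar>D\<bar> + 1))"
      have s: "s > 0" unfolding s_def using N c by simp
      have sf: "s * \<bar>f x\<bar> \<le> N"
      proof -
        have "s \<le> N / (\<bar>f x\<bar> + 1)" by (simp add: s_def)
        then have "s * (\<bar>f x\<bar> + 1) \<le> N" by (simp add: pos_le_divide_eq)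
        then show ?thesis using s by (simp add: algebra_simps)
      qed
      have sD': "s * \<bar>D\<bar> \<le> N * \<bar>c\<bar>"
      proof -
        have "s \<le> N * \<bar>c\<bar> / (\<bar>D\<bar> + 1)" by (simp add: s_def)
        then have "s * (\<bar>D\<bar> + 1) \<le> N * \<bar>c\<bar>" by (simp add: pos_le_divide_eq)
        then show ?thesis using s by (simp add: algebra_simps)
      qed
      have "2 * N * (s * sgn c) * c \<le> (s * sgn c)\<^sup>2 * D"
        using sf s c by (intro ineq) (simp add: abs_mult abs_sgn_eq)
      then have "2 * N * s * \<bar>c\<bar> \<le> s * (s * D)"
        using c by (simp add: power2_eq_square abs_sgn mult_ac sgn_if split: if_splits)
      also have "\<dots> \<le> s * (N * \<bar>c\<bar>)"
        using s sD' by (intro mult_left_mono) (smt (verit) mult_left_mono abs_ge_self, simp)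
      finally have "s * (N * \<bar>c\<bar>) \<le> 0" by (simp add: algebra_simps)
      then show False using s N c by (simp add: mult_le_0_iff)
    qed
    then show ?thesis by (simp add: c_def inner_commute)
  qed
  then show ?thesis by blast
qed

typedef (overloaded) 'h bop = "{T :: 'h::chilbert_space \<Rightarrow>\<^sub>L 'h. \<forall>c x. T (c *\<^sub>C x) = c *\<^sub>C T x}"
  morphisms blinfun_of_bop bop_of_blinfun
  by (rule exI[of _ 0]) simp

setup_lifting type_definition_bop

lift_definition app :: "'h::chilbert_space bop \<Rightarrow> 'h \<Rightarrow> 'h" is blinfun_apply .

lemma app_scaleC: "app T (c *\<^sub>C x) = c *\<^sub>C app T x"
  by transfer simp

lemma bounded_linear_app: "bounded_linear (app T)"
  by transfer (simp add: blinfun.bounded_linear_right)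

lemma bop_eqI: "(\<And>x. app S x = app T x) \<Longrightarrow> S = T"
  by transfer (rule blinfun_eqI)

lemma bounded_linear_scaleC: "bounded_linear (\<lambda>x::'a::complex_inner. c *\<^sub>C x)"
  by (rule bounded_linear_intro[where K="cmod c"])
    (simp_all add: scaleC_add_right scaleR_scaleC scaleC_scaleC norm_scaleC mult.commute)

text \<open>Complex unital normed star-algebras. The two instances used below, \<open>B(H)\<close> and the Calkin
  algebra, are C*-algebras; the class omits \<open>0 \<noteq> 1\<close> because these may be zero.\<close>

class star_algebra = complex_vector + real_normed_algebra + monoid_mult +
  fixes star :: "'a \<Rightarrow> 'a"
  assumes scaleC_mult_left: "(c *\<^sub>C x) * y = c *\<^sub>C (x * y)"
    and scaleC_mult_right: "x * (c *\<^sub>C y) = c *\<^sub>C (x * y)"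
    and norm_scaleC_star_algebra: "norm (c *\<^sub>C x) = cmod c * norm x"
    and star_star: "star (star x) = x"
    and star_add: "star (x + y) = star x + star y"
    and star_mult: "star (x * y) = star y * star x"
    and star_scaleC: "star (c *\<^sub>C x) = cnj c *\<^sub>C star x"

instantiation bop :: (chilbert_space) star_algebra
begin

lift_definition zero_bop :: "'a bop" is 0 by simp
lift_definition one_bop :: "'a bop" is id_blinfun by simp
lift_definition plus_bop :: "'a bop \<Rightarrow> 'a bop \<Rightarrow> 'a bop" is "(+)"
  by (simp add: blinfun.add_left scaleC_add_right)
lift_definition minus_bop :: "'a bop \<Rightarrow> 'a bop \<Rightarrow> 'a bop" is "(-)"
  by (simp add: blinfun.diff_left complex_vector.scale_right_diff_distrib)
lift_definition uminus_bop :: "'a bop \<Rightarrow> 'a bop" is uminus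
  by (simp add: blinfun.minus_left)
lift_definition times_bop :: "'a bop \<Rightarrow> 'a bop \<Rightarrow> 'a bop" is "(o\<^sub>L)"
  by simp
lift_definition scaleR_bop :: "real \<Rightarrow> 'a bop \<Rightarrow> 'a bop" is scaleR
  by (simp add: blinfun.scaleR_left scaleR_scaleC scaleC_scaleC mult.commute)
lift_definition scaleC_bop :: "complex \<Rightarrow> 'a bop \<Rightarrow> 'a bop"
  is "\<lambda>c T. Blinfun (\<lambda>x. c *\<^sub>C blinfun_apply T x)"
  by (simp add: bounded_linear_Blinfun_apply bounded_linear_compose[OF bounded_linear_scaleC]
      blinfun.bounded_linear_right scaleC_scaleC mult.commute)
lift_definition norm_bop :: "'a bop \<Rightarrow> real" is norm .
definition dist_bop :: "'a bop \<Rightarrow> 'a bop \<Rightarrow> real" where "dist_bop S T = norm (S - T)"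
definition sgn_bop :: "'a bop \<Rightarrow> 'a bop" where "sgn_bop T = inverse (norm T) *\<^sub>R T"
definition uniformity_bop :: "('a bop \<times> 'a bop) filter"
  where "uniformity_bop = (INF e\<in>{0 <..}. principal {(x, y). dist x y < e})"
definition open_bop :: "'a bop set \<Rightarrow> bool"
  where "open_bop U = (\<forall>x\<in>U. eventually (\<lambda>(x', y). x' = x \<longrightarrow> y \<in> U) uniformity)"
definition star_bop :: "'a bop \<Rightarrow> 'a bop"
  where "star_bop T = (THE S. \<forall>x y. cinner (app T x) y = cinner x (app S y))"

lemma app_bop [simp]:
  "app 0 x = 0" "app 1 x = x" "app (S + T) x = app S x + app T x"
  "app (S - T) x = app S x - app T x" "app (- T) x = - app T x"
  "app (S * T) x = app S (app T x)" "app (r *\<^sub>R T) x = r *\<^sub>R app T x"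
  for S T :: "'a bop"
  by (transfer; simp add: blinfun.bilinear_simps)+

lemma app_scaleC_bop [simp]: "app (c *\<^sub>C T) x = c *\<^sub>C app T x" for T :: "'a bop"
  by transfer (simp add: bounded_linear_Blinfun_apply bounded_linear_compose[OF bounded_linear_scaleC]
      blinfun.bounded_linear_right)

lemma norm_bop_onorm: "norm T = onorm (app T)" for T :: "'a bop"
  by transfer (simp add: norm_blinfun.rep_eq)

lemma bop_adjoint_exists:
  fixes T :: "'a bop"
  shows "\<exists>S. \<forall>x y. cinner (app T x) y = cinner x (app S y)"
proof -
  have T: "bounded_linear (app T)" by (rule bounded_linear_app)
  have "\<exists>s. \<forall>x. inner (app T x) y = inner x s" for y
    by (rule riesz_real) (intro bounded_linear_compose[OF bounded_linear_inner_left T])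
  then obtain s where s: "\<And>x y. inner (app T x) y = inner x (s y)" by metis
  have cs: "cinner (app T x) y = cinner x (s y)" for x y
    by (rule cinner_eqI) (simp_all add: s flip: app_scaleC)
  have add: "s (y + z) = s y + s z" for y z
    by (rule cinner_ext_right) (simp add: cinner_add_right flip: cs)
  have scC: "s (c *\<^sub>C y) = c *\<^sub>C s y" for c y
    by (rule cinner_ext_right) (simp add: cinner_scaleC_right flip: cs)
  have bd: "norm (s y) \<le> norm y * norm T" for y
  proof (cases "s y = 0")
    case False
    have "norm (s y) * norm (s y) = inner (s y) (s y)"
      by (simp add: power2_norm_eq_inner flip: power2_eq_square)
    also have "\<dots> = inner (app T (s y)) y" by (simp add: s)
    also have "\<dots> \<le> norm (app T (s y)) * norm y" by (rule norm_cauchy_schwarz)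
    also have "\<dots> \<le> (norm T * norm (s y)) * norm y"
      unfolding norm_bop_onorm by (intro mult_right_mono onorm[OF T]) simp
    finally have "norm (s y) * norm (s y) \<le> (norm y * norm T) * norm (s y)" by (simp add: mult_ac)
    then show ?thesis using False by simp
  qed (simp add: norm_bop_onorm onorm_pos_le[OF T])
  have bl: "bounded_linear s"
    by (rule bounded_linear_intro[OF add _ bd]) (simp add: scaleR_scaleC scC)
  have ap: "app (bop_of_blinfun (Blinfun s)) = s"
    by (simp add: app.rep_eq bop_of_blinfun_inverse bounded_linear_Blinfun_apply[OF bl] scC)
  show ?thesis by (intro exI[of _ "bop_of_blinfun (Blinfun s)"]) (simp add: ap cs)
qed

lemma bop_adjoint_unique:
  fixes T :: "'a bop"
  assumes "\<And>x y. cinner (app T x) y = cinner x (app S y)"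
  shows "star T = S"
  unfolding star_bop_def
proof (rule the_equality)
  show "R = S" if "\<forall>x y. cinner (app T x) y = cinner x (app R y)" for R
    by (intro bop_eqI cinner_ext_right) (metis assms that)
qed (use assms in blast)

lemma cinner_star: "cinner (app T x) y = cinner x (app (star T) y)" for T :: "'a bop"
  using bop_adjoint_exists[of T] bop_adjoint_unique[of T] by metis

lemma cinner_star': "cinner x (app T y) = cinner (app (star T) x) y" for T :: "'a bop"
  by (metis cinner_star cinner_commute)

instance
proof
  fix S T R :: "'a bop" and a b :: complex and r q :: real
  show "S + T + R = S + (T + R)" "S + T = T + S" "0 + S = S" "- S + S = 0" "S - T = S + - T"
    by (rule bop_eqI, simp)+
  show "r *\<^sub>R (S + T) = r *\<^sub>R S + r *\<^sub>R T" "(r + q) *\<^sub>R S = r *\<^sub>R S + q *\<^sub>R S"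
    "r *\<^sub>R q *\<^sub>R S = (r * q) *\<^sub>R S" "1 *\<^sub>R S = S"
    by (rule bop_eqI, simp add: scaleR_right_distrib scaleR_left_distrib)+
  show "a *\<^sub>C (S + T) = a *\<^sub>C S + a *\<^sub>C T" "(a + b) *\<^sub>C S = a *\<^sub>C S + b *\<^sub>C S"
    "a *\<^sub>C b *\<^sub>C S = (a * b) *\<^sub>C S" "1 *\<^sub>C S = S" "r *\<^sub>R S = complex_of_real r *\<^sub>C S"
    by (rule bop_eqI, simp add: scaleC_add_right scaleC_add_left scaleC_scaleC scaleC_one scaleR_scaleC)+
  show "S * T * R = S * (T * R)" "1 * S = S" "S * 1 = S" "(S + T) * R = S * R + T * R"
    by (rule bop_eqI, simp)+
  show "S * (T + R) = S * T + S * R" "(r *\<^sub>R S) * T = r *\<^sub>R (S * T)" "S * (r *\<^sub>R T) = r *\<^sub>R (S * T)"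
    by (rule bop_eqI,
        simp add: linear_simps[OF bounded_linear_app])+
  show "(a *\<^sub>C S) * T = a *\<^sub>C (S * T)" "S * (a *\<^sub>C T) = a *\<^sub>C (S * T)"
    by (rule bop_eqI, simp add: app_scaleC)+
  show "dist S T = norm (S - T)" by (rule dist_bop_def)
  show "sgn S = inverse (norm S) *\<^sub>R S" by (rule sgn_bop_def)
  show "uniformity = (INF e\<in>{0 <..}. principal {(x, y :: 'a bop). dist x y < e})"
    by (rule uniformity_bop_def)
  show "open U = (\<forall>x\<in>U. \<forall>\<^sub>F (x', y) in uniformity. x' = x \<longrightarrow> y \<in> U)" for U :: "'a bop set"
    by (rule open_bop_def)
  show "norm S = 0 \<longleftrightarrow> S = 0" by transfer simp
  show "norm (S + T) \<le> norm S + norm T" by transfer (rule norm_triangle_ineq)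
  show "norm (r *\<^sub>R S) = \<bar>r\<bar> * norm S" by transfer simp
  show "norm (S * T) \<le> norm S * norm T" by transfer (rule norm_blinfun_compose)
  have le: "norm (a *\<^sub>C S) \<le> cmod a * norm S" for a and S :: "'a bop"
    unfolding norm_bop_onorm
  proof (rule onorm_bound)
    show "0 \<le> cmod a * onorm (app S)" by (simp add: onorm_pos_le[OF bounded_linear_app])
    show "norm (app (a *\<^sub>C S) x) \<le> cmod a * onorm (app S) * norm x" for x
      using onorm[OF bounded_linear_app, of S x] 
      by (simp add: norm_scaleC mult.assoc mult_left_mono)
  qed
  show "norm (a *\<^sub>C S) = cmod a * norm S"
  proof (cases "a = 0")
    case True
    then show ?thesis using le[of a S] onorm_pos_le[OF bounded_linear_app, of "a *\<^sub>C S"]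
      by (simp add: norm_bop_onorm)
  next
    case False
    have "inverse a *\<^sub>C a *\<^sub>C S = S" using False by (intro bop_eqI) simp
    then have "norm S \<le> inverse (cmod a) * norm (a *\<^sub>C S)"
      using le[of "inverse a" "a *\<^sub>C S"] by (simp only: norm_inverse)
    then have "cmod a * norm S \<le> norm (a *\<^sub>C S)"
      using False by (simp add: field_simps)
    then show ?thesis using le[of a S] by simp
  qed
  show "star (star S) = S" by (rule bop_adjoint_unique) (rule cinner_star'[symmetric])
  show "star (S + T) = star S + star T" "star (S * T) = star T * star S"
    "star (a *\<^sub>C S) = cnj a *\<^sub>C star S"
    by (rule bop_adjoint_unique,
        simp add: cinner_add_left cinner_add_right cinner_scaleC_left cinner_scaleC_right cinner_star)+
qed

end


lemma norm_app_le: "norm (app T x) \<le> norm T * norm x"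
  unfolding norm_bop_onorm by (rule onorm[OF bounded_linear_app])

definition compact_op :: "'h::chilbert_space bop \<Rightarrow> bool"
  where "compact_op T \<longleftrightarrow> compact (closure (app T ` cball 0 1))"

lemma compact_opI:
  fixes T :: "'h::chilbert_space bop"
  assumes "\<And>e. e > 0 \<Longrightarrow> \<exists>G. finite G \<and> (\<forall>x. norm x \<le> 1 \<longrightarrow> (\<exists>g\<in>G. norm (app T x - g) < e))"
  shows "compact_op T"
  unfolding compact_op_def compact_eq_totally_bounded
proof (intro conjI allI impI)
  show "complete (closure (app T ` cball 0 1))"
    by (simp add: complete_eq_closed)
next
  fix e :: real assume "e > 0"
  then obtain G where G: "finite G" "\<And>x. norm x \<le> 1 \<Longrightarrow> \<exists>g\<in>G. norm (app T x - g) < e / 2"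
    using assms[of "e / 2"] by auto
  have "app T ` cball 0 1 \<subseteq> (\<Union>x\<in>G. cball x (e / 2))"
    using G(2) by (fastforce simp: dist_norm norm_minus_commute)
  then have "closure (app T ` cball 0 1) \<subseteq> (\<Union>x\<in>G. cball x (e / 2))"
    by (rule closure_minimal) (use G(1) in \<open>auto intro!: closed_UN\<close>)
  also have "\<dots> \<subseteq> (\<Union>x\<in>G. ball x e)" using \<open>e > 0\<close> by auto
  finally show "\<exists>k. finite k \<and> closure (app T ` cball 0 1) \<subseteq> (\<Union>x\<in>k. ball x e)" using G(1) by blast
qed

lemma compact_opD:
  fixes T :: "'h::chilbert_space bop"
  assumes "compact_op T" "e > 0"
  shows "\<exists>F. finite F \<and> (\<forall>y\<in>F. norm y \<le> 1) \<and>
    (\<forall>x. norm x \<le> 1 \<longrightarrow> (\<exists>y\<in>F. norm (app T x - app T y) < e))"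
proof -
  let ?K = "closure (app T ` cball 0 1)"
  have "?K \<subseteq> (\<Union>y\<in>cball 0 1. ball (app T y) e)"
    using assms(2) by (force simp: closure_approachable)
  then obtain F where F: "F \<subseteq> cball 0 1" "finite F" "?K \<subseteq> (\<Union>y\<in>F. ball (app T y) e)"
    using assms(1) unfolding compact_op_def
    by (metis (no_types, lifting) compactE_image open_ball)
  have "\<exists>y\<in>F. norm (app T x - app T y) < e" if "norm x \<le> 1" for x
  proof -
    have "app T x \<in> ?K" using that by (intro subsetD[OF closure_subset]) auto
    then obtain y where "y \<in> F" "app T x \<in> ball (app T y) e" using F(3) by blast
    then show ?thesis by (auto simp: dist_norm norm_minus_commute)
  qed
  then show ?thesis using F by (intro exI[of _ F]) auto
qed

lemma compact_op_0: "compact_op 0"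
  by (rule compact_opI) (auto intro!: exI[of _ "{0}"])

lemma compact_op_add:
  assumes S: "compact_op S" and T: "compact_op T"
  shows "compact_op (S + T)"
proof (rule compact_opI)
  fix e :: real assume e: "e > 0"
  obtain F where F: "finite F" "\<And>x. norm x \<le> 1 \<Longrightarrow> \<exists>y\<in>F. norm (app S x - app S y) < e / 2"
    using compact_opD[OF S, of "e / 2"] e by auto
  obtain G where G: "finite G" "\<And>x. norm x \<le> 1 \<Longrightarrow> \<exists>y\<in>G. norm (app T x - app T y) < e / 2"
    using compact_opD[OF T, of "e / 2"] e by auto
  show "\<exists>G. finite G \<and> (\<forall>x. norm x \<le> 1 \<longrightarrow> (\<exists>g\<in>G. norm (app (S + T) x - g) < e))"
  proof (intro exI conjI allI impI)
    show "finite ((\<lambda>(y, z). app S y + app T z) ` (F \<times> G))" using F G by simp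
    fix x :: 'a assume x: "norm x \<le> 1"
    obtain y z where yz: "y \<in> F" "norm (app S x - app S y) < e / 2" "z \<in> G" "norm (app T x - app T z) < e / 2"
      using F(2)[OF x] G(2)[OF x] by blast
    have "norm (app (S + T) x - (app S y + app T z)) < e"
      using norm_add_less[OF yz(2,4)] by (simp add: algebra_simps)
    then show "\<exists>g\<in>(\<lambda>(y, z). app S y + app T z) ` (F \<times> G). norm (app (S + T) x - g) < e"
      using yz(1,3) by (intro bexI[of _ "app S y + app T z"]) auto
  qed
qed

lemma compact_op_mult_left:
  assumes T: "compact_op T"
  shows "compact_op (S * T)"
proof (rule compact_opI)
  fix e :: real assume e: "e > 0"
  define c where "c = norm S + 1"
  have c: "c > 0" unfolding c_def by (rule add_nonneg_pos) auto
  obtain F where F: "finite F" "\<And>x. norm x \<le> 1 \<Longrightarrow> \<exists>y\<in>F. norm (app T x - app T y) < e / c"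
    using compact_opD[OF T, of "e / c"] e c by auto
  show "\<exists>G. finite G \<and> (\<forall>x. norm x \<le> 1 \<longrightarrow> (\<exists>g\<in>G. norm (app (S * T) x - g) < e))"
  proof (intro exI conjI allI impI)
    show "finite ((\<lambda>y. app (S * T) y) ` F)" using F by simp
    fix x :: 'a assume x: "norm x \<le> 1"
    obtain y where y: "y \<in> F" "norm (app T x - app T y) < e / c" using F(2)[OF x] by blast
    have "norm (app (S * T) x - app (S * T) y) = norm (app S (app T x - app T y))"
      by (simp add: linear_simps[OF bounded_linear_app])
    also have "\<dots> \<le> norm S * norm (app T x - app T y)" by (rule norm_app_le)
    also have "\<dots> \<le> c * norm (app T x - app T y)" by (intro mult_right_mono) (auto simp: c_def)
    also have "\<dots> < e" using y(2) c by (simp add: pos_less_divide_eq mult.commute)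
    finally show "\<exists>g\<in>(\<lambda>y. app (S * T) y) ` F. norm (app (S * T) x - g) < e" using y(1) by blast
  qed
qed

lemma compact_op_mult_right:
  assumes T: "compact_op T"
  shows "compact_op (T * S)"
proof (rule compact_opI)
  fix e :: real assume e: "e > 0"
  define c where "c = norm S + 1"
  have c: "c > 0" unfolding c_def by (rule add_nonneg_pos) auto
  obtain F where F: "finite F" "\<And>x. norm x \<le> 1 \<Longrightarrow> \<exists>y\<in>F. norm (app T x - app T y) < e / c"
    using compact_opD[OF T, of "e / c"] e c by auto
  show "\<exists>G. finite G \<and> (\<forall>x. norm x \<le> 1 \<longrightarrow> (\<exists>g\<in>G. norm (app (T * S) x - g) < e))"
  proof (intro exI conjI allI impI)
    show "finite ((\<lambda>y. c *\<^sub>R app T y) ` F)" using F by simp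
    fix x :: 'a assume x: "norm x \<le> 1"
    have "norm (app S x) \<le> norm S * norm x" by (rule norm_app_le)
    also have "\<dots> \<le> c * 1" using x by (intro mult_mono) (auto simp: c_def)
    finally have "norm ((1 / c) *\<^sub>R app S x) \<le> 1" using c by simp
    then obtain y where y: "y \<in> F" "norm (app T ((1 / c) *\<^sub>R app S x) - app T y) < e / c"
      using F(2) by blast
    have "app (T * S) x - c *\<^sub>R app T y = c *\<^sub>R (app T ((1 / c) *\<^sub>R app S x) - app T y)"
      using c by (simp add: linear_simps[OF bounded_linear_app] scaleR_right_diff_distrib)
    then have "norm (app (T * S) x - c *\<^sub>R app T y) = c * norm (app T ((1 / c) *\<^sub>R app S x) - app T y)"
      using c by simp
    also have "\<dots> < e" using y(2) c by (simp add: pos_less_divide_eq mult.commute)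
    finally show "\<exists>g\<in>(\<lambda>y. c *\<^sub>R app T y) ` F. norm (app (T * S) x - g) < e" using y(1) by blast
  qed
qed

lemma compact_op_scaleC: "compact_op T \<Longrightarrow> compact_op (c *\<^sub>C T)"
  using compact_op_mult_left[of T "c *\<^sub>C 1"] by (simp add: scaleC_mult_left)

lemma compact_op_scaleR: "compact_op T \<Longrightarrow> compact_op (r *\<^sub>R T)"
  by (simp add: scaleR_scaleC compact_op_scaleC)

lemma compact_op_minus: "compact_op T \<Longrightarrow> compact_op (- T)"
  using compact_op_scaleR[of T "- 1"] by simp

lemma compact_op_diff: "compact_op S \<Longrightarrow> compact_op T \<Longrightarrow> compact_op (S - T)"
  using compact_op_add[of S "- T"] by (simp add: compact_op_minus)

lemma compact_op_star:
  assumes T: "compact_op T"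
  shows "compact_op (star T)"
proof (rule compact_opI)
  fix e :: real assume e: "e > 0"
  obtain F where F: "finite F" "\<And>y. y \<in> F \<Longrightarrow> norm y \<le> 1"
    "\<And>x. norm x \<le> 1 \<Longrightarrow> \<exists>y\<in>F. norm (app (T * star T) x - app (T * star T) y) < e\<^sup>2 / 2"
    using compact_opD[OF compact_op_mult_right[OF T, of "star T"], of "e\<^sup>2 / 2"] e by auto
  show "\<exists>G. finite G \<and> (\<forall>x. norm x \<le> 1 \<longrightarrow> (\<exists>g\<in>G. norm (app (star T) x - g) < e))"
  proof (intro exI conjI allI impI)
    show "finite (app (star T) ` F)" using F by simp
    fix x :: 'a assume x: "norm x \<le> 1"
    obtain y where y: "y \<in> F" "norm (app (T * star T) x - app (T * star T) y) < e\<^sup>2 / 2"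
      using F(3)[OF x] by blast
    define z where "z = x - y"
    have z: "norm z \<le> 2" using norm_triangle_ineq4[of x y] x F(2)[OF y(1)] by (simp add: z_def)
    have "(norm (app (star T) z))\<^sup>2 = inner (app T (app (star T) z)) z"
      by (simp add: power2_norm_eq_inner inner_cinner cinner_star)
    also have "\<dots> \<le> norm (app (T * star T) z) * norm z" by (simp add: norm_cauchy_schwarz)
    also have "\<dots> \<le> norm (app (T * star T) z) * 2" using z by (intro mult_left_mono) auto
    also have "\<dots> < e\<^sup>2" using y(2) by (simp add: z_def linear_simps[OF bounded_linear_app])
    finally have "norm (app (star T) z) < e" using e by (simp add: power_less_imp_less_base)
    then show "\<exists>g\<in>app (star T) ` F. norm (app (star T) x - g) < e"
      using y(1) by (auto simp: z_def linear_simps[OF bounded_linear_app])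
  qed
qed

lemma closed_compact_op: "closed {K. compact_op K}"
  unfolding closure_subset_eq[symmetric]
proof safe
  fix T :: "'h::chilbert_space bop"
  assume "T \<in> closure {K. compact_op K}"
  then have A: "\<forall>e>0. \<exists>K\<in>{K. compact_op K}. dist K T < e" by (simp add: closure_approachable)
  show "compact_op T"
  proof (rule compact_opI)
    fix e :: real assume e: "e > 0"
    obtain K where K: "compact_op K" "dist K T < e / 2" using A e half_gt_zero by blast
    obtain F where F: "finite F" "\<And>x. norm x \<le> 1 \<Longrightarrow> \<exists>y\<in>F. norm (app K x - app K y) < e / 2"
      using compact_opD[OF K(1), of "e / 2"] e by auto
    have "\<exists>g\<in>app K ` F. norm (app T x - g) < e" if x: "norm x \<le> 1" for x
    proof -
      obtain y where y: "y \<in> F" "norm (app K x - app K y) < e / 2" using F(2)[OF x] by blast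
      have "norm (app (T - K) x) \<le> norm (T - K) * norm x" by (rule norm_app_le)
      also have "\<dots> \<le> norm (T - K) * 1" using x by (intro mult_left_mono) auto
      also have "\<dots> < e / 2" using K(2) by (simp add: dist_norm norm_minus_commute)
      finally have "norm (app T x - app K x) < e / 2" by simp
      from norm_add_less[OF this y(2)] show ?thesis using y(1) by auto
    qed
    then show "\<exists>G. finite G \<and> (\<forall>x. norm x \<le> 1 \<longrightarrow> (\<exists>g\<in>G. norm (app T x - g) < e))"
      using F(1) by (intro exI[of _ "app K ` F"]) auto
  qed
qed

abbreviation compact_dist :: "'h::chilbert_space bop \<Rightarrow> real"
  where "compact_dist X \<equiv> infdist X {K. compact_op K}"

lemma compact_dist_le: "compact_op K \<Longrightarrow> compact_dist X \<le> norm (X - K)"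
  by (simp add: infdist_le flip: dist_norm)

lemma le_compact_dist:
  assumes "\<And>K. compact_op K \<Longrightarrow> c \<le> a * norm (X - K)" "a \<ge> 0"
  shows "c \<le> a * compact_dist X"
proof (cases "a = 0")
  case True
  then show ?thesis using assms(1)[OF compact_op_0] by simp
next
  case False
  then have a: "a > 0" using assms(2) by simp
  have "c / a \<le> compact_dist X"
  proof -
    have "c / a \<le> (INF K\<in>{K. compact_op K}. dist X K)"
      using compact_op_0 assms(1) a
      by (intro cINF_greatest) (auto simp: pos_divide_le_eq dist_norm mult.commute)
    then show ?thesis using compact_op_0 by (auto simp: infdist_def)
  qed
  then show ?thesis using a by (simp add: pos_divide_le_eq mult.commute)
qed

lemma compact_dist_eq_0_iff: "compact_dist X = 0 \<longleftrightarrow> compact_op X"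
  using in_closed_iff_infdist_zero[OF closed_compact_op, of X] compact_op_0 by auto

lemma compact_dist_triangle: "compact_dist (X + Y) \<le> compact_dist X + compact_dist Y"
proof -
  have "compact_dist (X + Y) \<le> norm (X - K) + norm (Y - L)" if "compact_op K" "compact_op L" for K L
    using compact_dist_le[OF compact_op_add[OF that], of "X + Y"] norm_triangle_ineq[of "X - K" "Y - L"]
    by (simp add: algebra_simps)
  then have "compact_dist (X + Y) - norm (X - K) \<le> 1 * compact_dist Y" if "compact_op K" for K
    using that by (intro le_compact_dist) (auto simp: algebra_simps)
  then have "compact_dist (X + Y) - compact_dist Y \<le> 1 * compact_dist X"
    by (intro le_compact_dist) (auto simp: algebra_simps)
  then show ?thesis by simp
qed

lemma compact_dist_mult: "compact_dist (X * Y) \<le> compact_dist X * compact_dist Y"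
proof -
  have "compact_dist (X * Y) \<le> norm (X - K) * norm (Y - L)" if "compact_op K" "compact_op L" for K L
  proof -
    have "compact_op (K * (Y - L) + X * L)"
      using that by (intro compact_op_add compact_op_mult_left compact_op_mult_right)
    from compact_dist_le[OF this, of "X * Y"]
    have "compact_dist (X * Y) \<le> norm ((X - K) * (Y - L))" by (simp add: algebra_simps)
    then show ?thesis using norm_mult_ineq order_trans by blast
  qed
  then have "compact_dist (X * Y) \<le> norm (X - K) * compact_dist Y" if "compact_op K" for K
    using that by (intro le_compact_dist) auto
  then have "compact_dist (X * Y) \<le> compact_dist Y * compact_dist X"
    by (intro le_compact_dist) (auto simp: mult.commute infdist_nonneg)
  then show ?thesis by (simp add: mult.commute)
qed

lemma compact_dist_scaleC: "compact_dist (c *\<^sub>C X) = cmod c * compact_dist X"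
proof (rule antisym)
  have le: "compact_dist (c *\<^sub>C X) \<le> cmod c * compact_dist X" for c and X :: "'a bop"
  proof (rule le_compact_dist)
    show "compact_dist (c *\<^sub>C X) \<le> cmod c * norm (X - K)" if "compact_op K" for K
      using compact_dist_le[OF compact_op_scaleC[OF that], of "c *\<^sub>C X" c]
      by (metis complex_vector.scale_right_diff_distrib norm_scaleC_star_algebra)
  qed simp
  show "compact_dist (c *\<^sub>C X) \<le> cmod c * compact_dist X" by (rule le)
  show "cmod c * compact_dist X \<le> compact_dist (c *\<^sub>C X)"
  proof (cases "c = 0")
    case False
    then have "inverse c *\<^sub>C c *\<^sub>C X = X" by (simp add: scaleC_scaleC scaleC_one)
    then have "compact_dist X \<le> inverse (cmod c) * compact_dist (c *\<^sub>C X)"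
      using le[of "inverse c" "c *\<^sub>C X"] by (simp only: norm_inverse)
    then show ?thesis using False by (simp add: field_simps)
  qed (simp add: infdist_nonneg)
qed

lemma compact_dist_cong:
  assumes "compact_op (X - Y)"
  shows "compact_dist X = compact_dist Y"
proof -
  have "compact_dist (X - Y) = 0" "compact_dist (Y - X) = 0"
    using assms compact_op_minus[OF assms] by (simp_all only: compact_dist_eq_0_iff minus_diff_eq)
  then show ?thesis
    using compact_dist_triangle[of "X - Y" Y] compact_dist_triangle[of "Y - X" X] by simp
qed

quotient_type (overloaded) 'h calkin = "'h::chilbert_space bop" / "\<lambda>S T. compact_op (S - T)"
  morphisms rep_calkin calkin
proof (rule equivpI)
  show "reflp (\<lambda>S T :: 'h bop. compact_op (S - T))"
    by (simp add: reflp_def compact_op_0)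
  show "symp (\<lambda>S T :: 'h bop. compact_op (S - T))"
    using compact_op_minus by (fastforce simp: symp_def)
  show "transp (\<lambda>S T :: 'h bop. compact_op (S - T))"
    using compact_op_add by (fastforce simp: transp_def)
qed

instantiation calkin :: (chilbert_space) star_algebra
begin

lift_definition zero_calkin :: "'a calkin" is 0 .
lift_definition one_calkin :: "'a calkin" is 1 .
lift_definition plus_calkin :: "'a calkin \<Rightarrow> 'a calkin \<Rightarrow> 'a calkin" is "(+)"
  using compact_op_add by (simp add: add_diff_add)
lift_definition minus_calkin :: "'a calkin \<Rightarrow> 'a calkin \<Rightarrow> 'a calkin" is "(-)"
  by (metis compact_op_diff diff_diff_eq diff_add_eq add.commute diff_diff_eq2)
lift_definition uminus_calkin :: "'a calkin \<Rightarrow> 'a calkin" is uminus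
  using compact_op_minus by (fastforce simp: algebra_simps)
lift_definition times_calkin :: "'a calkin \<Rightarrow> 'a calkin \<Rightarrow> 'a calkin" is "(*)"
proof -
  fix S S' T T' :: "'a bop"
  assume "compact_op (S - S')" "compact_op (T - T')"
  then have "compact_op ((S - S') * T + S' * (T - T'))"
    by (intro compact_op_add compact_op_mult_left compact_op_mult_right)
  then show "compact_op (S * T - S' * T')" by (simp add: algebra_simps)
qed
lift_definition scaleR_calkin :: "real \<Rightarrow> 'a calkin \<Rightarrow> 'a calkin" is scaleR
  by (metis compact_op_scaleR scaleR_right_diff_distrib)
lift_definition scaleC_calkin :: "complex \<Rightarrow> 'a calkin \<Rightarrow> 'a calkin" is scaleC
  by (metis compact_op_scaleC complex_vector.scale_right_diff_distrib)
lift_definition star_calkin :: "'a calkin \<Rightarrow> 'a calkin" is star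
proof -
  fix S T :: "'a bop"
  assume "compact_op (S - T)"
  then have "compact_op (star (S - T))" by (rule compact_op_star)
  moreover have "star S = star (S - T) + star T" by (simp flip: star_add)
  ultimately show "compact_op (star S - star T)" by simp
qed
lift_definition norm_calkin :: "'a calkin \<Rightarrow> real" is "\<lambda>X. infdist X {K. compact_op K}"
  by (rule compact_dist_cong)
definition dist_calkin :: "'a calkin \<Rightarrow> 'a calkin \<Rightarrow> real" where "dist_calkin S T = norm (S - T)"
definition sgn_calkin :: "'a calkin \<Rightarrow> 'a calkin" where "sgn_calkin T = inverse (norm T) *\<^sub>R T"
definition uniformity_calkin :: "('a calkin \<times> 'a calkin) filter"
  where "uniformity_calkin = (INF e\<in>{0 <..}. principal {(x, y). dist x y < e})"
definition open_calkin :: "'a calkin set \<Rightarrow> bool"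
  where "open_calkin U = (\<forall>x\<in>U. eventually (\<lambda>(x', y). x' = x \<longrightarrow> y \<in> U) uniformity)"

lemma calkin_eqI: "S = T \<Longrightarrow> compact_op (S - T)"
  by (simp add: compact_op_0)

instance
proof
  fix S T R :: "'a calkin" and a b :: complex and r q :: real
  show "S + T + R = S + (T + R)" "S + T = T + S" "0 + S = S" "- S + S = 0" "S - T = S + - T"
    by (transfer, rule calkin_eqI, simp)+
  show "r *\<^sub>R (S + T) = r *\<^sub>R S + r *\<^sub>R T" "(r + q) *\<^sub>R S = r *\<^sub>R S + q *\<^sub>R S"
    "r *\<^sub>R q *\<^sub>R S = (r * q) *\<^sub>R S" "1 *\<^sub>R S = S"
    by (transfer, rule calkin_eqI, simp add: scaleR_right_distrib scaleR_left_distrib)+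
  show "a *\<^sub>C (S + T) = a *\<^sub>C S + a *\<^sub>C T" "(a + b) *\<^sub>C S = a *\<^sub>C S + b *\<^sub>C S"
    "a *\<^sub>C b *\<^sub>C S = (a * b) *\<^sub>C S" "1 *\<^sub>C S = S" "r *\<^sub>R S = complex_of_real r *\<^sub>C S"
    by (transfer, rule calkin_eqI,
        simp add: scaleC_add_right scaleC_add_left scaleC_scaleC scaleC_one scaleR_scaleC)+
  show "S * T * R = S * (T * R)" "1 * S = S" "S * 1 = S" "(S + T) * R = S * R + T * R"
    "S * (T + R) = S * T + S * R" "(r *\<^sub>R S) * T = r *\<^sub>R (S * T)" "S * (r *\<^sub>R T) = r *\<^sub>R (S * T)"
    "(a *\<^sub>C S) * T = a *\<^sub>C (S * T)" "S * (a *\<^sub>C T) = a *\<^sub>C (S * T)"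
    by (transfer, rule calkin_eqI,
        simp add: algebra_simps scaleC_mult_left scaleC_mult_right)+
  show "star (star S) = S" "star (S + T) = star S + star T"
    "star (S * T) = star T * star S" "star (a *\<^sub>C S) = cnj a *\<^sub>C star S"
    by (transfer, rule calkin_eqI, simp add: star_star star_add star_mult star_scaleC)+
  show "dist S T = norm (S - T)" by (rule dist_calkin_def)
  show "sgn S = inverse (norm S) *\<^sub>R S" by (rule sgn_calkin_def)
  show "uniformity = (INF e\<in>{0 <..}. principal {(x, y :: 'a calkin). dist x y < e})"
    by (rule uniformity_calkin_def)
  show "open U = (\<forall>x\<in>U. \<forall>\<^sub>F (x', y) in uniformity. x' = x \<longrightarrow> y \<in> U)" for U :: "'a calkin set"
    by (rule open_calkin_def)
  show "norm S = 0 \<longleftrightarrow> S = 0" by transfer (simp add: compact_dist_eq_0_iff)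
  show "norm (S + T) \<le> norm S + norm T" by transfer (rule compact_dist_triangle)
  show "norm (r *\<^sub>R S) = \<bar>r\<bar> * norm S" by transfer (simp add: scaleR_scaleC compact_dist_scaleC)
  show "norm (S * T) \<le> norm S * norm T" by transfer (rule compact_dist_mult)
  show "norm (a *\<^sub>C S) = cmod a * norm S" by transfer (rule compact_dist_scaleC)
qed

end

definition cstar_subalgebra :: "'a::star_algebra set \<Rightarrow> bool"
  where "cstar_subalgebra A \<longleftrightarrow> closed A \<and> 1 \<in> A \<and>
    (\<forall>a\<in>A. \<forall>b\<in>A. a + b \<in> A \<and> a * b \<in> A) \<and> (\<forall>a\<in>A. star a \<in> A \<and> (\<forall>c. c *\<^sub>C a \<in> A))"

definition cstar_gen :: "'a::star_algebra \<Rightarrow> 'a set"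
  where "cstar_gen a = \<Inter>{A. cstar_subalgebra A \<and> a \<in> A}"

definition vec_norm2 :: "complex vec \<Rightarrow> real"
  where "vec_norm2 v = sqrt (Re (v \<bullet>c v))"

definition mat_norm :: "complex mat \<Rightarrow> real"
  where "mat_norm A = (SUP v\<in>{v \<in> carrier_vec (dim_col A). vec_norm2 v \<le> 1}. vec_norm2 (A *\<^sub>v v))"

definition normalized_trace :: "complex mat \<Rightarrow> complex"
  where "normalized_trace A = (\<Sum>i<dim_row A. A $$ (i, i)) / of_nat (dim_row A)"

text \<open>An \<open>m \<times> m\<close> array of \<open>k \<times> k\<close> matrices, respectively of operators, is positive as an operator on
  the \<open>m\<close>-fold direct sum. Inequalities \<open>0 \<le> z\<close> between complex numbers mean that \<open>z\<close> is real and
  nonnegative.\<close>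

definition mat_block_pos :: "nat \<Rightarrow> nat \<Rightarrow> (nat \<Rightarrow> nat \<Rightarrow> complex mat) \<Rightarrow> bool"
  where "mat_block_pos m k Y \<longleftrightarrow>
    (\<forall>v. (\<forall>i<m. v i \<in> carrier_vec k) \<longrightarrow> 0 \<le> (\<Sum>i<m. \<Sum>j<m. (Y i j *\<^sub>v v j) \<bullet>c v i))"

definition bop_block_pos :: "nat \<Rightarrow> (nat \<Rightarrow> nat \<Rightarrow> 'h::chilbert_space bop) \<Rightarrow> bool"
  where "bop_block_pos m Y \<longleftrightarrow> (\<forall>v. 0 \<le> (\<Sum>i<m. \<Sum>j<m. cinner (app (Y i j) (v j)) (v i)))"

text \<open>Completely positive maps from a C*-subalgebra \<open>A\<close> to \<open>M\<^sub>k(\<complex>)\<close>: the positive elements of \<open>M\<^sub>m(A)\<close>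
  are those of the form \<open>X\<^sup>*X\<close>, with entries \<open>\<Sum>l. X\<^sub>l\<^sub>i\<^sup>* X\<^sub>l\<^sub>j\<close>.\<close>

definition cp_to_mat :: "'a::star_algebra set \<Rightarrow> nat \<Rightarrow> ('a \<Rightarrow> complex mat) \<Rightarrow> bool"
  where "cp_to_mat A k \<phi> \<longleftrightarrow>
    (\<forall>a\<in>A. \<phi> a \<in> carrier_mat k k) \<and>
    (\<forall>a\<in>A. \<forall>b\<in>A. \<phi> (a + b) = \<phi> a + \<phi> b) \<and>
    (\<forall>a\<in>A. \<forall>c. \<phi> (c *\<^sub>C a) = c \<cdot>\<^sub>m \<phi> a) \<and>
    (\<forall>m X. (\<forall>i<m. \<forall>j<m. X i j \<in> A) \<longrightarrow>
      mat_block_pos m k (\<lambda>i j. \<phi> (\<Sum>l<m. star (X l i) * X l j)))"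

definition ucp_to_mat :: "'a::star_algebra set \<Rightarrow> nat \<Rightarrow> ('a \<Rightarrow> complex mat) \<Rightarrow> bool"
  where "ucp_to_mat A k \<phi> \<longleftrightarrow> cp_to_mat A k \<phi> \<and> \<phi> 1 = 1\<^sub>m k"

definition cp_from_mat :: "nat \<Rightarrow> (complex mat \<Rightarrow> 'h::chilbert_space bop) \<Rightarrow> bool"
  where "cp_from_mat k \<psi> \<longleftrightarrow>
    (\<forall>X\<in>carrier_mat k k. \<forall>Y\<in>carrier_mat k k. \<psi> (X + Y) = \<psi> X + \<psi> Y) \<and>
    (\<forall>X\<in>carrier_mat k k. \<forall>c. \<psi> (c \<cdot>\<^sub>m X) = c *\<^sub>C \<psi> X) \<and>
    (\<forall>m Y. (\<forall>i<m. \<forall>j<m. Y i j \<in> carrier_mat k k) \<longrightarrow> mat_block_pos m k Y \<longrightarrow>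
      bop_block_pos m (\<lambda>i j. \<psi> (Y i j)))"

definition tracial_state :: "'a::star_algebra set \<Rightarrow> ('a \<Rightarrow> complex) \<Rightarrow> bool"
  where "tracial_state A \<tau> \<longleftrightarrow>
    (\<forall>a\<in>A. \<forall>b\<in>A. \<tau> (a + b) = \<tau> a + \<tau> b) \<and> (\<forall>a\<in>A. \<forall>c. \<tau> (c *\<^sub>C a) = c * \<tau> a) \<and>
    (\<forall>a\<in>A. 0 \<le> \<tau> (star a * a)) \<and> \<tau> 1 = 1 \<and> (\<forall>a\<in>A. \<forall>b\<in>A. \<tau> (a * b) = \<tau> (b * a))"

definition quasidiagonal_trace :: "'a::star_algebra set \<Rightarrow> ('a \<Rightarrow> complex) \<Rightarrow> bool"
  where "quasidiagonal_trace A \<tau> \<longleftrightarrow> tracial_state A \<tau> \<and>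
    (\<exists>k \<phi>. (\<forall>n::nat. ucp_to_mat A (k n) (\<phi> n)) \<and>
      (\<forall>a\<in>A. (\<lambda>n. normalized_trace (\<phi> n a)) \<longlonglongrightarrow> \<tau> a) \<and>
      (\<forall>a\<in>A. \<forall>b\<in>A. (\<lambda>n. mat_norm (\<phi> n (a * b) - \<phi> n a * \<phi> n b)) \<longlonglongrightarrow> 0))"

definition faithful_rep :: "'a::star_algebra set \<Rightarrow> ('a \<Rightarrow> 'k::chilbert_space bop) \<Rightarrow> bool"
  where "faithful_rep A \<rho> \<longleftrightarrow> inj_on \<rho> A \<and>
    (\<forall>a\<in>A. \<forall>b\<in>A. \<rho> (a + b) = \<rho> a + \<rho> b \<and> \<rho> (a * b) = \<rho> a * \<rho> b) \<and>
    (\<forall>a\<in>A. \<rho> (star a) = star (\<rho> a) \<and> (\<forall>c. \<rho> (c *\<^sub>C a) = c *\<^sub>C \<rho> a))"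

text \<open>Nuclearity of a map: approximate factorization, in the point-norm topology, through matrix
  algebras by contractive completely positive maps.\<close>

definition nuclear_map :: "'a::star_algebra set \<Rightarrow> ('a \<Rightarrow> 'k::chilbert_space bop) \<Rightarrow> bool"
  where "nuclear_map A \<theta> \<longleftrightarrow>
    (\<forall>F e. finite F \<and> F \<subseteq> A \<and> e > 0 \<longrightarrow>
      (\<exists>k \<phi> \<psi>. cp_to_mat A k \<phi> \<and> (\<forall>a\<in>A. mat_norm (\<phi> a) \<le> norm a) \<and>
        cp_from_mat k \<psi> \<and> (\<forall>X\<in>carrier_mat k k. norm (\<psi> X) \<le> mat_norm X) \<and>
        (\<forall>a\<in>F. norm (\<psi> (\<phi> a) - \<theta> a) < e)))"

text \<open>A C*-algebra is exact if it has a faithful nuclear representation on some Hilbert space. The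
  space is the type argument; as a hypothesis with a free type variable this says that some
  such space exists.\<close>

definition exact_cstar :: "'k::chilbert_space itself \<Rightarrow> 'a::star_algebra set \<Rightarrow> bool"
  where "exact_cstar _ A \<longleftrightarrow> (\<exists>\<rho> :: 'a \<Rightarrow> 'k bop. faithful_rep A \<rho> \<and> nuclear_map A \<rho>)"

definition is_projection :: "'h::chilbert_space bop \<Rightarrow> bool"
  where "is_projection P \<longleftrightarrow> P * P = P \<and> star P = P"

definition finite_rank :: "'h::chilbert_space bop \<Rightarrow> bool"
  where "finite_rank P \<longleftrightarrow> (\<exists>B. finite B \<and> range (app P) = cspan B)"

definition op_rank :: "'h::chilbert_space bop \<Rightarrow> nat"
  where "op_rank P = cdim (range (app P))"

definition op_le :: "'h::chilbert_space bop \<Rightarrow> 'h bop \<Rightarrow> bool"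
  where "op_le S T \<longleftrightarrow> (\<forall>x. 0 \<le> cinner (app (T - S) x) x)"

definition filtration :: "(nat \<Rightarrow> 'h::chilbert_space bop) \<Rightarrow> bool"
  where "filtration P \<longleftrightarrow> (\<forall>n. is_projection (P n) \<and> finite_rank (P n) \<and> op_le (P n) (P (Suc n))) \<and>
    (\<forall>x. (\<lambda>n. norm (app (P n) x - x)) \<longlonglongrightarrow> 0)"

definition quasidiagonal :: "'h::chilbert_space bop \<Rightarrow> bool"
  where "quasidiagonal T \<longleftrightarrow> (\<exists>Q. filtration Q \<and> (\<lambda>n. norm (T * Q n - Q n * T)) \<longlonglongrightarrow> 0)"

text \<open>An operator \<open>S\<close> leaving a closed subspace \<open>M\<close> invariant is regarded as an operator on \<open>M\<close>. Its
  inverse on \<open>M\<close> is represented by any \<open>R\<close> extending it to the whole space.\<close>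

definition inverse_on :: "'h::chilbert_space set \<Rightarrow> 'h bop \<Rightarrow> 'h bop \<Rightarrow> bool"
  where "inverse_on M S R \<longleftrightarrow> (\<forall>x\<in>M. app R x \<in> M \<and> app S (app R x) = x \<and> app R (app S x) = x)"

definition invertible_on :: "'h::chilbert_space set \<Rightarrow> 'h bop \<Rightarrow> bool"
  where "invertible_on M S \<longleftrightarrow> (\<exists>R. inverse_on M S R)"

definition norm_on :: "'h::chilbert_space set \<Rightarrow> 'h bop \<Rightarrow> real"
  where "norm_on M R = (SUP x\<in>{x \<in> M. norm x \<le> 1}. norm (app R x))"

definition spectrum_on :: "'h::chilbert_space set \<Rightarrow> 'h bop \<Rightarrow> complex set"
  where "spectrum_on M S = {z. \<not> invertible_on M (z *\<^sub>C 1 - S)}"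

definition pseudospectrum_on :: "real \<Rightarrow> 'h::chilbert_space set \<Rightarrow> 'h bop \<Rightarrow> complex set"
  where "pseudospectrum_on \<epsilon> M S = spectrum_on M S \<union>
    {z \<in> - spectrum_on M S. \<exists>R. inverse_on M (z *\<^sub>C 1 - S) R \<and> norm_on M R \<ge> 1 / \<epsilon>}"

definition finite_section_stable :: "(nat \<Rightarrow> 'h::chilbert_space bop) \<Rightarrow> 'h bop \<Rightarrow> bool"
  where "finite_section_stable P T \<longleftrightarrow> (\<exists>n0 C. \<forall>n\<ge>n0. \<exists>R.
    inverse_on (range (app (P n))) (P n * T * P n) R \<and> norm_on (range (app (P n))) R \<le> C)"

definition limsup_sets :: "(nat \<Rightarrow> complex set) \<Rightarrow> complex set"
  where "limsup_sets X = {z. \<exists>x r. (\<forall>n. x n \<in> X n) \<and> strict_mono (r :: nat \<Rightarrow> nat) \<and> (x \<circ> r) \<longlonglongrightarrow> z}"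

text \<open>The identification of the corner \<open>P B(H) P\<close> with a matrix algebra, through a chosen
  orthonormal basis of the range of \<open>P\<close>; its trace does not depend on the choice.\<close>

definition range_onb :: "'h::chilbert_space bop \<Rightarrow> nat \<Rightarrow> 'h"
  where "range_onb P = (SOME e.
    (\<forall>i<op_rank P. \<forall>j<op_rank P. cinner (e i) (e j) = (if i = j then 1 else 0)) \<and>
    cspan (e ` {..<op_rank P}) = range (app P))"

definition corner_mat :: "'h::chilbert_space bop \<Rightarrow> 'h bop \<Rightarrow> complex mat"
  where "corner_mat P X =
    mat (op_rank P) (op_rank P) (\<lambda>(i, j). cinner (app X (range_onb P j)) (range_onb P i))"

definition section_state :: "'h::chilbert_space bop \<Rightarrow> 'h bop \<Rightarrow> complex"
  where "section_state P X = normalized_trace (corner_mat P (P * X * P))"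

end

theory Submission
  imports Defs "Jordan_Normal_Form.Spectral_Radius"
begin

text \<open>A finite rank projection that almost commutes with \<open>T\<close> can be enlarged by orthogonal projections
  \<open>V V\<^sup>*\<close>, where \<open>V : \<complex>\<^sup>k \<rightarrow> H\<close> is an isometry and \<open>V\<^sup>* X V\<close> is close to \<open>\<phi> (\<pi> X)\<close> for an almost
  multiplicative ucp map \<open>\<phi>\<close> on \<open>C\<^sup>*(\<pi>(T))\<close>; such \<open>V\<close> exist by Glimm's lemma, and multiplicativity at
  \<open>T\<^sup>* T\<close> and \<open>T T\<^sup>*\<close> makes \<open>V V\<^sup>*\<close> almost commute with \<open>T\<close>. With many copies of \<open>V\<close> the trace of the
  enlarged projection is dominated by that of \<open>\<phi>\<close>. Alternating such enlargements, over a countable weak-*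
  dense set of quasidiagonal traces, with enlargements that absorb the projections witnessing
  quasidiagonality yields a filtration with \<open>\<parallel>T P\<^sub>n - P\<^sub>n T\<parallel> \<rightarrow> 0\<close>, from which the statements on finite
  sections and pseudospectra follow by perturbation.\<close>

text \<open>Glimm's lemma is proved variationally: a ucp map into matrices is a positive functional
  on matrices over a subalgebra of the Calkin algebra, and tuples of vectors are fitted to it by
  least squares. Two obstacles shape the rest. First, coming close to a witness \<open>Q n\<close>
  of quasidiagonality adds vectors of uncontrolled number and trace. Hence in every step this
  happens before the trace enlargement, which then outweighs all that has accumulated. Second, new
  vectors must be exactly orthogonal to the old projection, or the sum would not be a projection.
  For this reason \<open>block_functional_approx\<close> and \<open>glimm\<close> carry a finite set
  \<open>G\<close> of constraints and \<open>almost_onf\<close> preserves spans; constraints of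
  finite codimension cost nothing because \<open>calkin\<close> annihilates finite rank projections.
  Countably many traces suffice because weak-* convergence is tested on a dense sequence of
  \<open>cstar_gen T\<close>, traces and section states being uniformly Lipschitz.\<close>

lemmas cspan_base = complex_vector.span_base
  and cspan_scale = complex_vector.span_scale
  and cspan_add = complex_vector.span_add
  and cspan_diff = complex_vector.span_diff
  and cspan_mono = complex_vector.span_mono

section \<open>Inner products and bounded operators\<close>

lemma cinner_zero [simp]: "cinner 0 y = 0" "cinner x 0 = 0"
  for x y :: "'a::complex_inner"
  using cinner_scaleC_left[of 0 0 y] cinner_scaleC_right[of x 0 0] by simp_all

lemma cinner_diff_left: "cinner (x - y) z = cinner x z - cinner y z"
  for x y z :: "'a::complex_inner"
  using cinner_add_left[of "x - y" y z] by (simp add: algebra_simps)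

lemma cinner_diff_right: "cinner x (y - z) = cinner x y - cinner x z"
  for x y z :: "'a::complex_inner"
  using cinner_add_right[of x "y - z" z] by (simp add: algebra_simps)

lemma cinner_sum_left: "cinner (\<Sum>i\<in>I. f i) y = (\<Sum>i\<in>I. cinner (f i) y)"
  for y :: "'a::complex_inner"
  by (induction I rule: infinite_finite_induct) (simp_all add: cinner_add_left)

lemma cinner_sum_right: "cinner x (\<Sum>i\<in>I. f i) = (\<Sum>i\<in>I. cinner x (f i))"
  for x :: "'a::complex_inner"
  by (induction I rule: infinite_finite_induct) (simp_all add: cinner_add_right)

lemmas cinner_simps =
  cinner_add_left cinner_add_right cinner_diff_left cinner_diff_right
  cinner_sum_left cinner_sum_right cinner_scaleC_left cinner_scaleC_right

lemma scaleC_simps [simp]: "c *\<^sub>C (0::'a::complex_vector) = 0" "0 *\<^sub>C x = (0::'a::complex_vector)"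
  "1 *\<^sub>C x = (x::'a::complex_vector)"
  by (simp_all add: scaleC_one)

lemma cinner_self: "cinner x x = complex_of_real ((norm x)\<^sup>2)"
  for x :: "'a::complex_inner"
  using cinner_commute[of x x] by (simp add: complex_eq_iff inner_cinner power2_norm_eq_inner)

lemma of_real_cmod_power2: "(complex_of_real (cmod z))\<^sup>2 = z * cnj z"
  by (simp only: of_real_power[symmetric] complex_norm_square)

lemma norm_cinner_le: "cmod (cinner x y) \<le> norm x * norm y"
  for x y :: "'a::complex_inner"
proof (cases "cinner x y = 0")
  case False
  define c where "c = cnj (cinner x y) / cmod (cinner x y)"
  have c: "cmod c = 1" using False by (simp add: c_def norm_divide)
  have "c * cinner x y = (cmod (cinner x y))\<^sup>2 / cmod (cinner x y)"
    by (simp add: c_def of_real_cmod_power2)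
  then have "c * cinner x y = cmod (cinner x y)"
    using False by (simp add: power2_eq_square)
  then have "cmod (cinner x y) = Re (cinner (c *\<^sub>C x) y)" by (simp add: cinner_scaleC_left)
  also have "\<dots> \<le> norm (c *\<^sub>C x) * norm y"
    by (simp add: inner_cinner[symmetric] norm_cauchy_schwarz)
  finally show ?thesis by (simp add: norm_scaleC c)
qed simp

lemma app_0 [simp]: "app S 0 = 0"
  by (rule linear_simps(3)[OF bounded_linear_app])

lemma app_add: "app S (x + y) = app S x + app S y"
  by (rule linear_simps(1)[OF bounded_linear_app])

lemma app_diff: "app S (x - y) = app S x - app S y"
  by (rule linear_simps(2)[OF bounded_linear_app])

lemma app_sum: "app S (\<Sum>i\<in>I. f i) = (\<Sum>i\<in>I. app S (f i))"
  by (induction I rule: infinite_finite_induct) (simp_all add: app_add)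

lemma app_sum_bop: "app (\<Sum>i\<in>I. F i) x = (\<Sum>i\<in>I. app (F i) x)"
  by (induction I rule: infinite_finite_induct) simp_all

lemma norm_bop_le:
  fixes S :: "'h::chilbert_space bop"
  assumes "\<And>x. norm (app S x) \<le> K * norm x" "K \<ge> 0"
  shows "norm S \<le> K"
  unfolding norm_bop_onorm by (rule onorm_bound) (use assms in auto)

lemma bop_exists:
  fixes f :: "'h::chilbert_space \<Rightarrow> 'h"
  assumes "\<And>x y. f (x + y) = f x + f y" "\<And>c x. f (c *\<^sub>C x) = c *\<^sub>C f x" "\<And>x. norm (f x) \<le> K * norm x"
  shows "\<exists>S. app S = f"
proof -
  have bl: "bounded_linear f"
    by (rule bounded_linear_intro[OF assms(1), of K])
      (simp_all add: scaleR_scaleC assms(2,3) mult.commute[of _ K])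
  then have "app (bop_of_blinfun (Blinfun f)) = f"
    by (simp add: app.rep_eq bop_of_blinfun_inverse bounded_linear_Blinfun_apply assms(2))
  then show ?thesis by blast
qed

text \<open>The square root series in \<open>block_sqrt\<close> needs completeness. It is inherited
  from the real bounded operators because complex homogeneity survives pointwise limits.\<close>

instance bop :: (chilbert_space) banach
proof
  fix X :: "nat \<Rightarrow> 'a bop"
  assume X: "Cauchy X"
  have d: "dist (blinfun_of_bop S) (blinfun_of_bop R) = dist S R" for S R :: "'a bop"
    by (simp add: dist_norm norm_bop.rep_eq minus_bop.rep_eq)
  have "Cauchy (\<lambda>n. blinfun_of_bop (X n))"
    using X by (simp add: Cauchy_def d)
  then obtain L where L: "(\<lambda>n. blinfun_of_bop (X n)) \<longlonglongrightarrow> L"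
    using Cauchy_convergent convergent_def by blast
  have Lx: "(\<lambda>n. app (X n) x) \<longlonglongrightarrow> blinfun_apply L x" for x
    using blinfun.tendsto[OF L tendsto_const] by (simp add: app.rep_eq)
  have "blinfun_apply L (c *\<^sub>C x) = c *\<^sub>C blinfun_apply L x" for c x
    using bounded_linear.tendsto[OF bounded_linear_scaleC Lx, of c x] Lx[of "c *\<^sub>C x"]
    by (simp add: app_scaleC LIMSEQ_unique)
  then have "blinfun_of_bop (bop_of_blinfun L) = L" by (simp add: bop_of_blinfun_inverse)
  then have "dist (X n) (bop_of_blinfun L) = dist (blinfun_of_bop (X n)) L" for n
    using d[of "X n" "bop_of_blinfun L"] by simp
  then have "X \<longlonglongrightarrow> bop_of_blinfun L"
    using L unfolding lim_sequentially by simp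
  then show "convergent X" unfolding convergent_def by blast
qed

lemma star_bop_eqI:
  fixes S T :: "'h::chilbert_space bop"
  assumes "\<And>x y. cinner (app T x) y = cinner x (app S y)"
  shows "star T = S"
  using assms by (rule bop_adjoint_unique)

lemma star_simps [simp]:
  "star (0 :: 'a::star_algebra) = 0" "star (1 :: 'a) = 1"
  "star (- a :: 'a) = - star a" "star (a - b :: 'a) = star a - star b"
proof -
  show 0: "star (0 :: 'a) = 0" using star_add[of 0 "0::'a"] by simp
  show "star (1 :: 'a) = 1"
    using star_mult[of 1 "star (1::'a)"] by (simp add: star_star)
  show m: "star (- a :: 'a) = - star a" for a :: 'a
    using star_add[of a "- a"] 0 by (simp add: eq_neg_iff_add_eq_0 add.commute)
  show "star (a - b :: 'a) = star a - star b"
    using star_add[of a "- b"] m[of b] by simp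
qed

lemma star_sum: "star (\<Sum>i\<in>I. f i) = (\<Sum>i\<in>I. star (f i) :: 'a::star_algebra)"
  by (induction I rule: infinite_finite_induct) (simp_all add: star_add)

lemma norm_star [simp]: "norm (star S) = norm S" for S :: "'h::chilbert_space bop"
proof -
  have le: "norm (star S) \<le> norm S" for S :: "'h bop"
  proof (rule norm_bop_le)
    fix x
    have "(norm (app (star S) x))\<^sup>2 = cmod (cinner (app (star S) x) (app (star S) x))"
      by (simp add: cinner_self norm_power)
    also have "\<dots> = cmod (cinner (app S (app (star S) x)) x)" by (simp add: cinner_star)
    also have "\<dots> \<le> norm (app S (app (star S) x)) * norm x" by (rule norm_cinner_le)
    also have "\<dots> \<le> norm S * norm (app (star S) x) * norm x"
      by (intro mult_right_mono norm_app_le) simp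
    finally show "norm (app (star S) x) \<le> norm S * norm x"
      by (cases "norm (app (star S) x) = 0") (simp_all add: power2_eq_square mult_ac)
  qed simp
  show ?thesis using le[of S] le[of "star S"] by (simp add: star_star)
qed

definition rank1 :: "'h::chilbert_space \<Rightarrow> 'h \<Rightarrow> 'h bop"
  where "rank1 x y = (SOME S. \<forall>z. app S z = cinner z y *\<^sub>C x)"

lemma app_rank1 [simp]: "app (rank1 x y) z = cinner z y *\<^sub>C x"
proof -
  have "\<exists>S. app S = (\<lambda>z. cinner z y *\<^sub>C x)"
    by (rule bop_exists[where K = "norm y * norm x"])
      (auto simp: cinner_simps scaleC_add_left scaleC_scaleC norm_scaleC
        intro!: order_trans[OF mult_right_mono[OF norm_cinner_le]])
  then have "\<forall>z. app (rank1 x y) z = cinner z y *\<^sub>C x"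
    unfolding rank1_def by (intro someI_ex[of "\<lambda>S. \<forall>z. app S z = cinner z y *\<^sub>C x"]) (auto simp: fun_eq_iff)
  then show ?thesis by blast
qed

section \<open>Orthonormal families and finite rank projections\<close>

definition onf :: "nat \<Rightarrow> (nat \<Rightarrow> 'h::complex_inner) \<Rightarrow> bool"
  where "onf k e \<longleftrightarrow> (\<forall>i<k. \<forall>j<k. cinner (e i) (e j) = (if i = j then 1 else 0))"

definition span_proj :: "nat \<Rightarrow> (nat \<Rightarrow> 'h::chilbert_space) \<Rightarrow> 'h bop"
  where "span_proj k e = (\<Sum>i<k. rank1 (e i) (e i))"

lemma app_span_proj: "app (span_proj k e) x = (\<Sum>i<k. cinner x (e i) *\<^sub>C e i)"
  by (simp add: span_proj_def app_sum_bop)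

lemma onfD: "onf k e \<Longrightarrow> i < k \<Longrightarrow> j < k \<Longrightarrow> cinner (e i) (e j) = (if i = j then 1 else 0)"
  by (simp add: onf_def)

lemma onf_norm: "onf k e \<Longrightarrow> i < k \<Longrightarrow> norm (e i) = 1"
  using onfD[of k e i i] cinner_self[of "e i"] norm_ge_zero[of "e i"]
  by (simp add: power2_eq_1_iff of_real_eq_1_iff flip: of_real_power)

lemma cinner_onf_sum:
  assumes "onf k e" "j < k"
  shows "cinner (\<Sum>i<k. c i *\<^sub>C e i) (e j) = c j"
proof -
  have "cinner (\<Sum>i<k. c i *\<^sub>C e i) (e j) = (\<Sum>i<k. if i = j then c i else 0)"
    unfolding cinner_sum_left cinner_scaleC_left
    by (rule sum.cong) (use assms in \<open>auto simp: onfD\<close>)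
  then show ?thesis using assms by simp
qed

lemma norm_onf_sum:
  assumes "onf k e"
  shows "(norm (\<Sum>i<k. c i *\<^sub>C e i))\<^sup>2 = (\<Sum>i<k. (cmod (c i))\<^sup>2)"
proof -
  let ?s = "\<Sum>i<k. c i *\<^sub>C e i"
  have "complex_of_real ((norm ?s)\<^sup>2) = (\<Sum>j<k. cnj (c j) * cinner ?s (e j))"
    by (simp only: cinner_self[symmetric] cinner_sum_right cinner_scaleC_right)
  also have "\<dots> = (\<Sum>j<k. cnj (c j) * c j)"
    by (rule sum.cong) (simp_all add: cinner_onf_sum[OF assms])
  also have "\<dots> = complex_of_real (\<Sum>i<k. (cmod (c i))\<^sup>2)"
    by (simp add: of_real_cmod_power2 mult.commute)
  finally show ?thesis using of_real_eq_iff by blast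
qed

lemma cspan_image_sum:
  assumes "x \<in> cspan (e ` {..<k})"
  shows "\<exists>c. x = (\<Sum>i<(k::nat). c i *\<^sub>C (e i :: 'a::complex_vector))"
  using assms
proof (induction rule: complex_vector.span_induct_alt)
  case base
  show ?case by (rule exI[of _ "\<lambda>_. 0"]) simp
next
  case (step a x y)
  then obtain c j where c: "y = (\<Sum>i<k. c i *\<^sub>C e i)" and j: "j < k" "x = e j" by auto
  have "(\<Sum>i<k. (c i + (if i = j then a else 0)) *\<^sub>C e i)
      = (\<Sum>i<k. c i *\<^sub>C e i) + (\<Sum>i<k. if i = j then a *\<^sub>C e i else 0)"
    unfolding sum.distrib[symmetric] by (rule sum.cong) (auto simp: scaleC_add_left)
  then have "a *\<^sub>C x + y = (\<Sum>i<k. (c i + (if i = j then a else 0)) *\<^sub>C e i)"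
    using j c by (simp add: add.commute)
  then show ?case by (intro exI[of _ "\<lambda>i. c i + (if i = j then a else 0)"])
qed

lemma sum_in_cspan: "(\<Sum>i<(k::nat). c i *\<^sub>C (e i :: 'a::complex_vector)) \<in> cspan (e ` {..<k})"
  by (intro complex_vector.span_sum cspan_scale cspan_base) auto

lemma span_proj_fixes:
  assumes "onf k e" "x \<in> cspan (e ` {..<k})"
  shows "app (span_proj k e) x = x"
proof -
  obtain c where "x = (\<Sum>i<k. c i *\<^sub>C e i)" using cspan_image_sum[OF assms(2)] by blast
  then show ?thesis using assms(1) by (simp add: app_span_proj cinner_onf_sum)
qed

lemma span_proj_in_cspan: "app (span_proj k e) x \<in> cspan (e ` {..<k})"
  by (simp add: app_span_proj sum_in_cspan)

lemma range_span_proj: "onf k e \<Longrightarrow> range (app (span_proj k e)) = cspan (e ` {..<k})"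
  using span_proj_in_cspan span_proj_fixes[of k e] by (auto simp: image_iff) metis

lemma is_projection_span_proj:
  assumes "onf k e"
  shows "is_projection (span_proj k e)"
  unfolding is_projection_def
proof
  show "span_proj k e * span_proj k e = span_proj k e"
    by (rule bop_eqI) (simp add: span_proj_fixes[OF assms] span_proj_in_cspan)
  show "star (span_proj k e) = span_proj k e"
    by (rule star_bop_eqI) (simp add: app_span_proj cinner_simps cinner_commute[of _ "e _"] mult.commute)
qed

definition finproj :: "'h::chilbert_space bop \<Rightarrow> bool"
  where "finproj P \<longleftrightarrow> is_projection P \<and> finite_rank P"

lemma finproj_span_proj: "onf k e \<Longrightarrow> finproj (span_proj k e)"
  unfolding finproj_def finite_rank_def by (auto simp: is_projection_span_proj range_span_proj)

text \<open>Each projection fixes the range of the other, so \<open>P * Q = Q\<close> and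
  \<open>Q * P = P\<close>, and these two products are adjoint to each other.\<close>

lemma is_projection_eqI:
  assumes "is_projection P" "is_projection Q" "range (app P) = range (app Q)"
  shows "P = Q"
proof -
  have PQ: "P * Q = Q" if P: "is_projection P" and r: "range (app Q) \<subseteq> range (app P)" for P Q :: "'h::chilbert_space bop"
  proof (rule bop_eqI)
    fix x
    obtain y where y: "app Q x = app P y" using r by blast
    have "app (P * Q) x = app (P * P) y" by (simp add: y)
    also have "\<dots> = app Q x" using P y by (simp add: is_projection_def del: app_bop)
    finally show "app (P * Q) x = app Q x" .
  qed
  have "P * Q = Q" using PQ[of P Q] assms by simp
  moreover have "Q * P = P" using PQ[of Q P] assms by simp
  ultimately show ?thesis using assms by (metis is_projection_def star_mult)
qed

lemma onf_extend_span:
  fixes e :: "nat \<Rightarrow> 'h::chilbert_space"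
  assumes "onf k e" "\<And>i. i < k \<Longrightarrow> cinner r (e i) = 0" "norm r = 1"
  shows "onf (Suc k) (e(k := r))"
  using assms unfolding onf_def
  by (auto simp: less_Suc_eq cinner_self cinner_commute[of "e _" r])

lemma onf_residual:
  assumes "onf k e" "i < k"
  shows "cinner (x - app (span_proj k e) x) (e i) = 0"
  using cinner_onf_sum[OF assms, of "\<lambda>i. cinner x (e i)"] by (simp add: app_span_proj cinner_diff_left)

text \<open>The exchange step of Gram-Schmidt, shared by the exact version \<open>finite_onf\<close>
  and the perturbative version \<open>almost_onf\<close>.\<close>

lemma cspan_insert_residual:
  assumes p: "p \<in> cspan B" and r: "b - p = a *\<^sub>C u" "a \<noteq> 0"
  shows "cspan (insert u B) = cspan (insert b B)"
proof (rule complex_vector.span_eq[THEN iffD2], intro conjI insert_subsetI)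
  have B: "cspan B \<subseteq> cspan (insert b B)" "cspan B \<subseteq> cspan (insert u B)"
    by (auto intro!: cspan_mono)
  show "B \<subseteq> cspan (insert b B)" "B \<subseteq> cspan (insert u B)"
    by (auto intro: cspan_base)
  have "b - p \<in> cspan (insert b B)"
    by (rule cspan_diff) (use p B in \<open>auto intro: cspan_base\<close>)
  then have "inverse a *\<^sub>C (a *\<^sub>C u) \<in> cspan (insert b B)"
    unfolding r(1) by (rule cspan_scale)
  then show "u \<in> cspan (insert b B)" using r(2) by (simp add: scaleC_scaleC)
  have "b = a *\<^sub>C u + p" using r(1) by (simp add: algebra_simps)
  moreover have "a *\<^sub>C u \<in> cspan (insert u B)"
    by (intro cspan_scale cspan_base) simp
  ultimately show "b \<in> cspan (insert u B)" using p B by (auto intro: cspan_add)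
qed

lemma finite_onf:
  assumes "finite (B :: 'h::chilbert_space set)"
  shows "\<exists>k e. onf k e \<and> cspan (e ` {..<k}) = cspan B"
  using assms
proof (induction B)
  case empty
  show ?case by (rule exI[of _ 0]) (simp add: onf_def)
next
  case (insert b B)
  then obtain k e where e: "onf k e" "cspan (e ` {..<k}) = cspan B" by blast
  define p where "p = app (span_proj k e) b"
  define r where "r = b - p"
  have p: "p \<in> cspan B" unfolding p_def using span_proj_in_cspan e(2) by blast
  show ?case
  proof (cases "r = 0")
    case True
    then have "b \<in> cspan B" using p by (simp add: r_def)
    then show ?thesis using e complex_vector.span_redundant by metis
  next
    case False
    define u where "u = complex_of_real (inverse (norm r)) *\<^sub>C r"
    have u: "norm u = 1" unfolding u_def using False by (simp add: norm_scaleC norm_inverse)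
    have b: "b - p = complex_of_real (norm r) *\<^sub>C u"
      using False by (simp add: u_def scaleC_scaleC r_def)
    have on: "onf (Suc k) (e(k := u))"
      using u onf_residual[OF e(1)] by (intro onf_extend_span e) (auto simp: u_def r_def p_def cinner_scaleC_left)
    have im: "(e(k := u)) ` {..<Suc k} = insert u (e ` {..<k})"
      by (auto simp: less_Suc_eq)
    have "cspan (insert u (e ` {..<k})) = cspan (insert u B)"
      using e(2) by (metis complex_vector.span_insert)
    also have "\<dots> = cspan (insert b B)"
      by (rule cspan_insert_residual[OF p b]) (use False in simp)
    finally show ?thesis using on im by metis
  qed
qed

lemma finprojE:
  assumes "finproj P"
  obtains k e where "onf k e" "P = span_proj k e"
proof -
  obtain B where B: "finite B" "range (app P) = cspan B"
    using assms unfolding finproj_def finite_rank_def by blast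
  obtain k e where e: "onf k e" "cspan (e ` {..<k}) = cspan B" using finite_onf[OF B(1)] by blast
  have "P = span_proj k e"
    using assms e B(2) by (intro is_projection_eqI) (auto simp: finproj_def is_projection_span_proj range_span_proj)
  then show ?thesis using that e by blast
qed

lemma finite_onf_proj:
  assumes "finite (B :: 'h::chilbert_space set)"
  obtains P where "finproj P" "range (app P) = cspan B"
  using finite_onf[OF assms] finproj_span_proj range_span_proj by metis

lemma projection_idem: "is_projection P \<Longrightarrow> app P (app P x) = app P x"
  unfolding is_projection_def by (metis app_bop(6))

lemma projection_sa: "is_projection P \<Longrightarrow> cinner (app P x) y = cinner x (app P y)"
  unfolding is_projection_def by (metis cinner_star)

lemma finproj_sa: "finproj P \<Longrightarrow> cinner (app P x) y = cinner x (app P y)"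
  by (simp add: finproj_def projection_sa)

lemma csubspace_range_app: "csubspace (range (app S))"
proof (rule complex_vector.subspaceI)
  show "0 \<in> range (app S)" by (metis app_0 rangeI)
  show "x + y \<in> range (app S)" if "x \<in> range (app S)" "y \<in> range (app S)" for x y
    using that by (auto simp flip: app_add)
  show "c *\<^sub>C x \<in> range (app S)" if "x \<in> range (app S)" for c x
    using that by (auto simp flip: app_scaleC)
qed

text \<open>\<open>finite_rank\<close> asks for a finite set whose span is exactly the range. The
  image of \<open>B\<close> under \<open>P\<close> is such a set because \<open>P\<close> fixes its
  range.\<close>

lemma finite_rank_subset:
  assumes P: "is_projection P" and B: "finite B" "range (app P) \<subseteq> cspan B"
  shows "finite_rank P"
proof -
  have sub: "csubspace {x. app P x \<in> cspan (app P ` B)}"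
    by (rule complex_vector.subspaceI)
      (auto simp: app_add app_scaleC intro: cspan_add cspan_scale complex_vector.span_zero)
  have "app P x \<in> cspan (app P ` B)" if "x \<in> cspan B" for x
    using that sub by (rule complex_vector.span_induct) (auto intro: cspan_base)
  moreover have "app P x = app P (app P x)" for x using P by (metis app_bop(6) is_projection_def)
  ultimately have "range (app P) \<subseteq> cspan (app P ` B)" using B(2)
    by (metis image_subset_iff)
  moreover have "cspan (app P ` B) \<subseteq> range (app P)"
    by (intro complex_vector.span_minimal csubspace_range_app) auto
  ultimately show ?thesis unfolding finite_rank_def using B(1) by (intro exI[of _ "app P ` B"]) auto
qed

text \<open>Sums and differences of projections share this argument. Quantifying over all
  \<open>V\<close> says that \<open>app R x\<close> is a combination of \<open>app P x\<close> and
  \<open>app Q x\<close> without naming the combination.\<close>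

lemma finite_rank_pointwise:
  assumes P: "finproj P" and Q: "finproj Q" and R: "is_projection R"
    and span: "\<And>V x. app P x \<in> cspan V \<Longrightarrow> app Q x \<in> cspan V \<Longrightarrow> app R x \<in> cspan V"
  shows "finite_rank R"
proof -
  obtain A B where A: "finite A" "range (app P) = cspan A" and B: "finite B" "range (app Q) = cspan B"
    using P Q unfolding finproj_def finite_rank_def by blast
  have "app R x \<in> cspan (A \<union> B)" for x
    using A B by (intro span) (metis cspan_mono rangeI subsetD sup_ge1 sup_ge2)+
  then show ?thesis using A B by (intro finite_rank_subset[OF R, of "A \<union> B"]) auto
qed

lemma finproj_add:
  assumes P: "finproj P" and Q: "finproj Q" and PQ: "P * Q = 0"
  shows "finproj (P + Q)"
  unfolding finproj_def
proof
  have "Q * P = star (P * Q)" using P Q by (simp add: star_mult finproj_def is_projection_def)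
  then have QP: "Q * P = 0" by (simp add: PQ)
  show pr: "is_projection (P + Q)"
    using P Q PQ QP by (simp add: finproj_def is_projection_def star_add algebra_simps)
  show "finite_rank (P + Q)"
    by (rule finite_rank_pointwise[OF P Q pr]) (auto intro: cspan_add)
qed

lemma finproj_diff:
  assumes P: "finproj P" and Q: "finproj Q" and PQ: "P * Q = Q"
  shows "finproj (P - Q)"
  unfolding finproj_def
proof
  have QP: "Q * P = Q" using P Q PQ by (metis finproj_def is_projection_def star_mult)
  show pr: "is_projection (P - Q)"
    using P Q PQ QP by (simp add: finproj_def is_projection_def algebra_simps)
  show "finite_rank (P - Q)"
    by (rule finite_rank_pointwise[OF P Q pr]) (auto intro: cspan_diff)
qed

lemma norm_projection_le: "is_projection P \<Longrightarrow> norm P \<le> 1"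
proof (rule norm_bop_le)
  fix x assume P: "is_projection P"
  have "(norm (app P x))\<^sup>2 = cmod (cinner (app P x) (app P x))" by (simp add: cinner_self norm_power)
  also have "\<dots> = cmod (cinner (app P x) x)" by (simp add: projection_sa[OF P] projection_idem[OF P])
  also have "\<dots> \<le> norm (app P x) * norm x" by (rule norm_cinner_le)
  finally show "norm (app P x) \<le> 1 * norm x"
    by (cases "norm (app P x) = 0") (simp_all add: power2_eq_square)
qed simp

lemma norm_compl_projection_le: "is_projection P \<Longrightarrow> norm (1 - P) \<le> 1"
  by (rule norm_projection_le) (simp add: is_projection_def algebra_simps)

lemma op_le_projI:
  assumes "is_projection P" "is_projection Q" "Q * P = P"
  shows "op_le P Q"
proof -
  have "P * Q = P" using assms by (metis is_projection_def star_mult)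
  then have pr: "is_projection (Q - P)" using assms by (simp add: is_projection_def algebra_simps)
  have "cinner (app (Q - P) x) x = complex_of_real ((norm (app (Q - P) x))\<^sup>2)" for x
  proof -
    have "cinner (app (Q - P) x) x = cinner (app (star (Q - P) * (Q - P)) x) x"
      using pr by (simp add: is_projection_def)
    also have "\<dots> = cinner (app (Q - P) x) (app (Q - P) x)"
      by (simp only: cinner_star' app_bop(6) star_star)
    finally show ?thesis by (simp only: cinner_self)
  qed
  then show ?thesis unfolding op_le_def by (simp add: less_eq_complex_def)
qed

subsection \<open>Traces of compressions\<close>

lemma op_rank_span_proj:
  assumes "onf k e"
  shows "op_rank (span_proj k e) = k"
proof -
  have inj: "inj_on e {..<k}"
    using assms by (auto simp: onf_def inj_on_def) (metis zero_neq_one)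
  have ind: "\<not> cdependent (e ` {..<k})"
  proof (rule complex_vector.independent_if_scalars_zero)
    fix f x assume f: "(\<Sum>x\<in>e ` {..<k}. f x *\<^sub>C x) = 0" and "x \<in> e ` {..<k}"
    then obtain j where j: "j < k" "x = e j" by auto
    have "(\<Sum>i<k. f (e i) *\<^sub>C e i) = 0" using f inj by (simp add: sum.reindex)
    then show "f x = 0" using cinner_onf_sum[OF assms j(1), of "\<lambda>i. f (e i)"] j by simp
  qed simp
  have "op_rank (span_proj k e) = card (e ` {..<k})"
    unfolding op_rank_def range_span_proj[OF assms]
    by (rule complex_vector.dim_span_eq_card_independent[OF ind])
  then show ?thesis using inj by (simp add: card_image)
qed

lemma sum_lessThan_add: "(\<Sum>i<k + l. g i) = (\<Sum>i<k. g i) + (\<Sum>i<l. g (k + i :: nat) :: 'a::comm_monoid_add)"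
  by (induction l) (simp_all add: add.assoc)

text \<open>The unnormalized trace of \<open>P * X * P\<close>. Unlike \<open>section_state\<close>
  it is additive over orthogonal projections, so contributions of successive enlargements can be
  summed.\<close>

definition ptrace :: "'h::chilbert_space bop \<Rightarrow> 'h bop \<Rightarrow> complex"
  where "ptrace P X = (\<Sum>i<op_rank P. cinner (app X (range_onb P i)) (range_onb P i))"

lemma range_onb_onf:
  assumes "finproj P"
  shows "onf (op_rank P) (range_onb P)" "span_proj (op_rank P) (range_onb P) = P"
proof -
  obtain k e where e: "onf k e" "P = span_proj k e" using finprojE[OF assms] by blast
  have k: "op_rank P = k" using e op_rank_span_proj by blast
  have "(\<forall>i<op_rank P. \<forall>j<op_rank P. cinner (range_onb P i) (range_onb P j) = (if i = j then 1 else 0)) \<and>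
      cspan (range_onb P ` {..<op_rank P}) = range (app P)"
    unfolding range_onb_def
    by (rule someI[where x = e]) (use e k in \<open>simp add: onf_def range_span_proj\<close>)
  then show *: "onf (op_rank P) (range_onb P)"
    and "span_proj (op_rank P) (range_onb P) = P"
    using assms by (auto simp: onf_def finproj_def simp flip: range_span_proj
        intro!: is_projection_eqI is_projection_span_proj)
qed

text \<open>\<open>range_onb\<close> is an arbitrary choice. Expanding the two families in each
  other frees computations from it; a sum of orthogonal projections can then use the concatenated
  basis.\<close>

lemma onf_trace_indep:
  assumes e: "onf k e" and b: "onf m b" and eq: "span_proj k e = span_proj m b"
  shows "(\<Sum>i<k. cinner (app X (e i)) (e i)) = (\<Sum>i<m. cinner (app X (b i)) (b i))"
proof -
  have eb: "e i = (\<Sum>j<m. cinner (e i) (b j) *\<^sub>C b j)" if "i < k" for i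
  proof -
    have "app (span_proj k e) (e i) = e i"
      using that by (intro span_proj_fixes e cspan_base) auto
    then show ?thesis using eq by (simp add: app_span_proj)
  qed
  have be: "b j = (\<Sum>i<k. cinner (b j) (e i) *\<^sub>C e i)" if "j < m" for j
  proof -
    have "app (span_proj k e) (b j) = b j"
      unfolding eq using that by (intro span_proj_fixes b cspan_base) auto
    then show ?thesis by (simp add: app_span_proj)
  qed
  have "(\<Sum>i<k. cinner (app X (e i)) (e i)) = (\<Sum>i<k. \<Sum>j<m. cinner (e i) (b j) * cinner (app X (b j)) (e i))"
  proof (rule sum.cong)
    fix i assume "i \<in> {..<k}"
    then have "app X (e i) = (\<Sum>j<m. cinner (e i) (b j) *\<^sub>C app X (b j))"
      using eb[of i] by (metis (no_types, lifting) app_scaleC app_sum lessThan_iff sum.cong)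
    then show "cinner (app X (e i)) (e i) = (\<Sum>j<m. cinner (e i) (b j) * cinner (app X (b j)) (e i))"
      by (simp add: cinner_sum_left cinner_scaleC_left)
  qed simp
  also have "\<dots> = (\<Sum>j<m. \<Sum>i<k. cinner (e i) (b j) * cinner (app X (b j)) (e i))"
    by (rule sum.swap)
  also have "\<dots> = (\<Sum>j<m. cinner (app X (b j)) (b j))"
  proof (rule sum.cong)
    fix j assume "j \<in> {..<m}"
    then have "cinner (app X (b j)) (b j) = cinner (app X (b j)) (\<Sum>i<k. cinner (b j) (e i) *\<^sub>C e i)"
      using be[of j] by simp
    also have "\<dots> = (\<Sum>i<k. cinner (e i) (b j) * cinner (app X (b j)) (e i))"
      by (simp add: cinner_sum_right cinner_scaleC_right cinner_commute[of "e _" "b j"])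
    finally show "(\<Sum>i<k. cinner (e i) (b j) * cinner (app X (b j)) (e i)) = cinner (app X (b j)) (b j)" ..
  qed simp
  finally show ?thesis .
qed

lemma ptrace_span_proj:
  assumes "onf k e"
  shows "ptrace (span_proj k e) X = (\<Sum>i<k. cinner (app X (e i)) (e i))"
  unfolding ptrace_def
  using range_onb_onf[OF finproj_span_proj[OF assms]] by (intro onf_trace_indep assms) auto

lemma section_state_ptrace:
  assumes "finproj P"
  shows "section_state P X = ptrace P X / of_nat (op_rank P)"
proof -
  have "cinner (app (P * X * P) (range_onb P i)) (range_onb P i) = cinner (app X (range_onb P i)) (range_onb P i)"
    if "i < op_rank P" for i
  proof -
    have "app P (range_onb P i) = range_onb P i"
      using span_proj_fixes[OF range_onb_onf(1)[OF assms]] range_onb_onf(2)[OF assms] that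
      by (metis cspan_base imageI lessThan_iff)
    then show ?thesis by (simp add: finproj_sa[OF assms])
  qed
  then show ?thesis
    by (simp add: section_state_def normalized_trace_def corner_mat_def ptrace_def cong: sum.cong_simp)
qed

lemma finproj_orthogonal_basis:
  assumes e: "onf k e" and f: "onf l f" and ef: "\<And>i j. i < k \<Longrightarrow> j < l \<Longrightarrow> cinner (e i) (f j) = 0"
  defines "g \<equiv> \<lambda>i. if i < k then e i else f (i - k)"
  shows "onf (k + l) g" "span_proj k e + span_proj l f = span_proj (k + l) g"
    "span_proj k e * span_proj l f = 0"
proof -
  have fe: "cinner (f j) (e i) = 0" if "i < k" "j < l" for i j
    using ef[OF that] cinner_commute[of "f j" "e i"] by simp
  show "onf (k + l) g" unfolding onf_def g_def
    using e f ef fe by (auto simp: onf_def)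
  show "span_proj k e + span_proj l f = span_proj (k + l) g"
    by (simp add: span_proj_def g_def sum_lessThan_add)
  show "span_proj k e * span_proj l f = 0"
    by (rule bop_eqI) (simp add: app_span_proj cinner_sum_left cinner_scaleC_left fe)
qed

lemma ptrace_add:
  assumes P: "finproj P" and Q: "finproj Q" and PQ: "P * Q = 0"
  shows "ptrace (P + Q) X = ptrace P X + ptrace Q X" "op_rank (P + Q) = op_rank P + op_rank Q"
proof -
  obtain k e where e: "onf k e" "P = span_proj k e" using finprojE[OF P] by blast
  obtain l f where f: "onf l f" "Q = span_proj l f" using finprojE[OF Q] by blast
  have ef: "cinner (e i) (f j) = 0" if "i < k" "j < l" for i j
  proof -
    have "app P (e i) = e i" "app Q (f j) = f j"
      using e f that by (auto intro!: span_proj_fixes cspan_base)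
    then have "cinner (e i) (f j) = cinner (e i) (app (P * Q) (f j))"
      by (metis P app_bop(6) finproj_sa)
    then show ?thesis by (simp add: PQ)
  qed
  note g = finproj_orthogonal_basis[OF e(1) f(1) ef]
  show "op_rank (P + Q) = op_rank P + op_rank Q"
    using g e f by (simp add: op_rank_span_proj)
  show "ptrace (P + Q) X = ptrace P X + ptrace Q X"
    using g e f by (simp add: ptrace_span_proj sum_lessThan_add)
qed

text \<open>Gram-Schmidt moves an almost orthonormal family only slightly. Keeping the span matters:
  in \<open>filtration_dominate\<close> the new vectors must stay in the range of
  \<open>Q n\<close>, in \<open>glimm\<close> they must stay orthogonal to \<open>G\<close>.\<close>

lemma almost_onf:
  fixes k :: nat
  assumes "\<epsilon> > 0"
  shows "\<exists>\<delta>>0. \<forall>x :: nat \<Rightarrow> 'h::chilbert_space.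
    (\<forall>i<k. \<forall>j<k. cmod (cinner (x i) (x j) - (if i = j then 1 else 0)) \<le> \<delta>) \<longrightarrow>
    (\<exists>f. onf k f \<and> (\<forall>i<k. norm (f i - x i) \<le> \<epsilon>) \<and> cspan (f ` {..<k}) = cspan (x ` {..<k}))"
  using assms
proof (induction k arbitrary: \<epsilon>)
  case 0
  show ?case by (rule exI[of _ 1]) (auto simp: onf_def)
next
  case (Suc k)
  \<comment> \<open>The last vector moves by at most \<open>7 * (real k + 1) * \<epsilon>2\<close>:
    3 for subtracting its projection and 4 for normalizing, so 12 leaves room. The second bound in
    \<open>\<epsilon>2\<close> keeps the norm of the residual at least 3/4.\<close>
  define \<epsilon>' where "\<epsilon>' = \<epsilon> / (12 * (real k + 1))"
  have e': "\<epsilon>' > 0" "12 * (real k + 1) * \<epsilon>' \<le> \<epsilon>"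
    using Suc.prems by (simp_all add: \<epsilon>'_def)
  have "1 * \<epsilon>' \<le> 12 * (real k + 1) * \<epsilon>'" using e'(1) by (intro mult_right_mono) auto
  then have e'3: "\<epsilon>' \<le> \<epsilon>" using e'(2) by simp
  define \<epsilon>2 where "\<epsilon>2 = min \<epsilon>' (1 / (16 * (real k + 1)))"
  have e2: "\<epsilon>2 > 0" "\<epsilon>2 \<le> \<epsilon>'" "\<epsilon>2 \<le> 1 / (16 * (real k + 1))" using e' by (auto simp: \<epsilon>2_def)
  obtain \<delta>1 where d1: "\<delta>1 > 0" and IH: "\<And>x :: nat \<Rightarrow> 'h.
    (\<forall>i<k. \<forall>j<k. cmod (cinner (x i) (x j) - (if i = j then 1 else 0)) \<le> \<delta>1) \<Longrightarrow>
    (\<exists>f. onf k f \<and> (\<forall>i<k. norm (f i - x i) \<le> \<epsilon>2) \<and> cspan (f ` {..<k}) = cspan (x ` {..<k}))"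
    using Suc.IH[OF e2(1)] by blast
  define \<delta> where "\<delta> = min \<delta>1 \<epsilon>2"
  have d: "\<delta> > 0" "\<delta> \<le> \<delta>1" "\<delta> \<le> \<epsilon>2" using d1 e2 by (auto simp: \<delta>_def)
  have e2': "\<epsilon>2 \<le> 1/16" using e2(3) by (rule order_trans) (simp add: field_simps)
  have ke: "(real k + 1) * \<epsilon>2 \<le> 1/16" using e2(3) by (simp add: field_simps)
  show ?case
  proof (intro exI[of _ \<delta>] conjI allI impI d(1))
    fix x :: "nat \<Rightarrow> 'h"
    assume x: "\<forall>i<Suc k. \<forall>j<Suc k. cmod (cinner (x i) (x j) - (if i = j then 1 else 0)) \<le> \<delta>"
    have "\<forall>i<k. \<forall>j<k. cmod (cinner (x i) (x j) - (if i = j then 1 else 0)) \<le> \<delta>1"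
      using x d(2) by (meson less_Suc_eq order_trans)
    then obtain f where f: "onf k f" "\<And>i. i < k \<Longrightarrow> norm (f i - x i) \<le> \<epsilon>2"
      "cspan (f ` {..<k}) = cspan (x ` {..<k})" using IH by blast
    have nx: "\<bar>(norm (x k))\<^sup>2 - 1\<bar> \<le> \<delta>"
    proof -
      have "cmod (cinner (x k) (x k) - 1) \<le> \<delta>" using x by force
      moreover have "cinner (x k) (x k) - 1 = complex_of_real ((norm (x k))\<^sup>2 - 1)"
        by (simp add: cinner_self)
      ultimately show ?thesis by (metis norm_of_real)
    qed
    have nx1: "\<bar>norm (x k) - 1\<bar> \<le> \<delta>"
    proof -
      have "\<bar>norm (x k) - 1\<bar> * 1 \<le> \<bar>norm (x k) - 1\<bar> * (norm (x k) + 1)" by (intro mult_left_mono) auto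
      also have "\<dots> = \<bar>(norm (x k) - 1) * (norm (x k) + 1)\<bar>" by (simp add: abs_mult)
      also have "\<dots> = \<bar>(norm (x k))\<^sup>2 - 1\<bar>" by (simp add: power2_eq_square algebra_simps)
      finally show ?thesis using nx by simp
    qed
    have c: "cmod (cinner (x k) (f i)) \<le> 3 * \<epsilon>2" if i: "i < k" for i
    proof -
      have "cmod (cinner (x k) (x i)) \<le> \<delta>" using x[rule_format, of k i] i by simp
      moreover have "cmod (cinner (x k) (f i - x i)) \<le> 2 * \<epsilon>2"
        using norm_cinner_le[of "x k" "f i - x i"] f(2)[OF i] nx1 d(3) e2'
        by (elim order_trans) (intro mult_mono, auto)
      moreover have "cinner (x k) (f i) = cinner (x k) (x i) + cinner (x k) (f i - x i)"
        by (simp add: cinner_diff_right)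
      ultimately show ?thesis using norm_triangle_ineq[of "cinner (x k) (x i)" "cinner (x k) (f i - x i)"] d(3) by simp
    qed
    define p where "p = app (span_proj k f) (x k)"
    define r where "r = x k - p"
    have np: "norm p \<le> 3 * (real k + 1) * \<epsilon>2"
    proof -
      have "norm p \<le> (\<Sum>i<k. norm (cinner (x k) (f i) *\<^sub>C f i))"
        unfolding p_def app_span_proj by (rule norm_sum)
      also have "\<dots> \<le> (\<Sum>i<k. 3 * \<epsilon>2)"
        by (rule sum_mono) (simp add: norm_scaleC onf_norm[OF f(1)] c)
      also have "\<dots> \<le> 3 * (real k + 1) * \<epsilon>2" using e2 by (simp add: algebra_simps)
      finally show ?thesis .
    qed
    have nr: "\<bar>norm r - 1\<bar> \<le> 4 * (real k + 1) * \<epsilon>2"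
    proof -
      have "\<bar>norm r - norm (x k)\<bar> \<le> norm p" using norm_triangle_ineq3[of r "x k"] by (simp add: r_def)
      moreover have "1 * \<epsilon>2 \<le> (real k + 1) * \<epsilon>2" using e2(1) by (intro mult_right_mono) auto
      then have "\<delta> \<le> (real k + 1) * \<epsilon>2" using d(3) by simp
      ultimately show ?thesis using np nx1 by (simp add: algebra_simps)
    qed
    then have rpos: "norm r > 0" using ke by (auto simp: abs_le_iff algebra_simps)
    define u where "u = complex_of_real (inverse (norm r)) *\<^sub>C r"
    have ru: "r = complex_of_real (norm r) *\<^sub>C u" using rpos by (simp add: u_def scaleC_scaleC)
    have un: "norm u = 1" unfolding u_def using rpos by (simp add: norm_scaleC norm_inverse)
    have on: "onf (Suc k) (f(k := u))"
      using un onf_residual[OF f(1)] by (intro onf_extend_span f) (auto simp: u_def r_def p_def cinner_scaleC_left)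
    have "u - r = complex_of_real (1 - norm r) *\<^sub>C u"
      by (subst ru) (simp add: complex_vector.scale_left_diff_distrib)
    then have "norm (u - r) = \<bar>norm r - 1\<bar>" using un by (simp only: norm_scaleC norm_of_real) simp
    then have "norm (u - x k) \<le> 4 * (real k + 1) * \<epsilon>2 + 3 * (real k + 1) * \<epsilon>2"
      using norm_triangle_ineq4[of "u - r" p] nr np by (simp add: r_def algebra_simps)
    also have "\<dots> \<le> 12 * (real k + 1) * \<epsilon>'" using e2(1,2) by (simp add: algebra_simps mult_mono add_mono)
    finally have ux: "norm (u - x k) \<le> \<epsilon>" using e'(2) by linarith
    have im: "(f(k := u)) ` {..<Suc k} = insert u (f ` {..<k})" "x ` {..<Suc k} = insert (x k) (x ` {..<k})"
      by (auto simp: less_Suc_eq)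
    have "cspan (insert u (f ` {..<k})) = cspan (insert u (x ` {..<k}))"
      using f(3) by (metis complex_vector.span_insert)
    also have "\<dots> = cspan (insert (x k) (x ` {..<k}))"
    proof (rule cspan_insert_residual)
      show "p \<in> cspan (x ` {..<k})" unfolding p_def f(3)[symmetric] by (rule span_proj_in_cspan)
      show "x k - p = complex_of_real (norm r) *\<^sub>C u" using ru by (simp add: r_def)
    qed (use rpos in simp)
    finally have "cspan ((f(k := u)) ` {..<Suc k}) = cspan (x ` {..<Suc k})" by (simp only: im)
    moreover have "\<forall>i<Suc k. norm ((f(k := u)) i - x i) \<le> \<epsilon>"
      using ux f(2) e2(2) e'3 by (force simp: less_Suc_eq)
    ultimately show "\<exists>f. onf (Suc k) f \<and> (\<forall>i<Suc k. norm (f i - x i) \<le> \<epsilon>) \<and> cspan (f ` {..<Suc k}) = cspan (x ` {..<Suc k})"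
      using on by blast
  qed
qed

lemma norm_span_proj_diff:
  assumes e: "onf k e" and f: "onf k f" and d: "\<And>i. i < k \<Longrightarrow> norm (e i - f i) \<le> \<epsilon>" and "\<epsilon> \<ge> 0"
  shows "norm (span_proj k e - span_proj k f) \<le> 2 * real k * \<epsilon>"
proof (rule norm_bop_le)
  fix x
  have "app (span_proj k e - span_proj k f) x
      = (\<Sum>i<k. cinner x (e i) *\<^sub>C (e i - f i) + cinner x (e i - f i) *\<^sub>C f i)"
    by (simp add: app_span_proj sum_subtractf[symmetric] cinner_diff_right
        complex_vector.scale_right_diff_distrib complex_vector.scale_left_diff_distrib)
  also have "norm \<dots> \<le> (\<Sum>i<k. 2 * \<epsilon> * norm x)"
  proof (rule order_trans[OF norm_sum], rule sum_mono, rule order_trans[OF norm_triangle_ineq])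
    fix i assume "i \<in> {..<k}"
    then have i: "i < k" by simp
    have "cmod (cinner x (e i)) * norm (e i - f i) \<le> norm x * \<epsilon>"
      using norm_cinner_le[of x "e i"] d[OF i] onf_norm[OF e i] by (intro mult_mono) auto
    moreover have "cmod (cinner x (e i - f i)) \<le> norm x * \<epsilon>"
      using norm_cinner_le[of x "e i - f i"] d[OF i] by (meson mult_left_mono norm_ge_zero order_trans)
    ultimately show "norm (cinner x (e i) *\<^sub>C (e i - f i)) + norm (cinner x (e i - f i) *\<^sub>C f i) \<le> 2 * \<epsilon> * norm x"
      unfolding norm_scaleC using onf_norm[OF f i] by (simp add: algebra_simps)
  qed
  finally show "norm (app (span_proj k e - span_proj k f) x) \<le> 2 * real k * \<epsilon> * norm x" by simp
qed (use assms in simp)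

lemma filtrationD:
  assumes "filtration Q"
  shows "finproj (Q n)" "(\<lambda>n. app (Q n) x) \<longlonglongrightarrow> x"
  using assms unfolding filtration_def finproj_def by (auto simp: LIM_zero_iff tendsto_norm_zero_iff intro: LIM_zero_cancel)

text \<open>If \<open>R\<close> projects onto \<open>Q\<^sub>n P H\<close>, then \<open>Q\<^sub>n - R\<close> is exactly orthogonal to \<open>P\<close>, because
  \<open>x = Q\<^sub>n x\<close> implies \<open>(x, P y) = (x, Q\<^sub>n P y)\<close>. So \<open>P + (Q\<^sub>n - R)\<close> is a projection near \<open>Q\<^sub>n\<close>.\<close>

lemma filtration_dominate:
  assumes Q: "filtration Q" and P: "finproj P" and "\<epsilon> > 0"
  shows "\<exists>n\<ge>N. \<exists>P'. finproj P' \<and> P' * P = P \<and> norm (P' - Q n) < \<epsilon>"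
proof -
  obtain k e where e: "onf k e" "P = span_proj k e" using finprojE[OF P] by blast
  \<comment> \<open>The vectors \<open>e i\<close> and \<open>f i\<close> will differ by at most
    \<open>2 * \<epsilon>'\<close>, hence the projections by
    \<open>4 * real k * \<epsilon>'\<close>, which is below \<open>\<epsilon>\<close>.\<close>
  define \<epsilon>' where "\<epsilon>' = \<epsilon> / (8 * (real k + 1))"
  have e': "\<epsilon>' > 0" using assms by (simp add: \<epsilon>'_def)
  obtain \<delta> where d: "\<delta> > 0" and gs: "\<And>x :: nat \<Rightarrow> 'a.
    (\<forall>i<k. \<forall>j<k. cmod (cinner (x i) (x j) - (if i = j then 1 else 0)) \<le> \<delta>) \<Longrightarrow>
    (\<exists>f. onf k f \<and> (\<forall>i<k. norm (f i - x i) \<le> \<epsilon>') \<and> cspan (f ` {..<k}) = cspan (x ` {..<k}))"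
    using almost_onf[OF e', of k] by blast
  define \<eta> where "\<eta> = min \<epsilon>' \<delta>"
  have eta: "\<eta> > 0" using e' d by (simp add: \<eta>_def)
  have "\<forall>\<^sub>F n in sequentially. \<forall>i<k. norm (app (Q n) (e i) - e i) < \<eta>"
    using eventually_ball_finite[of "{..<k}" "\<lambda>n i. norm (app (Q n) (e i) - e i) < \<eta>" sequentially]
      tendstoD[OF filtrationD(2)[OF Q] eta] by (simp add: dist_norm Ball_def)
  then obtain n where n: "n \<ge> N" and ne: "\<And>i. i < k \<Longrightarrow> norm (app (Q n) (e i) - e i) < \<eta>"
    unfolding eventually_sequentially by (meson le_cases)
  note Qn = filtrationD(1)[OF Q, of n]
  have Qp: "is_projection (Q n)" using Qn by (simp add: finproj_def)
  define x where "x i = app (Q n) (e i)" for i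
  have "cmod (cinner (x i) (x j) - (if i = j then 1 else 0)) \<le> \<delta>" if "i < k" "j < k" for i j
  proof -
    have "cinner (x i) (x j) - (if i = j then 1 else 0) = cinner (x i - e i) (e j)"
      using that by (simp add: x_def projection_sa[OF Qp] projection_idem[OF Qp] cinner_diff_left onfD[OF e(1)])
    also have "cmod \<dots> \<le> \<eta>"
      using norm_cinner_le[of "x i - e i" "e j"] ne[OF that(1)] onf_norm[OF e(1) that(2)] by (simp add: x_def)
    finally show ?thesis by (simp add: \<eta>_def)
  qed
  then obtain f where f: "onf k f" "\<And>i. i < k \<Longrightarrow> norm (f i - x i) \<le> \<epsilon>'" "cspan (f ` {..<k}) = cspan (x ` {..<k})"
    using gs by blast
  define R where "R = span_proj k f"
  have R: "finproj R" unfolding R_def by (rule finproj_span_proj[OF f(1)])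
  have "norm (e i - f i) \<le> 2 * \<epsilon>'" if "i < k" for i
    using ne[OF that] f(2)[OF that] norm_triangle_ineq[of "f i - x i" "x i - e i"]
    by (simp add: x_def \<eta>_def norm_minus_commute)
  then have "norm (P - R) \<le> 2 * real k * (2 * \<epsilon>')"
    unfolding R_def e(2) using e' by (intro norm_span_proj_diff e f) auto
  also have "\<dots> < \<epsilon>" using assms by (simp add: \<epsilon>'_def field_simps add_pos_nonneg)
  finally have PR: "norm (P - R) < \<epsilon>" .
  have "app (Q n) (app R y) = app R y" for y
  proof -
    have "app R y \<in> cspan (x ` {..<k})" unfolding R_def f(3)[symmetric] by (rule span_proj_in_cspan)
    also have "\<dots> \<subseteq> range (app (Q n))"
      by (intro complex_vector.span_minimal csubspace_range_app) (auto simp: x_def)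
    finally show ?thesis using projection_idem[OF Qp] by auto
  qed
  then have QR: "Q n * R = R" by (intro bop_eqI) simp
  have D: "finproj (Q n - R)" by (rule finproj_diff[OF Qn R QR])
  have Rx: "app R (x i) = x i" if "i < k" for i
    unfolding R_def by (rule span_proj_fixes[OF f(1)]) (use that f(3) in \<open>auto intro: cspan_base\<close>)
  have DP: "(Q n - R) * P = 0"
  proof (rule bop_eqI)
    fix y
    have "app (Q n - R) (e i) = 0" if i: "i < k" for i
    proof -
      \<comment> \<open>This exchanges \<open>e i\<close> for \<open>x i\<close>, which
        \<open>R\<close> fixes. So \<open>R\<close> and \<open>Q n\<close> agree on
        \<open>e i\<close>, and the orthogonality is exact.\<close>
      have "R * Q n = R" using QR R Qn by (metis finproj_def is_projection_def star_mult)
      then have "app R (e i) = app R (x i)" unfolding x_def by (metis app_bop(6))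
      then show ?thesis using Rx[OF i] by (simp add: x_def)
    qed
    then show "app ((Q n - R) * P) y = app 0 y"
      by (simp add: e(2) app_span_proj app_sum app_scaleC del: app_bop(4))
  qed
  have PD: "P * (Q n - R) = 0"
  proof -
    have "P * (Q n - R) = star ((Q n - R) * P)"
      using P D unfolding star_mult finproj_def is_projection_def by simp
    then show ?thesis by (simp add: DP)
  qed
  have "(P + (Q n - R)) * P = P"
    using DP P by (simp add: distrib_right finproj_def is_projection_def)
  moreover have "norm (P + (Q n - R) - Q n) < \<epsilon>" using PR by simp
  ultimately show ?thesis using n finproj_add[OF P D PD] by blast
qed

subsection \<open>Finite sections\<close>

lemma norm_app_le_unit: "norm x \<le> 1 \<Longrightarrow> norm (app R x) \<le> norm R"
  using norm_app_le[of R x] mult_left_le[of "norm x" "norm R"] by simp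

text \<open>The lower bound makes the inverse continuous directly, with the explicit norm that the
  section estimates need.\<close>

lemma bop_inverse_exists:
  fixes S :: "'h::chilbert_space bop"
  assumes c: "c > 0" and below: "\<And>x. c * norm x \<le> norm (app S x)" and surj: "surj (app S)"
  shows "\<exists>R. S * R = 1 \<and> R * S = 1 \<and> norm R \<le> 1 / c"
proof -
  have inj: "x = y" if "app S x = app S y" for x y
    using below[of "x - y"] that c by (simp add: app_diff mult_le_0_iff)
  define g where "g = inv_into UNIV (app S)"
  have g: "app S (g x) = x" for x unfolding g_def by (rule surj_f_inv_f[OF surj])
  have ng: "norm (g x) \<le> 1 / c * norm x" for x
    using below[of "g x"] c by (simp add: g field_simps)
  have "g (x + y) = g x + g y" for x y by (rule inj) (simp add: g app_add)
  moreover have "g (a *\<^sub>C x) = a *\<^sub>C g x" for a x by (rule inj) (simp add: g app_scaleC)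
  ultimately obtain R where R: "app R = g" using bop_exists[OF _ _ ng] by blast
  have "S * R = 1" by (rule bop_eqI) (simp add: R g)
  moreover have "R * S = 1" by (rule bop_eqI, rule inj) (simp add: R g)
  moreover have "norm R \<le> 1 / c" using c ng by (intro norm_bop_le) (auto simp: R)
  ultimately show ?thesis by blast
qed

text \<open>A solution of \<open>app X x = y\<close> is a fixed point of the
  \<open>q\<close>-contraction sending \<open>x\<close> to \<open>y + (x - app X x)\<close>; the
  lower bound \<open>1 - q\<close> controls the inverse.\<close>

lemma neumann_inverse:
  fixes X :: "'h::chilbert_space bop"
  assumes "norm (1 - X) \<le> q" "q < 1"
  shows "\<exists>R. X * R = 1 \<and> R * X = 1 \<and> norm R \<le> 1 / (1 - q)"
proof (rule bop_inverse_exists)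
  have q: "q \<ge> 0" using assms(1) norm_ge_zero order_trans by blast
  have le: "norm (x - app X x) \<le> q * norm x" for x
    using norm_app_le[of "1 - X" x] mult_right_mono[OF assms(1) norm_ge_zero[of x]] by simp
  show "(1 - q) * norm x \<le> norm (app X x)" for x
    using le[of x] norm_triangle_ineq2[of x "x - app X x"] by (simp add: algebra_simps)
  show "surj (app X)"
  proof (unfold surj_def, rule allI)
    fix y
    have "\<exists>!x. y + (x - app X x) = x"
    proof (rule banach_fix_type[of q])
      have "y + (x - app X x) - (y + (z - app X z)) = (x - z) - app X (x - z)" for x z
        by (simp add: app_diff algebra_simps)
      then show "\<forall>x z. dist (y + (x - app X x)) (y + (z - app X z)) \<le> q * dist x z"
        using le by (simp only: dist_norm) simp
    qed (use q assms in auto)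
    then obtain x where "y + (x - app X x) = x" by blast
    then have "y = app X x" by (simp add: algebra_simps)
    then show "\<exists>x. y = app X x" ..
  qed
qed (use assms in simp)

lemma inverse_onI_of_inverse:
  assumes "S * R = 1" "R * S = 1"
  shows "inverse_on UNIV S R"
  unfolding inverse_on_def by (metis UNIV_I app_bop(2,6) assms)

lemma inverse_on_UNIV_iff: "inverse_on UNIV S R \<longleftrightarrow> S * R = 1 \<and> R * S = 1"
proof
  assume "inverse_on UNIV S R"
  then show "S * R = 1 \<and> R * S = 1" unfolding inverse_on_def by (auto intro!: bop_eqI)
qed (simp add: inverse_onI_of_inverse)

lemma inverse_on_cong:
  assumes "\<And>x. x \<in> M \<Longrightarrow> app S x = app S' x"
  shows "inverse_on M S R \<longleftrightarrow> inverse_on M S' R"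
  unfolding inverse_on_def using assms by auto

lemma norm_on_bdd: "bdd_above ((\<lambda>x. norm (app R x)) ` {x \<in> M. norm x \<le> 1})"
  by (rule bdd_aboveI2[where M = "norm R"])
    (auto intro: norm_app_le_unit)

lemma norm_on_le:
  assumes "0 \<in> M"
  shows "norm_on M R \<le> norm R"
  unfolding norm_on_def
proof (rule cSUP_least)
  show "{x \<in> M. norm x \<le> 1} \<noteq> {}" using assms by force
  show "norm (app R x) \<le> norm R" if "x \<in> {x \<in> M. norm x \<le> 1}" for x
    using that by (auto intro: norm_app_le_unit)
qed

lemma norm_app_le_norm_on:
  assumes "csubspace M" "x \<in> M"
  shows "norm (app R x) \<le> norm_on M R * norm x"
proof (cases "x = 0")
  case False
  define y where "y = complex_of_real (inverse (norm x)) *\<^sub>C x"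
  have x: "x = complex_of_real (norm x) *\<^sub>C y" using False by (simp add: y_def scaleC_scaleC)
  have "y \<in> M" "norm y = 1"
    using assms False by (auto simp: y_def norm_scaleC norm_inverse intro: complex_vector.subspace_scale)
  then have "norm (app R y) \<le> norm_on M R" unfolding norm_on_def
    by (intro cSUP_upper norm_on_bdd) auto
  then have "norm x * norm (app R y) \<le> norm x * norm_on M R" by (intro mult_left_mono) auto
  moreover have "norm (app R x) = norm x * norm (app R y)"
    by (subst x) (simp add: app_scaleC norm_scaleC del: of_real_inverse)
  ultimately show ?thesis by (simp add: mult.commute)
qed simp

text \<open>Adding \<open>1 - P\<close> extends the section to an operator \<open>V\<close> on the
  whole space, and treating \<open>R\<close> alike gives an approximate inverse \<open>W\<close>:
  both products differ from 1 only by terms with the commutator of \<open>S\<close> and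
  \<open>P\<close> or with the shift \<open>d\<close>. The shift serves pseudospectra, where the
  spectral parameter varies with the section.\<close>

lemma section_inverse:
  fixes S R P :: "'h::chilbert_space bop"
  assumes SR: "S * R = 1" "R * S = 1" and P: "is_projection P"
    and small: "(norm (S * P - P * S) + cmod d) * norm R \<le> 1 / 2"
  shows "\<exists>G. inverse_on (range (app P)) (P * (S + d *\<^sub>C 1) * P) G \<and>
    norm_on (range (app P)) G \<le> 2 * (norm R + 1)"
proof -
  have PP: "P * P = P" using P by (simp add: is_projection_def)
  define V where "V = P * (S + d *\<^sub>C 1) * P + (1 - P)"
  define W where "W = P * R * P + (1 - P)"
  define K where "K = S * P - P * S"
  have n1: "norm (P * X * P) \<le> norm X" for X
  proof -
    have "norm (P * X * P) \<le> norm P * norm X * norm P"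
      by (meson mult_right_mono norm_ge_zero norm_mult_ineq order_trans)
    also have "\<dots> \<le> 1 * norm X * 1" using norm_projection_le[OF P] by (intro mult_mono) auto
    finally show ?thesis by simp
  qed
  have n2: "norm (K * R) + cmod d * norm R \<le> 1/2" "norm (R * K) + cmod d * norm R \<le> 1/2"
    using small norm_mult_ineq[of K R] norm_mult_ineq[of R K] by (simp_all add: K_def algebra_simps)
  have PX: "P * (P * X) = P * X" for X by (simp add: PP flip: mult.assoc)
  have R1: "R * (S * X) = X" "S * (R * X) = X" for X using SR by (simp_all flip: mult.assoc)
  have VW: "V * W = 1 + (P * (K * R) * P + P * (d *\<^sub>C (P * R)) * P)"
    unfolding V_def W_def K_def
    by (simp add: algebra_simps PP PX SR R1 scaleC_mult_left scaleC_mult_right)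
  have WV: "W * V = 1 + (P * (- (R * K)) * P + P * (d *\<^sub>C (R * P)) * P)"
    unfolding V_def W_def K_def
    by (simp add: algebra_simps PP PX SR R1 scaleC_mult_left scaleC_mult_right)
  have nP: "norm (P * R) \<le> norm R" "norm (R * P) \<le> norm R"
    using norm_mult_ineq[of P R] norm_mult_ineq[of R P] norm_projection_le[OF P]
    by (auto elim!: order_trans intro: mult_left_le_one_le mult_right_le_one_le)
  have near: "norm (1 - (1 + (P * X * P + P * (d *\<^sub>C Y) * P))) \<le> norm X + cmod d * norm R"
    if "norm Y \<le> norm R" for X Y
  proof -
    have "norm (1 - (1 + (P * X * P + P * (d *\<^sub>C Y) * P))) \<le> norm (P * X * P) + norm (P * (d *\<^sub>C Y) * P)"
      by (simp only: norm_minus_commute[of 1] add_diff_cancel_left' norm_triangle_ineq)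
    also have "\<dots> \<le> norm X + norm (d *\<^sub>C Y)" by (intro add_mono n1)
    also have "\<dots> \<le> norm X + cmod d * norm R"
      using that by (simp add: norm_scaleC_star_algebra mult_left_mono)
    finally show ?thesis .
  qed
  have "norm (1 - V * W) \<le> norm (K * R) + cmod d * norm R" unfolding VW by (rule near[OF nP(1)])
  then obtain A where A: "V * W * A = 1" "A * (V * W) = 1" "norm A \<le> 2"
    using neumann_inverse[of "V * W" "1/2"] n2 by auto
  have "norm (1 - W * V) \<le> norm (- (R * K)) + cmod d * norm R" unfolding WV by (rule near[OF nP(2)])
  then have "norm (1 - W * V) \<le> norm (R * K) + cmod d * norm R" by simp
  then obtain B where B: "W * V * B = 1" "B * (W * V) = 1" "norm B \<le> 2"
    using neumann_inverse[of "W * V" "1/2"] n2 by auto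
  \<comment> \<open>\<open>A\<close> makes \<open>G\<close> a right inverse of \<open>V\<close> and
    \<open>B\<close> makes \<open>B * W\<close> a left inverse, so the two coincide. The final bound
    is \<open>norm A \<le> 2\<close> times \<open>norm W \<le> norm R + 1\<close>.\<close>
  define G where "G = W * A"
  have VG: "V * G = 1" using A by (simp add: G_def mult.assoc)
  have "B * W = (B * W) * (V * G)" by (simp add: VG)
  also have "\<dots> = (B * (W * V)) * G" by (simp add: mult.assoc)
  finally have GV: "G * V = 1" using B(2) by (metis mult.assoc mult_1_left)
  \<comment> \<open>Since \<open>V\<close> commutes with \<open>P\<close>, so does its inverse,
    which therefore leaves the range of \<open>P\<close> invariant.\<close>
  have VP: "V * P = P * V" unfolding V_def by (simp add: algebra_simps PP PX)
  have "G * P = G * P * (V * G)" by (simp add: VG)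
  also have "\<dots> = G * (P * V) * G" by (simp add: mult.assoc)
  also have "\<dots> = (G * V) * P * G" by (simp add: VP[symmetric] mult.assoc)
  finally have GP: "G * P = P * G" by (simp add: GV)
  have "inverse_on (range (app P)) V G"
    unfolding inverse_on_def
  proof
    fix x assume "x \<in> range (app P)"
    then have "x = app P x" using projection_idem[OF P] by auto
    then have "app G x = app (P * G) x" by (metis GP app_bop(6))
    moreover have "app V (app G x) = x" "app G (app V x) = x" using VG GV by (metis app_bop(2,6))+
    ultimately show "app G x \<in> range (app P) \<and> app V (app G x) = x \<and> app G (app V x) = x" by simp
  qed
  moreover have "app V x = app (P * (S + d *\<^sub>C 1) * P) x" if "x \<in> range (app P)" for x
  proof -
    have "app (1 - P) x = 0" using that projection_idem[OF P] by auto
    then show ?thesis unfolding V_def by (simp del: app_bop(4))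
  qed
  ultimately have "inverse_on (range (app P)) (P * (S + d *\<^sub>C 1) * P) G"
    using inverse_on_cong[of "range (app P)" V "P * (S + d *\<^sub>C 1) * P" G] by blast
  moreover have "norm_on (range (app P)) G \<le> 2 * (norm R + 1)"
  proof -
    have "0 \<in> range (app P)" by (metis app_0 rangeI)
    then have "norm_on (range (app P)) G \<le> norm G" by (rule norm_on_le)
    also have "\<dots> \<le> norm W * norm A" unfolding G_def by (rule norm_mult_ineq)
    also have "\<dots> \<le> (norm R + 1) * 2"
    proof (rule mult_mono)
      show "norm W \<le> norm R + 1"
        unfolding W_def using norm_triangle_ineq[of "P * R * P" "1 - P"] n1[of R] norm_compl_projection_le[OF P] by linarith
    qed (use A(3) in auto)
    finally show ?thesis by simp
  qed
  ultimately show ?thesis by blast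
qed

text \<open>The bounded local inverses \<open>R\<^sub>n\<close> satisfy \<open>S R\<^sub>n P\<^sub>n x \<rightarrow> x\<close>; as \<open>S\<close> is bounded below,
  \<open>R\<^sub>n P\<^sub>n x\<close> is a Cauchy sequence, whose limit is a preimage of \<open>x\<close>.\<close>

lemma invertible_of_sections:
  fixes S :: "'h::chilbert_space bop"
  assumes P: "filtration P" and comm: "(\<lambda>n. norm (S * P n - P n * S)) \<longlonglongrightarrow> 0"
    and freq: "\<exists>\<^sub>F n in sequentially. \<exists>R. inverse_on (range (app (P n))) (P n * S * P n) R \<and>
      norm_on (range (app (P n))) R \<le> C"
  shows "invertible_on UNIV S"
proof -
  let ?N = "{n. \<exists>R. inverse_on (range (app (P n))) (P n * S * P n) R \<and> norm_on (range (app (P n))) R \<le> C}"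
  have "infinite ?N" using freq by (simp add: frequently_cofinite flip: cofinite_eq_sequentially)
  then obtain r where r: "strict_mono (r :: nat \<Rightarrow> nat)" and "\<And>m. r m \<in> ?N"
    using infinite_enumerate[of ?N] by auto
  then obtain R where R: "\<And>m. inverse_on (range (app (P (r m)))) (P (r m) * S * P (r m)) (R m)"
    "\<And>m. norm_on (range (app (P (r m)))) (R m) \<le> C" unfolding mem_Collect_eq by metis
  define C' where "C' = max C 1"
  have C': "C' > 0" "C \<le> C'" by (auto simp: C'_def)
  define p where "p m = P (r m)" for m
  have pp: "is_projection (p m)" for m using filtrationD(1)[OF P] by (simp add: p_def finproj_def)
  have plim: "(\<lambda>m. app (p m) x) \<longlonglongrightarrow> x" for x
    using LIMSEQ_subseq_LIMSEQ[OF filtrationD(2)[OF P] r] by (simp add: p_def o_def)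
  have bnd: "norm (app (R m) y) \<le> C' * norm y" if "y \<in> range (app (p m))" for m y
  proof -
    have "norm (app (R m) y) \<le> norm_on (range (app (p m))) (R m) * norm y"
      by (rule norm_app_le_norm_on[OF csubspace_range_app that])
    also have "\<dots> \<le> C' * norm y" using R(2)[of m] C' by (intro mult_right_mono) (auto simp: p_def)
    finally show ?thesis .
  qed
  \<comment> \<open>The section inverses bound \<open>S\<close> from below on each range, and strong
    convergence of \<open>p m\<close> extends the bound to every vector.\<close>
  have below: "1 / C' * norm x \<le> norm (app S x)" for x
  proof -
    have "norm (app (p m) x) \<le> C' * norm (app (p m) (app S (app (p m) x)))" for m
    proof -
      have "app (R m) (app (p m * S * p m) (app (p m) x)) = app (p m) x"
        using R(1)[of m] unfolding inverse_on_def p_def by blast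
      then show ?thesis using bnd[of "app (p m) (app S (app (p m) x))" m] by (simp add: projection_idem[OF pp])
    qed
    then have "norm (app (p m) x) \<le> C' * norm (app S (app (p m) x))" for m
    proof -
      have "norm (app (p m) (app S (app (p m) x))) \<le> 1 * norm (app S (app (p m) x))"
        using norm_app_le[of "p m"] norm_projection_le[OF pp, of m] by (meson mult_right_mono norm_ge_zero order_trans)
      then show ?thesis
        using \<open>norm (app (p m) x) \<le> C' * norm (app (p m) (app S (app (p m) x)))\<close> C'
        by (smt (verit) mult_left_mono)
    qed
    then have "norm x \<le> C' * norm (app S x)"
      by (intro LIMSEQ_le[OF tendsto_norm[OF plim[of x]]
            tendsto_mult[OF tendsto_const tendsto_norm[OF bounded_linear.tendsto[OF bounded_linear_app plim]]]]) auto
    then show ?thesis using C' by (simp add: field_simps)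
  qed
  have "surj (app S)"
  proof (unfold surj_def, rule allI)
    fix y
    define K where "K m = S * p m - p m * S" for m
    define u where "u m = app (R m) (app (p m) y)" for m
    have up: "app (p m) (u m) = u m" "norm (u m) \<le> C' * norm y" for m
    proof -
      have "u m \<in> range (app (p m))" using R(1)[of m] unfolding u_def p_def inverse_on_def by blast
      then show "app (p m) (u m) = u m" using projection_idem[OF pp] by auto
      have "norm (u m) \<le> C' * norm (app (p m) y)" unfolding u_def by (rule bnd) simp
      also have "\<dots> \<le> C' * (1 * norm y)"
        using C' norm_app_le[of "p m" y] norm_projection_le[OF pp, of m]
        by (intro mult_left_mono) (meson mult_right_mono norm_ge_zero order_trans, simp)
      finally show "norm (u m) \<le> C' * norm y" by simp
    qed
    \<comment> \<open>On the range of \<open>p m\<close>, \<open>S\<close> acts as the section,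
      which returns \<open>app (p m) y\<close>, plus the commutator, which vanishes in the
      limit.\<close>
    have Su: "app S (u m) = app (p m) y + app (K m) (u m)" for m
    proof -
      have "app (p m * S * p m) (u m) = app (p m) y"
        using R(1)[of m] unfolding u_def p_def inverse_on_def by blast
      then show ?thesis by (simp add: up(1) K_def)
    qed
    have c0: "(\<lambda>m. norm (K m)) \<longlonglongrightarrow> 0"
      using LIMSEQ_subseq_LIMSEQ[OF comm r] by (simp add: K_def p_def o_def)
    have "(\<lambda>m. app (K m) (u m)) \<longlonglongrightarrow> 0"
    proof (rule Lim_null_comparison)
      show "\<forall>\<^sub>F m in sequentially. norm (app (K m) (u m)) \<le> norm (K m) * (C' * norm y)"
        by (intro always_eventually allI order_trans[OF norm_app_le] mult_left_mono up(2)) simp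
      show "(\<lambda>m. norm (K m) * (C' * norm y)) \<longlonglongrightarrow> 0"
        using tendsto_mult_left_zero[OF c0] by simp
    qed
    then have Slim: "(\<lambda>m. app S (u m)) \<longlonglongrightarrow> y"
      unfolding Su using tendsto_add[OF plim[of y]] by fastforce
    have "Cauchy u"
    proof (rule metric_CauchyI)
      fix e :: real assume "e > 0"
      then obtain M where M: "\<And>m n. m \<ge> M \<Longrightarrow> n \<ge> M \<Longrightarrow> dist (app S (u m)) (app S (u n)) < e / C'"
        using metric_CauchyD[OF LIMSEQ_imp_Cauchy[OF Slim], of "e / C'"] C' by auto
      have "dist (u m) (u n) < e" if "m \<ge> M" "n \<ge> M" for m n
        using M[OF that] below[of "u m - u n"] C' by (simp add: dist_norm app_diff field_simps)
      then show "\<exists>M. \<forall>m\<ge>M. \<forall>n\<ge>M. dist (u m) (u n) < e" by blast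
    qed
    then obtain x where "u \<longlonglongrightarrow> x" using Cauchy_convergent convergent_def by blast
    then have "(\<lambda>m. app S (u m)) \<longlonglongrightarrow> app S x" by (rule bounded_linear.tendsto[OF bounded_linear_app])
    then have "y = app S x" using Slim LIMSEQ_unique by blast
    then show "\<exists>x. y = app S x" ..
  qed
  then obtain G where "S * G = 1 \<and> G * S = 1"
    using bop_inverse_exists[of "1 / C'" S] below C' by auto
  then show ?thesis unfolding invertible_on_def using inverse_onI_of_inverse by blast
qed

text \<open>The compression is a complex matrix of positive size, so it has an eigenvector, which
  yields a nonzero kernel vector in the range of \<open>P\<close>.\<close>

lemma section_spectrum_nonempty:
  assumes P: "finproj P" and "P \<noteq> 0"
  shows "spectrum_on (range (app P)) (P * S * P) \<noteq> {}"
proof -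
  obtain k e where e: "onf k e" "P = span_proj k e" using finprojE[OF P] by blast
  have k: "k > 0" using e assms(2) by (cases k) (auto simp: span_proj_def)
  define A where "A = mat k k (\<lambda>(i, j). cinner (app S (e j)) (e i))"
  have A: "A \<in> carrier_mat k k" by (simp add: A_def)
  then obtain z where "z \<in> spectrum A" using spectrum_non_empty[OF A k] by blast
  then obtain v where v: "v \<in> carrier_vec k" "v \<noteq> 0\<^sub>v k" "A *\<^sub>v v = z \<cdot>\<^sub>v v"
    using A unfolding spectrum_def eigenvalue_def eigenvector_def by auto
  define x where "x = (\<Sum>j<k. v $ j *\<^sub>C e j)"
  have xP: "x \<in> range (app P)" unfolding e(2) range_span_proj[OF e(1)] x_def by (rule sum_in_cspan)
  then have Px: "app P x = x" using P projection_idem unfolding finproj_def by auto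
  have "x \<noteq> 0"
  proof
    assume "x = 0"
    then have "v $ j = 0" if "j < k" for j using cinner_onf_sum[OF e(1) that, of "\<lambda>j. v $ j"] by (simp add: x_def)
    then show False using v(1,2) by auto
  qed
  have "cinner (app S x) (e i) = z * v $ i" if i: "i < k" for i
  proof -
    have "cinner (app S x) (e i) = (\<Sum>j<k. cinner (app S (e j)) (e i) * v $ j)"
      by (simp add: x_def app_sum app_scaleC cinner_sum_left cinner_scaleC_left mult.commute)
    also have "\<dots> = (A *\<^sub>v v) $ i"
      using i v(1) by (auto simp: A_def scalar_prod_def lessThan_atLeast0 intro!: sum.cong)
    also have "\<dots> = z * v $ i" using i v by simp
    finally show ?thesis .
  qed
  then have "app P (app S x) = (\<Sum>i<k. (z * v $ i) *\<^sub>C e i)"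
    unfolding e(2) app_span_proj by simp
  also have "\<dots> = z *\<^sub>C x" by (simp add: x_def complex_vector.scale_sum_right scaleC_scaleC)
  finally have ker: "app (z *\<^sub>C 1 - P * S * P) x = 0" using Px by simp
  have "\<not> inverse_on (range (app P)) (z *\<^sub>C 1 - P * S * P) R" for R
    using ker xP \<open>x \<noteq> 0\<close> unfolding inverse_on_def by (auto simp del: app_bop) (metis app_0 rangeI)
  then have "z \<in> spectrum_on (range (app P)) (P * S * P)"
    unfolding spectrum_on_def invertible_on_def by blast
  then show ?thesis by blast
qed

section \<open>Matrices of operators and their square roots\<close>

text \<open>A \<open>k \<times> k\<close> matrix is a function of two indices, whose values outside \<open>{..<k}\<close> are irrelevant.\<close>

definition mmul :: "nat \<Rightarrow> (nat \<Rightarrow> nat \<Rightarrow> 'a::star_algebra) \<Rightarrow> (nat \<Rightarrow> nat \<Rightarrow> 'a) \<Rightarrow> nat \<Rightarrow> nat \<Rightarrow> 'a"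
  where "mmul k X Y i j = (\<Sum>l<k. X i l * Y l j)"

definition mone :: "nat \<Rightarrow> nat \<Rightarrow> 'a::star_algebra"
  where "mone i j = (if i = j then 1 else 0)"

definition mstar :: "(nat \<Rightarrow> nat \<Rightarrow> 'a::star_algebra) \<Rightarrow> nat \<Rightarrow> nat \<Rightarrow> 'a"
  where "mstar X i j = star (X j i)"

primrec mpow :: "nat \<Rightarrow> (nat \<Rightarrow> nat \<Rightarrow> 'a::star_algebra) \<Rightarrow> nat \<Rightarrow> nat \<Rightarrow> nat \<Rightarrow> 'a"
  where "mpow k D 0 = mone" | "mpow k D (Suc n) = mmul k D (mpow k D n)"

lemma mone_mmul: "i < k \<Longrightarrow> mmul k mone X i j = X i j"
  by (simp add: mmul_def mone_def if_distrib[of "\<lambda>x. x * _"] cong: if_cong)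

lemma mmul_mone: "j < k \<Longrightarrow> mmul k X mone i j = X i j"
  by (simp add: mmul_def mone_def if_distrib[of "\<lambda>x. _ * x"] cong: if_cong)

lemma mmul_assoc: "mmul k (mmul k X Y) Z i j = mmul k X (mmul k Y Z) i j"
  unfolding mmul_def sum_distrib_left sum_distrib_right
  by (subst sum.swap) (simp add: mult.assoc)

lemma mpow_add: "i < k \<Longrightarrow> mpow k D (p + q) i j = mmul k (mpow k D p) (mpow k D q) i j"
proof (induction p arbitrary: i)
  case 0
  then show ?case by (simp add: mone_mmul)
next
  case (Suc p)
  have "mpow k D (Suc p + q) i j = mmul k D (mmul k (mpow k D p) (mpow k D q)) i j"
    using Suc.IH by (simp add: mmul_def)
  then show ?case by (simp add: mmul_assoc)
qed

lemma star_mpow: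
  assumes "\<And>i j. i < k \<Longrightarrow> j < k \<Longrightarrow> star (D i j) = D j i" "i < k" "j < k"
  shows "star (mpow k D n i j) = mpow k D n j i"
  using assms(2,3)
proof (induction n arbitrary: i j)
  case 0
  then show ?case by (simp add: mone_def)
next
  case (Suc n)
  have D1: "mpow k D 1 l i = D l i" for l using Suc.prems by (simp add: mmul_mone)
  have "star (mpow k D (Suc n) i j) = (\<Sum>l<k. mpow k D n j l * D l i)"
    using Suc assms(1) by (simp add: mmul_def star_sum star_mult)
  also have "\<dots> = mmul k (mpow k D n) (mpow k D 1) j i" by (simp only: mmul_def D1)
  also have "\<dots> = mpow k D (n + 1) j i" using Suc.prems by (simp only: mpow_add)
  finally show ?case by simp
qed

text \<open>The Taylor coefficients of \<open>sqrt (1 - x)\<close>.\<close>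

definition sqrt_coeff :: "nat \<Rightarrow> real"
  where "sqrt_coeff n = (1/2 gchoose n) * (- 1) ^ n"

lemma summable_sqrt_coeff:
  assumes "0 \<le> r" "r < 1"
  shows "summable (\<lambda>n. \<bar>sqrt_coeff n\<bar> * r ^ n)"
proof -
  define s where "s = (r + 1) / 2"
  have s: "r < s" "0 < s" "s < 1" using assms by (auto simp: s_def)
  have "summable (\<lambda>n. (1/2 gchoose n) * s ^ n :: real)"
    using gen_binomial_real[of s "1/2"] s by (simp add: sums_iff)
  then have "summable (\<lambda>n. norm ((1/2 gchoose n) * r ^ n :: real))"
    by (rule powser_insidea) (use s assms in auto)
  then show ?thesis using assms by (simp add: sqrt_coeff_def abs_mult power_abs)
qed

text \<open>The square of the series for \<open>sqrt (1 - x)\<close> is \<open>1 - x\<close>, read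
  off coefficientwise: Vandermonde's identity for 1/2 + 1/2 = 1.\<close>

lemma sqrt_coeff_convolution:
  "(\<Sum>p\<le>n. sqrt_coeff p * sqrt_coeff (n - p)) = (if n = 0 then 1 else if n = 1 then - 1 else 0)"
proof -
  have "(\<Sum>p\<le>n. sqrt_coeff p * sqrt_coeff (n - p))
      = (\<Sum>p\<le>n. (1/2 gchoose p) * (1/2 gchoose (n - p)) * (- 1) ^ n)"
    by (rule sum.cong) (auto simp: sqrt_coeff_def algebra_simps simp flip: power_add)
  also have "\<dots> = (1 gchoose n) * (- 1) ^ n"
    using gbinomial_Vandermonde[of "1/2::real" "1/2" n] by (simp add: atLeast0AtMost flip: sum_distrib_right)
  also have "(1 gchoose n :: real) = of_nat (1 choose n)"
    by (simp add: binomial_gbinomial)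
  finally show ?thesis by (cases n) (auto simp: binomial_eq_0)
qed

lemma bounded_linear_star: "bounded_linear (star :: 'h::chilbert_space bop \<Rightarrow> 'h bop)"
  by (rule bounded_linear_intro[where K = 1])
    (simp_all add: star_add scaleR_scaleC star_scaleC)

text \<open>The binomial series is summed entrywise, the bound \<open>r ^ n\<close> with
  \<open>r < 1\<close> giving absolutely convergent Cauchy products. The series is part of the
  conclusion because it later places the entries of \<open>S\<close>, modulo compacts, in a given
  C*-subalgebra.\<close>

lemma block_sqrt:
  fixes D :: "nat \<Rightarrow> nat \<Rightarrow> 'h::chilbert_space bop"
  assumes herm: "\<And>i j. i < k \<Longrightarrow> j < k \<Longrightarrow> star (D i j) = D j i"
    and r: "0 \<le> r" "r < 1" and bound: "\<And>n i j. i < k \<Longrightarrow> j < k \<Longrightarrow> norm (mpow k D n i j) \<le> r ^ n"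
  obtains S where "\<And>i j. i < k \<Longrightarrow> j < k \<Longrightarrow> (\<lambda>n. sqrt_coeff n *\<^sub>R mpow k D n i j) sums S i j"
    "\<And>i j. i < k \<Longrightarrow> j < k \<Longrightarrow> mmul k (mstar S) S i j = mone i j - D i j"
proof -
  define f where "f i j n = sqrt_coeff n *\<^sub>R mpow k D n i j" for i j n
  define S where "S i j = suminf (f i j)" for i j
  have nf: "summable (\<lambda>n. norm (f i j n))" if "i < k" "j < k" for i j
    by (rule summable_comparison_test'[OF summable_sqrt_coeff[OF r]])
      (use bound[OF that] in \<open>simp add: f_def mult_left_mono\<close>)
  have S: "f i j sums S i j" if "i < k" "j < k" for i j
    unfolding S_def by (rule summable_sums, rule summable_norm_cancel, rule nf[OF that])
  have starS: "star (S i j) = S j i" if "i < k" "j < k" for i j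
  proof -
    have "(\<lambda>n. star (f i j n)) sums star (S i j)"
      by (rule bounded_linear.sums[OF bounded_linear_star S[OF that]])
    also have "(\<lambda>n. star (f i j n)) = f j i"
      by (rule ext) (simp add: f_def scaleR_scaleC star_scaleC star_mpow[OF herm that])
    finally show ?thesis using S[OF that(2,1)] sums_unique2 by blast
  qed
  have "mmul k S S i j = mone i j - D i j" if ij: "i < k" "j < k" for i j
  proof -
    have "(\<lambda>n. \<Sum>l<k. \<Sum>p\<le>n. f i l p * f l j (n - p)) sums (\<Sum>l<k. S i l * S l j)"
    proof (rule sums_sum)
      fix l assume "l \<in> {..<k}"
      then have l: "l < k" by simp
      show "(\<lambda>n. \<Sum>p\<le>n. f i l p * f l j (n - p)) sums (S i l * S l j)"
        unfolding S_def using Cauchy_product_sums[OF nf nf] ij l by blast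
    qed
    also have "(\<lambda>n. \<Sum>l<k. \<Sum>p\<le>n. f i l p * f l j (n - p))
        = (\<lambda>n. if n \<in> {0, 1} then (if n = 0 then 1 else - 1) *\<^sub>R mpow k D n i j else 0)"
    proof
      fix n
      have "(\<Sum>l<k. \<Sum>p\<le>n. f i l p * f l j (n - p))
          = (\<Sum>p\<le>n. (sqrt_coeff p * sqrt_coeff (n - p)) *\<^sub>R mmul k (mpow k D p) (mpow k D (n - p)) i j)"
        by (subst sum.swap) (simp add: f_def mmul_def scaleR_sum_right mult.commute)
      also have "\<dots> = (\<Sum>p\<le>n. (sqrt_coeff p * sqrt_coeff (n - p)) *\<^sub>R mpow k D n i j)"
      proof (rule sum.cong)
        fix p assume "p \<in> {..n}"
        then show "(sqrt_coeff p * sqrt_coeff (n - p)) *\<^sub>R mmul k (mpow k D p) (mpow k D (n - p)) i j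
            = (sqrt_coeff p * sqrt_coeff (n - p)) *\<^sub>R mpow k D n i j"
          using mpow_add[OF ij(1), of D p "n - p" j] by simp
      qed simp
      also have "\<dots> = (\<Sum>p\<le>n. sqrt_coeff p * sqrt_coeff (n - p)) *\<^sub>R mpow k D n i j"
        by (simp add: scaleR_sum_left)
      also have "\<dots> = (if n \<in> {0, 1} then (if n = 0 then 1 else - 1) *\<^sub>R mpow k D n i j else 0)"
        unfolding sqrt_coeff_convolution by simp
      finally show "(\<Sum>l<k. \<Sum>p\<le>n. f i l p * f l j (n - p)) = \<dots>" .
    qed
    finally have "(\<lambda>n. if n \<in> {0, 1} then (if n = 0 then 1 else - 1) *\<^sub>R mpow k D n i j else 0)
        sums mmul k S S i j" by (simp only: mmul_def)
    moreover have "(\<lambda>n. if n \<in> {0, 1} then (if n = 0 then 1 else - 1) *\<^sub>R mpow k D n i j else 0)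
        sums (\<Sum>n\<in>{0, 1::nat}. (if n = 0 then 1 else - 1) *\<^sub>R mpow k D n i j)"
      by (rule sums_If_finite_set) simp
    ultimately have "mmul k S S i j = (\<Sum>n\<in>{0, 1::nat}. (if n = 0 then 1 else - 1) *\<^sub>R mpow k D n i j)"
      using sums_unique2 by blast
    then show ?thesis by (simp add: mmul_mone ij)
  qed
  moreover have "mmul k (mstar S) S i j = mmul k S S i j" if "i < k" for i j
    unfolding mmul_def mstar_def using starS that by simp
  ultimately show ?thesis using S unfolding f_def[abs_def] by (intro that[of S]) auto
qed

text \<open>The sesquilinear form of an operator matrix on the \<open>k\<close>-fold direct sum.
  Tuples stand for its vectors, so the direct sum need not be built as a space.\<close>

definition block_form :: "nat \<Rightarrow> (nat \<Rightarrow> nat \<Rightarrow> 'h::chilbert_space bop) \<Rightarrow> (nat \<Rightarrow> 'h) \<Rightarrow> (nat \<Rightarrow> 'h) \<Rightarrow> complex"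
  where "block_form k M v u = (\<Sum>i<k. \<Sum>j<k. cinner (app (M i j) (v j)) (u i))"

abbreviation normsq :: "nat \<Rightarrow> (nat \<Rightarrow> 'h::real_normed_vector) \<Rightarrow> real"
  where "normsq k v \<equiv> \<Sum>i<k. (norm (v i))\<^sup>2"

lemma Re_half_mult: "Re ((1 / 2) * w) = Re w / 2"
  by simp

lemma Re_of_real_mult: "Re (complex_of_real a * w) = a * Re w"
  by simp

lemma norm_le_normsq: "i < k \<Longrightarrow> (norm (v i))\<^sup>2 \<le> normsq k v"
  by (rule member_le_sum) auto

lemma block_form_bound: "cmod (block_form k M v v) \<le> (\<Sum>i<k. \<Sum>j<k. norm (M i j)) * normsq k v"
proof -
  have "cmod (cinner (app (M i j) (v j)) (v i)) \<le> norm (M i j) * normsq k v" if "i < k" "j < k" for i j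
  proof -
    have "cmod (cinner (app (M i j) (v j)) (v i)) \<le> norm (app (M i j) (v j)) * norm (v i)"
      by (rule norm_cinner_le)
    also have "\<dots> \<le> norm (M i j) * norm (v j) * norm (v i)"
      by (intro mult_right_mono norm_app_le) simp
    also have "\<dots> = norm (M i j) * (norm (v j) * norm (v i))" by simp
    also have "norm (v j) * norm (v i) \<le> normsq k v"
    proof -
      have "2 * (norm (v j) * norm (v i)) \<le> (norm (v j))\<^sup>2 + (norm (v i))\<^sup>2"
        using sum_squares_bound[of "norm (v j)" "norm (v i)"] by simp
      also have "\<dots> \<le> normsq k v + normsq k v" using that by (intro add_mono norm_le_normsq)
      finally show ?thesis by simp
    qed
    finally show ?thesis by (simp add: mult_left_mono)
  qed
  then have "cmod (block_form k M v v) \<le> (\<Sum>i<k. \<Sum>j<k. norm (M i j) * normsq k v)"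
    unfolding block_form_def by (intro order_trans[OF norm_sum] sum_mono) auto
  then show ?thesis by (simp only: sum_distrib_right)
qed

lemma block_form_hermitian:
  assumes "\<And>i j. i < k \<Longrightarrow> j < k \<Longrightarrow> star (M i j) = M j i"
  shows "block_form k M u v = cnj (block_form k M v u)"
proof -
  have "cnj (block_form k M v u) = (\<Sum>i<k. \<Sum>j<k. cinner (u i) (app (M i j) (v j)))"
    by (simp add: block_form_def cnj_sum flip: cinner_commute)
  also have "\<dots> = (\<Sum>i<k. \<Sum>j<k. cinner (app (M j i) (u i)) (v j))"
    by (intro sum.cong refl) (simp add: cinner_star' assms)
  also have "\<dots> = block_form k M u v" unfolding block_form_def by (rule sum.swap)
  finally show ?thesis ..
qed

text \<open>The form of \<open>D\<close> is nonnegative at \<open>v\<close> minus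
  \<open>1 / r\<close> times the image of \<open>v\<close>; expanding there gives the estimate. The
  operator bound, unlike the form bound, passes to powers.\<close>

lemma block_positive_contraction:
  fixes D :: "nat \<Rightarrow> nat \<Rightarrow> 'h::chilbert_space bop"
  assumes herm: "\<And>i j. i < k \<Longrightarrow> j < k \<Longrightarrow> star (D i j) = D j i" and r: "r > 0"
    and pos: "\<And>v. 0 \<le> Re (block_form k D v v)" and le: "\<And>v. Re (block_form k D v v) \<le> r * normsq k v"
  shows "normsq k (\<lambda>i. \<Sum>j<k. app (D i j) (v j)) \<le> r\<^sup>2 * normsq k v"
proof -
  define w where "w i = (\<Sum>j<k. app (D i j) (v j))" for i
  have N: "block_form k D v w = of_real (normsq k w)"
  proof -
    have "block_form k D v w = (\<Sum>i<k. cinner (w i) (w i))"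
      unfolding block_form_def by (simp add: w_def cinner_sum_left)
    then show ?thesis by (simp add: cinner_self)
  qed
  then have N': "block_form k D w v = of_real (normsq k w)"
    using block_form_hermitian[OF herm, where u = w and v = v] by simp
  have "block_form k D (\<lambda>i. v i - (1 / r) *\<^sub>R w i) (\<lambda>i. v i - (1 / r) *\<^sub>R w i)
      = block_form k D v v - (1 / r) * block_form k D v w - (1 / r) * block_form k D w v + (1 / r\<^sup>2) * block_form k D w w"
    by (simp add: block_form_def scaleR_scaleC app_diff app_scaleC cinner_simps sum.distrib sum_subtractf
        sum_distrib_left power2_eq_square algebra_simps)
  then have "0 \<le> Re (block_form k D v v) - 2 * (1 / r) * normsq k w + (1 / r\<^sup>2) * Re (block_form k D w w)"
    using pos[of "\<lambda>i. v i - (1 / r) *\<^sub>R w i"] by (simp add: N N' flip: of_real_power of_real_divide)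
  also have "\<dots> \<le> r * normsq k v - 2 * (1 / r) * normsq k w + (1 / r\<^sup>2) * (r * normsq k w)"
    using le r by (intro add_mono diff_mono mult_left_mono) auto
  also have "\<dots> = r * normsq k v - normsq k w / r" using r by (simp add: power2_eq_square)
  finally have "normsq k w / r \<le> r * normsq k v" by simp
  then have "normsq k w \<le> r\<^sup>2 * normsq k v" using r by (simp add: pos_divide_le_eq power2_eq_square mult_ac)
  then show ?thesis by (simp only: w_def)
qed

text \<open>The contraction is iterated on the \<open>j\<close>-th column as a whole, so each entry
  obeys the bound without a factor depending on \<open>k\<close>.\<close>

lemma norm_mpow_le:
  fixes D :: "nat \<Rightarrow> nat \<Rightarrow> 'h::chilbert_space bop"
  assumes "r \<ge> 0" and contr: "\<And>v. normsq k (\<lambda>i. \<Sum>j<k. app (D i j) (v j)) \<le> r\<^sup>2 * normsq k v" and ij: "i < k" "j < k"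
  shows "norm (mpow k D n i j) \<le> r ^ n"
proof -
  have ap: "normsq k (\<lambda>i. app (mpow k D n i j) x) \<le> (r ^ n)\<^sup>2 * (norm x)\<^sup>2" for x
  proof (induction n)
    case 0
    have "normsq k (\<lambda>i. app (mpow k D 0 i j) x) = (\<Sum>i<k. if i = j then (norm x)\<^sup>2 else 0)"
      by (rule sum.cong) (auto simp: mone_def)
    then show ?case using ij by simp
  next
    case (Suc n)
    have "normsq k (\<lambda>i. app (mpow k D (Suc n) i j) x) = normsq k (\<lambda>i. \<Sum>l<k. app (D i l) (app (mpow k D n l j) x))"
      by (simp add: mmul_def app_sum_bop)
    also have "\<dots> \<le> r\<^sup>2 * normsq k (\<lambda>i. app (mpow k D n i j) x)" by (rule contr)
    also have "\<dots> \<le> r\<^sup>2 * ((r ^ n)\<^sup>2 * (norm x)\<^sup>2)" by (rule mult_left_mono[OF Suc]) simp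
    finally show ?case by (simp add: power_mult_distrib mult.assoc)
  qed
  show ?thesis
  proof (rule norm_bop_le)
    fix x
    have "(norm (app (mpow k D n i j) x))\<^sup>2 \<le> (r ^ n)\<^sup>2 * (norm x)\<^sup>2"
      using norm_le_normsq[OF ij(1), of "\<lambda>i. app (mpow k D n i j) x"] ap[of x] by simp
    then show "norm (app (mpow k D n i j) x) \<le> r ^ n * norm x"
      using assms(1) by (simp add: power2_le_iff_abs_le flip: power_mult_distrib)
  qed (use assms in simp)
qed

subsection \<open>The Calkin map\<close>

lemma calkin_hom:
  fixes S T :: "'h::chilbert_space bop"
  shows "calkin (S + T) = calkin S + calkin T" "calkin (S - T) = calkin S - calkin T"
    "calkin (S * T) = calkin S * calkin T" "calkin (c *\<^sub>C S) = c *\<^sub>C calkin S"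
    "calkin (r *\<^sub>R S) = r *\<^sub>R calkin S" "calkin (star S) = star (calkin S)"
    "calkin 1 = (1 :: 'h calkin)" "calkin 0 = (0 :: 'h calkin)"
  by (simp_all add: plus_calkin.abs_eq minus_calkin.abs_eq times_calkin.abs_eq scaleC_calkin.abs_eq
      scaleR_calkin.abs_eq star_calkin.abs_eq one_calkin.abs_eq zero_calkin.abs_eq)

lemma calkin_sum: "calkin (\<Sum>i\<in>I. F i) = (\<Sum>i\<in>I. calkin (F i))"
  by (induction I rule: infinite_finite_induct) (simp_all add: calkin_hom)

lemma norm_calkin_le: "norm (calkin S) \<le> norm S"
  using compact_dist_le[OF compact_op_0, of S] by (simp add: norm_calkin.abs_eq)

lemma bounded_linear_calkin: "bounded_linear (calkin :: 'h::chilbert_space bop \<Rightarrow> 'h calkin)"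
  by (rule bounded_linear_intro[where K = 1]) (simp_all add: calkin_hom norm_calkin_le)

lemma compact_op_rank1: "compact_op (rank1 x y)"
proof (rule compact_opI)
  fix e :: real assume e: "e > 0"
  have "e / (norm x + 1) > 0" using e by (simp add: add_nonneg_pos)
  moreover have "compact (cball (0::complex) (norm y))" by simp
  ultimately obtain F where F: "finite F" "cball (0::complex) (norm y) \<subseteq> (\<Union>c\<in>F. ball c (e / (norm x + 1)))"
    unfolding compact_eq_totally_bounded by blast
  have "\<exists>g\<in>(\<lambda>c. c *\<^sub>C x) ` F. norm (app (rank1 x y) z - g) < e" if z: "norm z \<le> 1" for z
  proof -
    have "cmod (cinner z y) \<le> norm z * norm y" by (rule norm_cinner_le)
    also have "\<dots> \<le> norm y" using z by (simp add: mult_left_le_one_le)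
    finally obtain c where c: "c \<in> F" "cmod (c - cinner z y) < e / (norm x + 1)"
      using F(2) by (force simp: dist_norm)
    have "norm (cinner z y *\<^sub>C x - c *\<^sub>C x) = cmod (c - cinner z y) * norm x"
      by (simp only: complex_vector.scale_left_diff_distrib[symmetric] norm_scaleC norm_minus_commute)
    also have "\<dots> \<le> cmod (c - cinner z y) * (norm x + 1)" by (intro mult_left_mono) auto
    also have "\<dots> < e" using c(2) by (simp add: pos_less_divide_eq add_nonneg_pos)
    finally show ?thesis using c(1) by auto
  qed
  then show "\<exists>G. finite G \<and> (\<forall>z. norm z \<le> 1 \<longrightarrow> (\<exists>g\<in>G. norm (app (rank1 x y) z - g) < e))"
    using F(1) by (intro exI[of _ "(\<lambda>c. c *\<^sub>C x) ` F"]) auto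
qed

lemma calkin_finproj:
  assumes "finproj P"
  shows "calkin P = 0"
proof -
  obtain k e where e: "onf k e" "P = span_proj k e" using finprojE[OF assms] by blast
  have "compact_op (span_proj k e)"
    unfolding span_proj_def by (induction k) (simp_all add: compact_op_0 compact_op_add compact_op_rank1)
  then show ?thesis
    by (metis calkin.abs_eq_iff diff_zero e(2) zero_calkin.abs_eq)
qed

lemma cstar_subalgebraD:
  assumes "cstar_subalgebra A"
  shows "closed A" "1 \<in> A" "0 \<in> A" "a \<in> A \<Longrightarrow> b \<in> A \<Longrightarrow> a + b \<in> A" "a \<in> A \<Longrightarrow> b \<in> A \<Longrightarrow> a * b \<in> A"
    "a \<in> A \<Longrightarrow> star a \<in> A" "a \<in> A \<Longrightarrow> c *\<^sub>C a \<in> A" "a \<in> A \<Longrightarrow> r *\<^sub>R a \<in> A"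
    "a \<in> A \<Longrightarrow> b \<in> A \<Longrightarrow> a - b \<in> A"
proof -
  have s: "c *\<^sub>C a \<in> A" if "a \<in> A" for a c using assms that by (simp add: cstar_subalgebra_def)
  show "0 \<in> A" using s[of 1 0] assms by (simp add: cstar_subalgebra_def)
  show "a - b \<in> A" if "a \<in> A" "b \<in> A"
    using s[of b "- 1"] assms that by (simp add: cstar_subalgebra_def) (metis diff_conv_add_uminus)
qed (use assms in \<open>auto simp: cstar_subalgebra_def scaleR_scaleC\<close>)

lemma cstar_subalgebra_sum:
  assumes "cstar_subalgebra A" "\<And>i. i \<in> I \<Longrightarrow> f i \<in> A"
  shows "(\<Sum>i\<in>I. f i) \<in> A"
  using assms(2) by (induction I rule: infinite_finite_induct) (auto intro: cstar_subalgebraD[OF assms(1)])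

lemma cstar_subalgebra_sums:
  assumes A: "cstar_subalgebra A" and "f sums s" "\<And>n. f n \<in> A"
  shows "s \<in> A"
proof (rule closed_sequentially[OF cstar_subalgebraD(1)[OF A]])
  show "(\<lambda>n. sum f {..<n}) \<longlonglongrightarrow> s" using assms(2) by (simp add: sums_def)
qed (auto intro: cstar_subalgebra_sum[OF A] assms(3))

subsection \<open>Positive functionals on matrices\<close>

text \<open>A matrix of functionals read as one functional on \<open>k \<times> k\<close> matrices
  over the algebra. For the entries of a matrix-valued map this is the standard correspondence
  between completely positive maps and positive functionals.\<close>

definition block_sum :: "nat \<Rightarrow> (nat \<Rightarrow> nat \<Rightarrow> 'a \<Rightarrow> complex) \<Rightarrow> (nat \<Rightarrow> nat \<Rightarrow> 'a) \<Rightarrow> complex"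
  where "block_sum k \<psi> X = (\<Sum>i<k. \<Sum>j<k. \<psi> i j (X i j))"

definition block_positive :: "nat \<Rightarrow> 'a::star_algebra set \<Rightarrow> (nat \<Rightarrow> nat \<Rightarrow> 'a \<Rightarrow> complex) \<Rightarrow> bool"
  where "block_positive k A \<psi> \<longleftrightarrow>
    (\<forall>i<k. \<forall>j<k. (\<forall>a\<in>A. \<forall>b\<in>A. \<psi> i j (a + b) = \<psi> i j a + \<psi> i j b) \<and> (\<forall>a\<in>A. \<forall>c. \<psi> i j (c *\<^sub>C a) = c * \<psi> i j a)) \<and>
    (\<forall>X. (\<forall>i<k. \<forall>j<k. X i j \<in> A) \<longrightarrow> 0 \<le> block_sum k \<psi> (mmul k (mstar X) X))"

lemma block_sum_add:
  assumes "block_positive k A \<psi>" "\<And>i j. i < k \<Longrightarrow> j < k \<Longrightarrow> X i j \<in> A" "\<And>i j. i < k \<Longrightarrow> j < k \<Longrightarrow> Y i j \<in> A"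
  shows "block_sum k \<psi> (\<lambda>i j. X i j + Y i j) = block_sum k \<psi> X + block_sum k \<psi> Y"
  using assms by (simp add: block_sum_def block_positive_def sum.distrib)

lemma block_sum_scale:
  assumes "block_positive k A \<psi>" "\<And>i j. i < k \<Longrightarrow> j < k \<Longrightarrow> X i j \<in> A"
  shows "block_sum k \<psi> (\<lambda>i j. c *\<^sub>C X i j) = c * block_sum k \<psi> X"
  using assms by (simp add: block_sum_def block_positive_def sum_distrib_left)

lemma block_sum_cong:
  "(\<And>i j. i < k \<Longrightarrow> j < k \<Longrightarrow> X i j = Y i j) \<Longrightarrow> block_sum k \<psi> X = block_sum k \<psi> Y"
  by (simp add: block_sum_def)

text \<open>Polarization: positivity at \<open>1 + X\<close> and \<open>1 + \<i>X\<close> forces \<open>Im (\<Psi> X + \<Psi> X\<^sup>*) = 0\<close> and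
  \<open>Re (\<Psi> X - \<Psi> X\<^sup>*) = 0\<close>.\<close>

lemma block_sum_mstar:
  assumes A: "cstar_subalgebra A" and bp: "block_positive k A \<psi>" and X: "\<And>i j. i < k \<Longrightarrow> j < k \<Longrightarrow> X i j \<in> A"
  shows "Re (block_sum k \<psi> (mstar X)) = Re (block_sum k \<psi> X)"
proof -
  note [intro] = cstar_subalgebraD(2-)[OF A]
  have pos: "Im (block_sum k \<psi> (mmul k (mstar X) X)) = 0" if "\<And>i j. i < k \<Longrightarrow> j < k \<Longrightarrow> X i j \<in> A" for X
    using bp that by (simp add: block_positive_def less_eq_complex_def)
  have mm: "mmul k (mstar X) X i j \<in> A" if "\<And>i j. i < k \<Longrightarrow> j < k \<Longrightarrow> X i j \<in> A" "i < k" "j < k" for X i j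
    unfolding mmul_def mstar_def using that by (intro cstar_subalgebra_sum[OF A]) auto
  have one: "mone i j \<in> A" for i j unfolding mone_def by auto
  have key: "Im (block_sum k \<psi> X + block_sum k \<psi> (mstar X)) = 0"
    if X: "\<And>i j. i < k \<Longrightarrow> j < k \<Longrightarrow> X i j \<in> A" for X
  proof -
    let ?Y = "\<lambda>i j. mone i j + X i j"
    have ms: "mstar X i j \<in> A" if "i < k" "j < k" for i j unfolding mstar_def using X that by auto
    have "block_sum k \<psi> (mmul k (mstar ?Y) ?Y)
        = block_sum k \<psi> (\<lambda>i j. mmul k (mstar mone) mone i j + ((X i j + mstar X i j) + mmul k (mstar X) X i j))"
    proof (rule block_sum_cong)
      fix i j assume ij: "i < k" "j < k"
      have "mmul k (mstar ?Y) ?Y i j = mmul k (mstar mone) mone i j + mmul k (mstar mone) X i j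
          + mmul k (mstar X) mone i j + mmul k (mstar X) X i j"
        by (simp add: mmul_def mstar_def star_add algebra_simps sum.distrib)
      moreover have "mstar mone = (mone :: nat \<Rightarrow> nat \<Rightarrow> 'a)" by (auto simp: mstar_def mone_def fun_eq_iff)
      ultimately show "mmul k (mstar ?Y) ?Y i j
          = mmul k (mstar mone) mone i j + ((X i j + mstar X i j) + mmul k (mstar X) X i j)"
        using ij by (simp add: mone_mmul mmul_mone)
    qed
    also have "\<dots> = block_sum k \<psi> (mmul k (mstar mone) mone) + ((block_sum k \<psi> X + block_sum k \<psi> (mstar X))
        + block_sum k \<psi> (mmul k (mstar X) X))"
      using X ms mm[OF X] mm[of mone] one
      by (simp add: block_sum_add[OF bp] cstar_subalgebraD[OF A])
    finally have "Im (block_sum k \<psi> (mmul k (mstar ?Y) ?Y)) =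
        Im (block_sum k \<psi> (mmul k (mstar mone) mone)) + Im (block_sum k \<psi> X + block_sum k \<psi> (mstar X))
        + Im (block_sum k \<psi> (mmul k (mstar X) X))" by simp
    moreover have "Im (block_sum k \<psi> (mmul k (mstar ?Y) ?Y)) = 0" using X one by (intro pos) auto
    ultimately show ?thesis using pos[OF X] pos[of mone] one by simp
  qed
  have ms: "mstar X i j \<in> A" if "i < k" "j < k" for i j unfolding mstar_def using X that by auto
  have "Im (block_sum k \<psi> (\<lambda>i j. \<i> *\<^sub>C X i j) + block_sum k \<psi> (mstar (\<lambda>i j. \<i> *\<^sub>C X i j))) = 0"
    using X by (intro key) auto
  moreover have "block_sum k \<psi> (mstar (\<lambda>i j. \<i> *\<^sub>C X i j)) = block_sum k \<psi> (\<lambda>i j. (- \<i>) *\<^sub>C mstar X i j)"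
    by (rule block_sum_cong) (simp add: mstar_def star_scaleC)
  moreover have "block_sum k \<psi> (\<lambda>i j. (- \<i>) *\<^sub>C mstar X i j) = (- \<i>) * block_sum k \<psi> (mstar X)"
    by (rule block_sum_scale[OF bp ms])
  moreover have "block_sum k \<psi> (\<lambda>i j. \<i> *\<^sub>C X i j) = \<i> * block_sum k \<psi> X"
    by (rule block_sum_scale[OF bp X])
  ultimately show ?thesis by simp
qed

text \<open>A self-adjoint matrix that is bounded below by \<open>-\<epsilon>\<close> on a subspace of finite codimension has,
  up to compact matrices and after adding \<open>2\<epsilon>\<close>, a square root with entries in the algebra.\<close>

lemma block_positive_of_form:
  fixes Y :: "nat \<Rightarrow> nat \<Rightarrow> 'h::chilbert_space bop"
  assumes A: "cstar_subalgebra A" and bp: "block_positive k A \<psi>"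
    and Y: "\<And>i j. i < k \<Longrightarrow> j < k \<Longrightarrow> calkin (Y i j) \<in> A" and G: "finite G" and \<epsilon>: "\<epsilon> > 0"
    and form: "\<And>v. (\<And>i g. i < k \<Longrightarrow> g \<in> G \<Longrightarrow> cinner (v i) g = 0) \<Longrightarrow> - \<epsilon> * normsq k v \<le> Re (block_form k Y v v)"
  shows "- (2 * \<epsilon>) * Re (block_sum k \<psi> mone) \<le> Re (block_sum k \<psi> (\<lambda>i j. calkin (Y i j)))"
proof -
  note [intro] = cstar_subalgebraD(2-)[OF A]
  obtain Q where Q: "finproj Q" "range (app Q) = cspan G" using finite_onf_proj[OF G] by blast
  \<comment> \<open>\<open>E\<close> enforces orthogonality to \<open>G\<close>, and compressing by
    it is invisible in the Calkin algebra.\<close>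
  define E where "E = 1 - Q"
  have Qp: "is_projection Q" using Q by (simp add: finproj_def)
  have E: "is_projection E" using Qp by (simp add: E_def is_projection_def algebra_simps)
  have cE: "calkin E = 1" by (simp add: E_def calkin_hom calkin_finproj[OF Q(1)])
  have Eg: "cinner (app E x) g = 0" if "g \<in> G" for x g
  proof -
    have "g \<in> range (app Q)" unfolding Q(2) using that by (rule cspan_base)
    then have "app Q g = g" using projection_idem[OF Qp] by auto
    then have "app E g = 0" by (simp add: E_def)
    then show ?thesis by (simp add: projection_sa[OF E])
  qed
  \<comment> \<open>The self-adjoint part has the same real form as \<open>Y\<close>, and by
    \<open>block_sum_mstar\<close> the functional has the same real part on both. Adding
    \<open>2 * \<epsilon>\<close> against the lower bound \<open>- \<epsilon>\<close> leaves
    \<open>W\<close> bounded below by \<open>\<epsilon>\<close>.\<close>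
  define Z where "Z i j = (1/2) *\<^sub>C (Y i j + star (Y j i))" for i j
  define W where "W i j = E * Z i j * E + complex_of_real (2 * \<epsilon>) *\<^sub>C mone i j" for i j
  have Zs: "star (Z i j) = Z j i" for i j by (simp add: Z_def star_scaleC star_add star_star add.commute)
  have Es: "star E = E" using E by (simp add: is_projection_def)
  have ones: "star (mone i j) = (mone j i :: 'b::star_algebra)" for i j by (simp add: mone_def)
  have Ws: "star (W i j) = W j i" for i j
    by (simp add: W_def star_add star_mult Zs Es ones star_scaleC mult.assoc)
  have Zform: "Re (block_form k Z v v) = Re (block_form k Y v v)" for v
  proof -
    have "block_form k (\<lambda>i j. star (Y j i)) v v = cnj (block_form k Y v v)"
      unfolding block_form_def cnj_sum
      by (subst sum.swap) (intro sum.cong refl, simp add: cinner_star[symmetric] cinner_star' star_star flip: cinner_commute)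
    moreover have "block_form k Z v v = (1/2) * (block_form k Y v v + block_form k (\<lambda>i j. star (Y j i)) v v)"
      by (simp add: block_form_def Z_def cinner_simps sum.distrib sum_distrib_left distrib_left)
    ultimately show ?thesis by (simp only: Re_half_mult) simp
  qed
  have one_form: "block_form k mone v v = of_real (normsq k v)" for v :: "nat \<Rightarrow> 'h"
  proof -
    have "(\<Sum>j<k. cinner (app (mone i j) (v j)) (v i)) = (\<Sum>j<k. if i = j then of_real ((norm (v i))\<^sup>2) else 0)" for i
      by (rule sum.cong) (auto simp: mone_def cinner_self)
    then show ?thesis by (simp add: block_form_def)
  qed
  have Wform: "block_form k W v v = block_form k Z (\<lambda>i. app E (v i)) (\<lambda>i. app E (v i)) + of_real (2 * \<epsilon> * normsq k v)" for v
  proof -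
    have "block_form k W v v = block_form k Z (\<lambda>i. app E (v i)) (\<lambda>i. app E (v i)) + of_real (2 * \<epsilon>) * block_form k mone v v"
      by (simp add: block_form_def W_def cinner_simps sum.distrib sum_distrib_left projection_sa[OF E])
    then show ?thesis by (simp add: one_form)
  qed
  have Wge: "\<epsilon> * normsq k v \<le> Re (block_form k W v v)" for v
  proof -
    have "norm (app E x) \<le> norm x" for x
      using norm_app_le[of E x] mult_right_mono[OF norm_projection_le[OF E] norm_ge_zero[of x]] by simp
    then have "normsq k (\<lambda>i. app E (v i)) \<le> normsq k v" by (intro sum_mono power_mono) auto
    then have "- \<epsilon> * normsq k v \<le> - \<epsilon> * normsq k (\<lambda>i. app E (v i))" using \<epsilon> by simp
    also have "\<dots> \<le> Re (block_form k Y (\<lambda>i. app E (v i)) (\<lambda>i. app E (v i)))" by (rule form) (rule Eg)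
    finally show ?thesis by (simp add: Wform Zform)
  qed
  \<comment> \<open>\<open>c\<close> dominates the form of \<open>W\<close>, so the form of
    \<open>D = 1 - W / c\<close> lies between 0 and \<open>r = 1 - \<epsilon> / c\<close>. The
    summand \<open>2 * \<epsilon>\<close> ensures \<open>0 < r\<close> even when the sum of norms
    vanishes.\<close>
  define c where "c = (\<Sum>i<k. \<Sum>j<k. norm (W i j)) + 2 * \<epsilon>"
  have "0 \<le> (\<Sum>i<k. \<Sum>j<k. norm (W i j))" by (intro sum_nonneg) auto
  then have c: "c > 0" "\<epsilon> < c" using \<epsilon> by (auto simp: c_def)
  define D where "D i j = mone i j - complex_of_real (1 / c) *\<^sub>C W i j" for i j
  have Ds: "star (D i j) = D j i" for i j by (simp add: D_def Ws ones star_scaleC)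
  define r where "r = 1 - \<epsilon> / c"
  have r: "0 < r" "r < 1" using c \<epsilon> by (simp_all add: r_def)
  have Dform: "Re (block_form k D v v) = normsq k v - Re (block_form k W v v) / c" for v
  proof -
    have "block_form k D v v = block_form k mone v v - of_real (1 / c) * block_form k W v v"
      by (simp add: block_form_def D_def cinner_simps sum_subtractf sum_distrib_left)
    then have "Re (block_form k D v v) = normsq k v - Re (of_real (1 / c) * block_form k W v v)"
      by (simp add: one_form)
    then show ?thesis by (simp only: Re_of_real_mult) simp
  qed
  have Dpos: "0 \<le> Re (block_form k D v v)" for v
  proof -
    have "Re (block_form k W v v) \<le> (\<Sum>i<k. \<Sum>j<k. norm (W i j)) * normsq k v"
      using block_form_bound[of k W v] complex_Re_le_cmod order_trans by blast
    also have "\<dots> \<le> c * normsq k v" using \<epsilon> by (intro mult_right_mono) (auto simp: c_def intro: sum_nonneg)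
    finally show ?thesis using c by (simp add: Dform pos_divide_le_eq mult.commute)
  qed
  have Dle: "Re (block_form k D v v) \<le> r * normsq k v" for v
    using Wge[of v] c by (simp add: Dform r_def left_diff_distrib divide_right_mono)
  have contr: "normsq k (\<lambda>i. \<Sum>j<k. app (D i j) (v j)) \<le> r\<^sup>2 * normsq k v" for v
    by (rule block_positive_contraction[OF Ds r(1) Dpos Dle])
  have np: "norm (mpow k D n i j) \<le> r ^ n" if "i < k" "j < k" for n i j
    by (rule norm_mpow_le[OF _ contr that]) (use r in simp)
  obtain S where S: "\<And>i j. i < k \<Longrightarrow> j < k \<Longrightarrow> (\<lambda>n. sqrt_coeff n *\<^sub>R mpow k D n i j) sums S i j"
    and SS: "\<And>i j. i < k \<Longrightarrow> j < k \<Longrightarrow> mmul k (mstar S) S i j = mone i j - D i j"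
    by (rule block_sqrt[of k D r, OF Ds _ r(2) np]) (use r in auto)
  have one: "calkin (mone i j) = (mone i j :: 'h calkin)" for i j by (simp add: mone_def calkin_hom)
  have oneA: "mone i j \<in> A" for i j by (auto simp: mone_def)
  have cZ: "calkin (Z i j) \<in> A" if "i < k" "j < k" for i j
    unfolding Z_def calkin_hom by (intro cstar_subalgebraD(4,6,7)[OF A] Y that)
  have cW: "calkin (W i j) = calkin (Z i j) + complex_of_real (2 * \<epsilon>) *\<^sub>C mone i j" for i j
    by (simp add: W_def calkin_hom cE one)
  have cD: "calkin (D i j) \<in> A" if "i < k" "j < k" for i j
    unfolding D_def calkin_hom cW one by (intro cstar_subalgebraD(4,7,9)[OF A] cZ[OF that] oneA)
  have cP: "calkin (mpow k D n i j) \<in> A" if "i < k" "j < k" for n i j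
    using that
  proof (induction n arbitrary: i j)
    case (Suc n)
    then show ?case unfolding mpow.simps mmul_def calkin_sum calkin_hom
      by (intro cstar_subalgebra_sum[OF A]) (auto intro: cD)
  qed (simp add: one oneA)
  \<comment> \<open>Modulo compacts the square root stays in \<open>A\<close>, where positivity of
    the functional can be applied to it.\<close>
  have cS: "calkin (S i j) \<in> A" if "i < k" "j < k" for i j
    using bounded_linear.sums[OF bounded_linear_calkin S[OF that]]
    by (rule cstar_subalgebra_sums[OF A]) (use cP[OF that] in \<open>auto simp: calkin_hom\<close>)
  let ?s = "\<lambda>i j. calkin (S i j)"
  have "0 \<le> Re (block_sum k \<psi> (mmul k (mstar ?s) ?s))"
    using bp cS by (simp add: block_positive_def less_eq_complex_def)
  also have "block_sum k \<psi> (mmul k (mstar ?s) ?s)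
      = block_sum k \<psi> (\<lambda>i j. of_real (1 / c) *\<^sub>C (calkin (Z i j) + complex_of_real (2 * \<epsilon>) *\<^sub>C mone i j))"
  proof (rule block_sum_cong)
    fix i j assume ij: "i < k" "j < k"
    have "mmul k (mstar ?s) ?s i j = calkin (mmul k (mstar S) S i j)"
      by (simp add: mmul_def mstar_def calkin_sum calkin_hom)
    also have "mmul k (mstar S) S i j = complex_of_real (1 / c) *\<^sub>C W i j" by (simp add: SS[OF ij] D_def)
    finally show "mmul k (mstar ?s) ?s i j = of_real (1 / c) *\<^sub>C (calkin (Z i j) + complex_of_real (2 * \<epsilon>) *\<^sub>C mone i j)"
      by (simp only: calkin_hom cW)
  qed
  also have "\<dots> = of_real (1 / c) * (block_sum k \<psi> (\<lambda>i j. calkin (Z i j)) + of_real (2 * \<epsilon>) * block_sum k \<psi> mone)"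
    using cZ oneA by (subst block_sum_scale[OF bp], blast, subst block_sum_add[OF bp], blast, blast,
        subst block_sum_scale[OF bp]) auto
  finally have "0 \<le> (1 / c) * (Re (block_sum k \<psi> (\<lambda>i j. calkin (Z i j))) + 2 * \<epsilon> * Re (block_sum k \<psi> mone))"
    by simp
  then have *: "0 \<le> Re (block_sum k \<psi> (\<lambda>i j. calkin (Z i j))) + 2 * \<epsilon> * Re (block_sum k \<psi> mone)"
    using c by (simp add: zero_le_mult_iff zero_le_divide_iff)
  let ?y = "\<lambda>i j. calkin (Y i j)"
  have ysA: "mstar ?y i j \<in> A" if "i < k" "j < k" for i j using Y that by (auto simp: mstar_def)
  have "block_sum k \<psi> (\<lambda>i j. calkin (Z i j)) = block_sum k \<psi> (\<lambda>i j. (1/2) *\<^sub>C (?y i j + mstar ?y i j))"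
    by (rule block_sum_cong) (simp add: Z_def calkin_hom mstar_def)
  also have "\<dots> = (1/2) * (block_sum k \<psi> ?y + block_sum k \<psi> (mstar ?y))"
    using Y ysA by (subst block_sum_scale[OF bp], blast, subst block_sum_add[OF bp]) auto
  finally have "Re (block_sum k \<psi> (\<lambda>i j. calkin (Z i j))) = Re (block_sum k \<psi> ?y)"
    using block_sum_mstar[OF A bp Y] by (simp only: Re_half_mult) simp
  then show ?thesis using * by simp
qed

section \<open>Least squares approximation by vector functionals and Glimm's lemma\<close>

lemma cmod_add_scaled_power2:
  "(cmod (u + of_real s * v))\<^sup>2 = (cmod u)\<^sup>2 + 2 * s * Re (cnj u * v) + s\<^sup>2 * (cmod v)\<^sup>2"
  unfolding cmod_power2 by (simp add: power2_eq_square algebra_simps)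

lemma sum_cmod_add_scaled_power2:
  "(\<Sum>t\<in>I. (cmod (u t + of_real s * v t))\<^sup>2)
    = (\<Sum>t\<in>I. (cmod (u t))\<^sup>2) + 2 * s * (\<Sum>t\<in>I. Re (cnj (u t) * v t)) + s\<^sup>2 * (\<Sum>t\<in>I. (cmod (v t))\<^sup>2)"
  by (simp only: cmod_add_scaled_power2 sum.distrib sum_distrib_left)

text \<open>The functional is compared with vector functionals of tuples orthogonal to \<open>G\<close>. At an almost
  best approximation \<open>x\<close>, perturbing \<open>x\<close> by tuples orthogonal to \<open>G\<close>, \<open>X x\<close> and \<open>X\<^sup>* x\<close> has no cross
  terms, so the error vector defines a form which is almost positive there.\<close>

lemma block_functional_approx:
  fixes F G
  assumes A: "cstar_subalgebra (A :: 'h::chilbert_space calkin set)" and bp: "block_positive k A \<psi>"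
    and G: "finite G" and F: "finite F" "\<And>X. X \<in> F \<Longrightarrow> calkin X \<in> A" and \<epsilon>: "\<epsilon> > 0"
  shows "\<exists>x :: nat \<Rightarrow> 'h. (\<forall>i<k. \<forall>g\<in>G. cinner (x i) g = 0) \<and>
    (\<Sum>(X, i, j)\<in>F \<times> {..<k} \<times> {..<k}. (cmod (cinner (app X (x j)) (x i) - \<psi> i j (calkin X)))\<^sup>2) < \<epsilon>"
proof -
  define I where "I = F \<times> {..<k} \<times> {..<k}"
  define c where "c x t = (case t of (X, i, j) \<Rightarrow> cinner (app X (x j)) (x i))" for x :: "nat \<Rightarrow> 'h" and t
  define p where "p t = (case t of (X, i, j) \<Rightarrow> \<psi> i j (calkin X))" for t
  define \<rho> where "\<rho> x = (\<Sum>t\<in>I. (cmod (c x t - p t))\<^sup>2)" for x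
  define V where "V = {x :: nat \<Rightarrow> 'h. \<forall>i<k. \<forall>g\<in>G. cinner (x i) g = 0}"
  define d where "d = (INF x\<in>V. \<rho> x)"
  define p2 where "p2 = (\<Sum>t\<in>I. (cmod (p t))\<^sup>2)"
  define B where "B = (\<Sum>(X, i, j)\<in>I. (norm X)\<^sup>2)"
  define M where "M = Re (block_sum k \<psi> mone)"
  \<comment> \<open>Per unit of \<open>\<theta>\<close>, the first summand bounds the radial term
    \<open>(1 + ?cx) / 2\<close>, where \<open>?cx \<le> 2 + 4 * p2\<close>, and the second the
    defect of positivity of the error form. Letting \<open>\<theta>\<close> tend to 0 in
    \<open>key\<close> gives \<open>d \<le> 0\<close>.\<close>
  define C where "C = (3 + 4 * p2) / 2 + (1 + B) * M"
  have I: "finite I" using F by (simp add: I_def)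
  have bdd: "bdd_below (\<rho> ` V)" by (rule bdd_belowI[of _ 0]) (auto simp: \<rho>_def intro: sum_nonneg)
  have d_le: "d \<le> \<rho> x" if "x \<in> V" for x unfolding d_def by (rule cINF_lower[OF bdd that])
  have zV: "(\<lambda>_. 0) \<in> V" by (simp add: V_def)
  have "\<rho> (\<lambda>_. 0) = p2" by (auto simp: \<rho>_def p2_def c_def intro!: sum.cong)
  then have dp: "d \<le> p2" using d_le[OF zV] by simp
  have p20: "p2 \<ge> 0" and B0: "B \<ge> 0" unfolding p2_def B_def by (auto intro!: sum_nonneg)
  have regroup: "(\<Sum>i<k. \<Sum>j<k. \<Sum>X\<in>F. h (X, i, j)) = (\<Sum>t\<in>I. h t)" for h :: "_ \<Rightarrow> complex"
  proof -
    have "(\<Sum>i<k. \<Sum>j<k. \<Sum>X\<in>F. h (X, i, j)) = (\<Sum>X\<in>F. \<Sum>i<k. \<Sum>j<k. h (X, i, j))"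
      by (subst (2) sum.swap) (simp add: sum.swap[of _ F])
    then show ?thesis by (simp add: I_def sum.cartesian_product)
  qed
  have key: "d \<le> C * \<theta>" if \<theta>: "0 < \<theta>" "\<theta> \<le> 1" for \<theta>
  proof -
    have "Inf (\<rho> ` V) < d + \<theta>\<^sup>2" using \<theta> by (simp add: d_def)
    then obtain x where x: "x \<in> V" "\<rho> x < d + \<theta>\<^sup>2" using cInf_lessD[of "\<rho> ` V"] zV by blast
    define a where "a t = c x t - p t" for t
    let ?cx = "\<Sum>t\<in>I. (cmod (c x t))\<^sup>2"
    let ?acx = "\<Sum>t\<in>I. Re (cnj (a t) * c x t)" and ?ap = "\<Sum>t\<in>I. Re (cnj (a t) * p t)"
    define G' where "G' = G \<union> (\<lambda>(X, j). app X (x j)) ` (F \<times> {..<k}) \<union> (\<lambda>(X, j). app (star X) (x j)) ` (F \<times> {..<k})"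
    have G': "finite G'" using F G by (simp add: G'_def)
    have a2: "(\<Sum>t\<in>I. (cmod (a t))\<^sup>2) = \<rho> x" by (simp add: \<rho>_def a_def)
    \<comment> \<open>Shrinking \<open>x\<close> by \<open>sqrt (1 - \<theta>)\<close> scales
      \<open>c x\<close> by \<open>1 - \<theta>\<close>. Near minimality forbids a substantial gain,
      which bounds the component of \<open>c x\<close> along \<open>a\<close>. The slack in the
      choice of \<open>x\<close> is quadratic in \<open>\<theta>\<close> so that a bound linear in
      \<open>\<theta>\<close> remains after division.\<close>
    have scaled: "2 * ?acx \<le> \<theta> * (1 + ?cx)"
    proof -
      let ?y = "\<lambda>i. complex_of_real (sqrt (1 - \<theta>)) *\<^sub>C x i"
      have "c ?y t = complex_of_real (1 - \<theta>) * c x t" for t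
        using \<theta> by (auto simp: c_def app_scaleC cinner_simps mult.assoc[symmetric] split: prod.split
            simp flip: of_real_mult)
      then have "c ?y t - p t = a t + of_real (- \<theta>) * c x t" for t
        by (simp add: a_def algebra_simps)
      then have "\<rho> ?y = (\<Sum>t\<in>I. (cmod (a t + of_real (- \<theta>) * c x t))\<^sup>2)" by (simp only: \<rho>_def)
      moreover have "?y \<in> V" using x(1) by (simp add: V_def cinner_simps)
      ultimately have "d \<le> \<rho> x + 2 * (- \<theta>) * ?acx + (- \<theta>)\<^sup>2 * ?cx"
        using d_le[of ?y] unfolding sum_cmod_add_scaled_power2 a2 by simp
      then have "\<theta> * (2 * ?acx) \<le> \<theta> * (\<theta> * (1 + ?cx))"
        using x(2) by (simp add: algebra_simps power2_eq_square)
      then show ?thesis using \<theta> by simp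
    qed
    \<comment> \<open>Pairing with the error vector \<open>a\<close> becomes the form of a single
      operator matrix, to which \<open>block_positive_of_form\<close> applies.\<close>
    define Y where "Y i j = (\<Sum>X\<in>F. cnj (a (X, i, j)) *\<^sub>C X)" for i j
    have Yform: "Re (block_form k Y y y) = (\<Sum>t\<in>I. Re (cnj (a t) * c y t))" for y
    proof -
      have "block_form k Y y y = (\<Sum>i<k. \<Sum>j<k. \<Sum>X\<in>F. cnj (a (X, i, j)) * c y (X, i, j))"
        by (simp add: block_form_def Y_def app_sum_bop cinner_sum_left cinner_scaleC_left c_def)
      then show ?thesis using regroup[of "\<lambda>t. cnj (a t) * c y t"] by simp
    qed
    have form: "- (\<theta> * (1 + B) / 2) * normsq k y \<le> Re (block_form k Y y y)"
      if y: "\<And>i g. i < k \<Longrightarrow> g \<in> G' \<Longrightarrow> cinner (y i) g = 0" for y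
    proof (cases "normsq k y = 0")
      case True
      then have "y i = 0" if "i < k" for i using that by (auto simp: sum_nonneg_eq_0_iff)
      then show ?thesis using True by (simp add: block_form_def)
    next
      case False
      define N where "N = normsq k y"
      have N: "N > 0" using False by (simp add: N_def sum_nonneg less_le)
      \<comment> \<open>The perturbation then has squared length \<open>\<theta>\<close>: its first
        order effect on the error is balanced against the second order term and the quadratic
        slack.\<close>
      define \<mu> where "\<mu> = sqrt (\<theta> / N)"
      have mu: "\<mu>\<^sup>2 = \<theta> / N" using N \<theta> by (simp add: \<mu>_def)
      let ?z = "\<lambda>i. x i + complex_of_real \<mu> *\<^sub>C y i"
      have zV: "?z \<in> V" using x(1) y by (auto simp: V_def cinner_simps G'_def)
      have cz: "c ?z t = c x t + of_real (\<mu>\<^sup>2) * c y t" if tI: "t \<in> I" for t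
      proof -
        obtain X i j where t: "t = (X, i, j)" "X \<in> F" "i < k" "j < k" using tI by (auto simp: I_def)
        have "cinner (y i) (app X (x j)) = 0" using t by (intro y) (auto simp: G'_def)
        then have "cinner (app X (x j)) (y i) = 0" using cinner_commute[of "app X (x j)"] by simp
        moreover have "cinner (app X (y j)) (x i) = cinner (y j) (app (star X) (x i))" by (rule cinner_star)
        moreover have "\<dots> = 0" using t by (intro y) (auto simp: G'_def)
        ultimately show ?thesis
          by (simp add: t c_def app_add app_scaleC cinner_simps power2_eq_square)
      qed
      have "d \<le> \<rho> ?z" by (rule d_le[OF zV])
      also have "\<rho> ?z = (\<Sum>t\<in>I. (cmod (a t + of_real (\<mu>\<^sup>2) * c y t))\<^sup>2)"
        unfolding \<rho>_def by (rule sum.cong) (simp_all add: cz a_def algebra_simps)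
      also have "\<dots> = \<rho> x + 2 * \<mu>\<^sup>2 * Re (block_form k Y y y) + (\<mu>\<^sup>2)\<^sup>2 * (\<Sum>t\<in>I. (cmod (c y t))\<^sup>2)"
        unfolding sum_cmod_add_scaled_power2 a2 Yform ..
      also have "(\<Sum>t\<in>I. (cmod (c y t))\<^sup>2) \<le> B * N\<^sup>2"
        unfolding B_def sum_distrib_right
      proof (rule sum_mono)
        fix t assume "t \<in> I"
        then obtain X i j where t: "t = (X, i, j)" "i < k" "j < k" by (auto simp: I_def)
        have "cmod (c y t) \<le> norm (app X (y j)) * norm (y i)" by (simp add: c_def t norm_cinner_le)
        also have "\<dots> \<le> norm X * norm (y j) * norm (y i)" by (intro mult_right_mono norm_app_le) simp
        finally have "(cmod (c y t))\<^sup>2 \<le> (norm X * norm (y j) * norm (y i))\<^sup>2" by (intro power_mono) auto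
        also have "\<dots> = (norm X)\<^sup>2 * ((norm (y j))\<^sup>2 * (norm (y i))\<^sup>2)" by (simp add: power_mult_distrib)
        also have "\<dots> \<le> (norm X)\<^sup>2 * (N * N)"
          using N t unfolding N_def by (intro mult_left_mono mult_mono norm_le_normsq) auto
        finally show "(cmod (c y t))\<^sup>2 \<le> (case t of (X, i, j) \<Rightarrow> (norm X)\<^sup>2) * N\<^sup>2"
          by (simp add: t power2_eq_square)
      qed
      finally have "d \<le> \<rho> x + 2 * \<mu>\<^sup>2 * Re (block_form k Y y y) + (\<mu>\<^sup>2)\<^sup>2 * (B * N\<^sup>2)"
        by (simp add: mult_left_mono)
      then have "- \<theta>\<^sup>2 \<le> 2 * (\<theta> / N) * Re (block_form k Y y y) + (\<theta> / N)\<^sup>2 * (B * N\<^sup>2)"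
        using x(2) unfolding mu by linarith
      then have "- \<theta>\<^sup>2 - \<theta>\<^sup>2 * B \<le> 2 * (\<theta> / N) * Re (block_form k Y y y)"
        using N by (simp add: power_divide)
      then have "\<theta> * (- \<theta> * (1 + B)) \<le> \<theta> * (2 * Re (block_form k Y y y) / N)"
        by (simp add: power2_eq_square algebra_simps)
      then have "- \<theta> * (1 + B) \<le> 2 * Re (block_form k Y y y) / N"
        using mult_le_cancel_left_pos[OF \<theta>(1)] by blast
      then have "- \<theta> * (1 + B) * N \<le> 2 * Re (block_form k Y y y)" using N by (simp add: pos_le_divide_eq)
      then show ?thesis by (simp add: N_def[symmetric])
    qed
    have "- (2 * (\<theta> * (1 + B) / 2)) * Re (block_sum k \<psi> mone) \<le> Re (block_sum k \<psi> (\<lambda>i j. calkin (Y i j)))"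
    proof (rule block_positive_of_form[OF A bp _ G' _ form])
      show "calkin (Y i j) \<in> A" for i j
        unfolding Y_def calkin_sum calkin_hom
        by (intro cstar_subalgebra_sum[OF A] cstar_subalgebraD(7)[OF A] F)
      show "\<theta> * (1 + B) / 2 > 0" using \<theta> B0 by simp
    qed
    moreover have "block_sum k \<psi> (\<lambda>i j. calkin (Y i j)) = (\<Sum>t\<in>I. cnj (a t) * p t)"
    proof -
      have lin: "\<psi> i j (\<Sum>X\<in>F'. f X *\<^sub>C calkin X) = (\<Sum>X\<in>F'. f X * \<psi> i j (calkin X))"
        if ij: "i < k" "j < k" and F': "F' \<subseteq> F" for i j f F'
        using finite_subset[OF F' F(1)] F'
      proof (induction F')
        case empty
        have "\<psi> i j (0 *\<^sub>C 0) = 0 * \<psi> i j 0"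
          using bp ij cstar_subalgebraD(3)[OF A] unfolding block_positive_def by blast
        then show ?case by simp
      next
        case (insert X F')
        have "(\<Sum>X\<in>F'. f X *\<^sub>C calkin X) \<in> A" "calkin X \<in> A" "f X *\<^sub>C calkin X \<in> A"
          using insert.prems F(2) by (auto intro!: cstar_subalgebra_sum[OF A] cstar_subalgebraD(7)[OF A])
        then show ?case using insert bp ij by (simp add: block_positive_def)
      qed
      have "block_sum k \<psi> (\<lambda>i j. calkin (Y i j)) = (\<Sum>i<k. \<Sum>j<k. \<Sum>X\<in>F. cnj (a (X, i, j)) * p (X, i, j))"
        by (simp add: block_sum_def Y_def calkin_sum calkin_hom lin p_def)
      then show ?thesis using regroup[of "\<lambda>t. cnj (a t) * p t"] by simp
    qed
    ultimately have pos: "- (\<theta> * (1 + B) * M) \<le> ?ap" by (simp add: M_def)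
    \<comment> \<open>The squared error is split along \<open>a = c x - p\<close>: the first part is
      controlled by \<open>scaled\<close>, the second by positivity of the functional.\<close>
    have "\<rho> x = ?acx - ?ap"
    proof -
      have "(cmod (a t))\<^sup>2 = Re (cnj (a t) * c x t) - Re (cnj (a t) * p t)" for t
      proof -
        have "complex_of_real ((cmod (a t))\<^sup>2) = cnj (a t) * (c x t - p t)"
          by (simp only: complex_norm_square a_def[symmetric] mult.commute)
        then have "(cmod (a t))\<^sup>2 = Re (cnj (a t) * (c x t - p t))" by (metis Re_complex_of_real)
        then show ?thesis by (simp add: algebra_simps)
      qed
      then show ?thesis unfolding a2[symmetric] by (simp add: sum_subtractf)
    qed
    also have "\<dots> \<le> \<theta> * (1 + ?cx) / 2 + \<theta> * (1 + B) * M" using scaled pos by linarith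
    also have "?cx \<le> 2 + 4 * p2"
    proof -
      have "(cmod (c x t))\<^sup>2 \<le> 2 * (cmod (a t))\<^sup>2 + 2 * (cmod (p t))\<^sup>2" for t
      proof -
        have "cmod (c x t) \<le> cmod (a t) + cmod (p t)" using norm_triangle_ineq[of "a t" "p t"] by (simp add: a_def)
        then have "(cmod (c x t))\<^sup>2 \<le> (cmod (a t) + cmod (p t))\<^sup>2" by (intro power_mono) auto
        also have "\<dots> \<le> 2 * (cmod (a t))\<^sup>2 + 2 * (cmod (p t))\<^sup>2"
          using sum_squares_bound[of "cmod (a t)" "cmod (p t)"] by (simp add: power2_sum)
        finally show ?thesis .
      qed
      then have "?cx \<le> 2 * \<rho> x + 2 * p2"
        unfolding a2[symmetric] p2_def sum_distrib_left sum.distrib[symmetric] by (intro sum_mono)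
      moreover have "\<theta>\<^sup>2 \<le> 1" using \<theta> by (simp add: power_le_one)
      ultimately show ?thesis using x(2) dp by linarith
    qed
    finally have "\<rho> x \<le> C * \<theta>" using \<theta> by (simp add: C_def algebra_simps divide_right_mono mult_left_mono)
    then show ?thesis using d_le[OF x(1)] by simp
  qed
  have "d < \<epsilon>"
  proof -
    define \<theta> where "\<theta> = min 1 (\<epsilon> / (2 * (\<bar>C\<bar> + 1)))"
    have \<theta>: "0 < \<theta>" "\<theta> \<le> 1" "\<theta> \<le> \<epsilon> / (2 * (\<bar>C\<bar> + 1))" using \<epsilon> by (auto simp: \<theta>_def)
    have "d \<le> C * \<theta>" by (rule key[OF \<theta>(1,2)])
    also have "\<dots> \<le> (\<bar>C\<bar> + 1) * \<theta>" using \<theta> by (intro mult_right_mono) auto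
    also have "\<dots> \<le> (\<bar>C\<bar> + 1) * (\<epsilon> / (2 * (\<bar>C\<bar> + 1)))" using \<theta> by (intro mult_left_mono) auto
    also have "\<dots> = \<epsilon> / 2" by (simp add: field_simps)
    also have "\<dots> < \<epsilon>" using \<epsilon> by simp
    finally show ?thesis .
  qed
  then obtain x where "x \<in> V" "\<rho> x < \<epsilon>" using cInf_lessD[of "\<rho> ` V" \<epsilon>] zV unfolding d_def by blast
  then show ?thesis by (auto simp: V_def \<rho>_def I_def c_def p_def case_prod_unfold)
qed

text \<open>Testing the positive block matrix at the tuple of unit vectors picks entry
  \<open>(i, j)\<close> out of block \<open>(i, j)\<close>, which is precisely the functional in
  question.\<close>

lemma ucp_block_positive:
  assumes A: "cstar_subalgebra A" and ucp: "ucp_to_mat A k \<phi>"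
  shows "block_positive k A (\<lambda>i j a. \<phi> a $$ (i, j))"
  unfolding block_positive_def
proof (intro conjI allI impI ballI)
  note cp = ucp[unfolded ucp_to_mat_def cp_to_mat_def]
  fix i j a b c assume ij: "i < k" "j < k"
  show "a \<in> A \<Longrightarrow> b \<in> A \<Longrightarrow> \<phi> (a + b) $$ (i, j) = \<phi> a $$ (i, j) + \<phi> b $$ (i, j)"
    using cp ij by (metis carrier_matD index_add_mat(1))
  show "a \<in> A \<Longrightarrow> \<phi> (c *\<^sub>C a) $$ (i, j) = c * \<phi> a $$ (i, j)"
    using cp ij by (metis carrier_matD index_smult_mat(1))
next
  note cp = ucp[unfolded ucp_to_mat_def cp_to_mat_def]
  fix X :: "nat \<Rightarrow> nat \<Rightarrow> 'a" assume X: "\<forall>i<k. \<forall>j<k. X i j \<in> A"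
  define Y where "Y i j = \<phi> (\<Sum>l<k. star (X l i) * X l j)" for i j
  have dim: "Y i j \<in> carrier_mat k k" if "i < k" "j < k" for i j
  proof -
    have "(\<Sum>l<k. star (X l i) * X l j) \<in> A"
      using X that by (intro cstar_subalgebra_sum[OF A] cstar_subalgebraD(5,6)[OF A]) auto
    then show ?thesis unfolding Y_def using cp by blast
  qed
  have "mat_block_pos k k Y" using cp X unfolding Y_def by blast
  then have "0 \<le> (\<Sum>i<k. \<Sum>j<k. (Y i j *\<^sub>v unit_vec k j) \<bullet>c unit_vec k i)"
    unfolding mat_block_pos_def by (elim allE[of _ "unit_vec k"]) simp
  also have "\<dots> = (\<Sum>i<k. \<Sum>j<k. Y i j $$ (i, j))"
  proof (intro sum.cong refl)
    fix i j assume "i \<in> {..<k}" "j \<in> {..<k}"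
    then have ij: "i < k" "j < k" by auto
    have "conjugate (unit_vec k i) = (unit_vec k i :: complex vec)" by (rule eq_vecI) (auto simp: unit_vec_def)
    then show "(Y i j *\<^sub>v unit_vec k j) \<bullet>c unit_vec k i = Y i j $$ (i, j)"
      using dim[OF ij] ij by (simp add: scalar_prod_right_unit)
  qed
  finally show "0 \<le> block_sum k (\<lambda>i j a. \<phi> a $$ (i, j)) (mmul k (mstar X) X)"
    by (simp add: block_sum_def Y_def mmul_def mstar_def)
qed

text \<open>Adding the unit to \<open>F\<close> makes the approximating tuple almost orthonormal,
  because \<open>\<phi> 1\<close> is the identity matrix. Orthonormalizing within its span costs
  little and preserves orthogonality to \<open>G\<close>.\<close>

lemma glimm:
  fixes F G
  assumes A: "cstar_subalgebra (A :: 'h::chilbert_space calkin set)" and ucp: "ucp_to_mat A k \<phi>"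
    and G: "finite G" and F: "finite F" "\<And>X. X \<in> F \<Longrightarrow> calkin X \<in> A" and \<epsilon>: "\<epsilon> > 0"
  shows "\<exists>e :: nat \<Rightarrow> 'h. onf k e \<and> (\<forall>i<k. \<forall>g\<in>G. cinner (e i) g = 0) \<and>
    (\<forall>X\<in>F. \<forall>i<k. \<forall>j<k. cmod (cinner (app X (e j)) (e i) - \<phi> (calkin X) $$ (i, j)) < \<epsilon>)"
proof -
  define K where "K = (\<Sum>X\<in>F. norm X)"
  have K: "K \<ge> 0" "\<And>X. X \<in> F \<Longrightarrow> norm X \<le> K"
    unfolding K_def using F(1) by (auto intro: sum_nonneg member_le_sum)
  \<comment> \<open>Replacing \<open>x\<close> by \<open>f\<close> costs at most
    \<open>3 * K * \<tau>\<close>, within half of \<open>\<epsilon>\<close>; the other half is the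
    accuracy \<open>\<epsilon>'\<close> of the tuple \<open>x\<close>.\<close>
  define \<tau> where "\<tau> = min 1 (\<epsilon> / (8 * (K + 1)))"
  have \<tau>: "0 < \<tau>" "\<tau> \<le> 1" "\<tau> \<le> \<epsilon> / (8 * (K + 1))" using \<epsilon> K by (auto simp: \<tau>_def)
  obtain \<delta> where \<delta>: "\<delta> > 0" and gs: "\<And>x :: nat \<Rightarrow> 'h.
    (\<forall>i<k. \<forall>j<k. cmod (cinner (x i) (x j) - (if i = j then 1 else 0)) \<le> \<delta>) \<Longrightarrow>
    (\<exists>f. onf k f \<and> (\<forall>i<k. norm (f i - x i) \<le> \<tau>) \<and> cspan (f ` {..<k}) = cspan (x ` {..<k}))"
    using almost_onf[OF \<tau>(1), of k] by blast
  define \<epsilon>' where "\<epsilon>' = min \<delta> (\<epsilon> / 2)"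
  have \<epsilon>': "\<epsilon>' > 0" "\<epsilon>' \<le> \<delta>" "\<epsilon>' \<le> \<epsilon> / 2" using \<delta> \<epsilon> by (auto simp: \<epsilon>'_def)
  have F1: "finite (insert 1 F)" "\<And>X. X \<in> insert 1 F \<Longrightarrow> calkin X \<in> A"
    using F cstar_subalgebraD(2)[OF A] by (auto simp: calkin_hom)
  obtain x :: "nat \<Rightarrow> 'h" where x: "\<And>i g. i < k \<Longrightarrow> g \<in> G \<Longrightarrow> cinner (x i) g = 0"
    and sum: "(\<Sum>(X, i, j)\<in>insert 1 F \<times> {..<k} \<times> {..<k}. (cmod (cinner (app X (x j)) (x i) - \<phi> (calkin X) $$ (i, j)))\<^sup>2) < \<epsilon>'\<^sup>2"
    using block_functional_approx[OF A ucp_block_positive[OF A ucp] G F1, of "\<epsilon>'\<^sup>2"] \<epsilon>' by auto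
  have close: "cmod (cinner (app X (x j)) (x i) - \<phi> (calkin X) $$ (i, j)) < \<epsilon>'"
    if "X \<in> insert 1 F" "i < k" "j < k" for X i j
  proof -
    have "(case (X, i, j) of (X, i, j) \<Rightarrow> (cmod (cinner (app X (x j)) (x i) - \<phi> (calkin X) $$ (i, j)))\<^sup>2)
      \<le> (\<Sum>(X, i, j)\<in>insert 1 F \<times> {..<k} \<times> {..<k}. (cmod (cinner (app X (x j)) (x i) - \<phi> (calkin X) $$ (i, j)))\<^sup>2)"
      using that F1(1) by (intro member_le_sum) auto
    then have "(cmod (cinner (app X (x j)) (x i) - \<phi> (calkin X) $$ (i, j)))\<^sup>2 < \<epsilon>'\<^sup>2" using sum by simp
    then show ?thesis using \<epsilon>'(1) by (simp add: power_less_imp_less_base)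
  qed
  have "cmod (cinner (x i) (x j) - (if i = j then 1 else 0)) \<le> \<delta>" if "i < k" "j < k" for i j
  proof -
    have "\<phi> (calkin 1) = 1\<^sub>m k" using ucp by (simp add: ucp_to_mat_def calkin_hom)
    then show ?thesis using close[of 1 j i] that \<epsilon>'(2) by (simp add: eq_commute[of j i])
  qed
  then obtain f where f: "onf k f" "\<And>i. i < k \<Longrightarrow> norm (f i - x i) \<le> \<tau>"
    "cspan (f ` {..<k}) = cspan (x ` {..<k})" using gs by blast
  have "cinner (f i) g = 0" if "i < k" "g \<in> G" for i g
  proof -
    have "f i \<in> cspan (x ` {..<k})" unfolding f(3)[symmetric] using that by (intro cspan_base) auto
    then obtain a where "f i = (\<Sum>j<k. a j *\<^sub>C x j)" using cspan_image_sum by blast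
    then show ?thesis using x that by (simp add: cinner_sum_left cinner_scaleC_left)
  qed
  moreover have "cmod (cinner (app X (f j)) (f i) - \<phi> (calkin X) $$ (i, j)) < \<epsilon>"
    if X: "X \<in> F" and ij: "i < k" "j < k" for X i j
  proof -
    have "norm (x j) \<le> 2" using f(2)[OF ij(2)] onf_norm[OF f(1) ij(2)] \<tau>(2) norm_triangle_ineq4[of "f j" "f j - x j"] by simp
    then have "cmod (cinner (app X (x j)) (f i - x i)) \<le> K * 2 * \<tau>"
      using norm_cinner_le[of "app X (x j)" "f i - x i"] norm_app_le[of X "x j"] K(2)[OF X] f(2)[OF ij(1)] K(1)
      by (elim order_trans) (intro mult_mono, auto intro: order_trans[OF _ mult_mono])
    moreover have "cmod (cinner (app X (f j - x j)) (f i)) \<le> K * \<tau>"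
      using norm_cinner_le[of "app X (f j - x j)" "f i"] norm_app_le[of X "f j - x j"] K f(2)[OF ij(2)] onf_norm[OF f(1) ij(1)]
      by (auto intro: order_trans order_trans[OF _ mult_mono] simp: X)
    moreover have "cinner (app X (f j)) (f i) - \<phi> (calkin X) $$ (i, j)
      = cinner (app X (f j - x j)) (f i) + cinner (app X (x j)) (f i - x i) + (cinner (app X (x j)) (x i) - \<phi> (calkin X) $$ (i, j))"
      by (simp add: app_diff cinner_simps)
    ultimately have "cmod (cinner (app X (f j)) (f i) - \<phi> (calkin X) $$ (i, j)) < K * \<tau> + K * 2 * \<tau> + \<epsilon>'"
      using close[of X i j] X ij by (smt (verit) insertI2 norm_triangle_ineq)
    also have "K * \<tau> + K * 2 * \<tau> + \<epsilon>' \<le> 4 * ((K + 1) * \<tau>) + \<epsilon> / 2"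
    proof -
      have "0 \<le> K * \<tau>" using K(1) \<tau>(1) by simp
      moreover have "K * 2 * \<tau> = 2 * (K * \<tau>)" "(K + 1) * \<tau> = K * \<tau> + \<tau>" by (simp_all add: distrib_right)
      ultimately show ?thesis using \<epsilon>'(3) \<tau>(1) by linarith
    qed
    also have "(K + 1) * \<tau> \<le> (K + 1) * (\<epsilon> / (8 * (K + 1)))" using \<tau>(3) K(1) by (intro mult_left_mono) auto
    also have "\<dots> = \<epsilon> / 8" using K(1) by (simp add: field_simps)
    finally show ?thesis by simp
  qed
  ultimately show ?thesis using f(1) by blast
qed

text \<open>This is \<open>block_positive_of_form\<close> with \<open>k = 1\<close>, without
  constraints, and with \<open>X\<close> rotated so that its trace becomes negative. The factor 2 is
  inherited from there; any constant serves the density argument.\<close>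

lemma tracial_state_bound:
  assumes A: "cstar_subalgebra (A :: 'h::chilbert_space calkin set)" and \<tau>: "tracial_state A \<tau>" and X: "calkin X \<in> A"
  shows "cmod (\<tau> (calkin X)) \<le> 2 * norm X"
proof (cases "\<tau> (calkin X) = 0")
  case False
  have bp: "block_positive 1 A (\<lambda>_ _. \<tau>)"
    using \<tau> by (simp add: block_positive_def tracial_state_def block_sum_def mmul_def mstar_def)
  define u where "u = - (cnj (\<tau> (calkin X)) / cmod (\<tau> (calkin X)))"
  have u: "cmod u = 1" using False by (simp add: u_def norm_divide)
  have "u * \<tau> (calkin X) = - complex_of_real (cmod (\<tau> (calkin X)))"
    using False of_real_cmod_power2[of "\<tau> (calkin X)"]
    by (simp add: u_def field_simps power2_eq_square)
  then have *: "Re (u * \<tau> (calkin X)) = - cmod (\<tau> (calkin X))" by simp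
  show ?thesis
  proof (rule field_le_epsilon)
    fix e :: real assume e: "e > 0"
    \<comment> \<open>The summand \<open>e / 2\<close> keeps the form bound positive when
      \<open>X = 0\<close>.\<close>
    have "- (2 * (norm X + e / 2)) * Re (block_sum 1 (\<lambda>_ _. \<tau>) mone) \<le> Re (block_sum 1 (\<lambda>_ _. \<tau>) (\<lambda>i j. calkin (u *\<^sub>C X)))"
    proof (rule block_positive_of_form[OF A bp _ finite.emptyI])
      show "calkin (u *\<^sub>C X) \<in> A" unfolding calkin_hom by (intro cstar_subalgebraD(7)[OF A] X)
      show "norm X + e / 2 > 0" using e by (simp add: add_nonneg_pos)
      fix v :: "nat \<Rightarrow> 'h"
      have "cmod (cinner (app (u *\<^sub>C X) (v 0)) (v 0)) \<le> norm X * norm (v 0) * norm (v 0)"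
        using norm_cinner_le[of "app (u *\<^sub>C X) (v 0)" "v 0"] norm_app_le[of X "v 0"]
        by (elim order_trans) (simp add: norm_scaleC u mult_right_mono)
      also have "\<dots> \<le> (norm X + e / 2) * (norm (v 0))\<^sup>2"
        using e by (simp add: power2_eq_square algebra_simps)
      finally have "- ((norm X + e / 2) * (norm (v 0))\<^sup>2) \<le> Re (cinner (app (u *\<^sub>C X) (v 0)) (v 0))"
        using abs_Re_le_cmod[of "cinner (app (u *\<^sub>C X) (v 0)) (v 0)"] by linarith
      then show "- (norm X + e / 2) * normsq 1 v \<le> Re (block_form 1 (\<lambda>i j. u *\<^sub>C X) v v)"
        by (simp add: block_form_def algebra_simps)
    qed
    moreover have "\<tau> (calkin (u *\<^sub>C X)) = u * \<tau> (calkin X)" using \<tau> X by (simp add: tracial_state_def calkin_hom)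
    moreover have "\<tau> 1 = 1" using \<tau> by (simp add: tracial_state_def)
    ultimately show "cmod (\<tau> (calkin X)) \<le> 2 * norm X + e"
      using * by (simp add: block_sum_def mone_def)
  qed
qed simp

subsection \<open>Projections compressing to an almost multiplicative map\<close>

lemma scalar_prod_conjugate:
  assumes "v \<in> carrier_vec k" "w \<in> carrier_vec k"
  shows "v \<bullet>c w = (\<Sum>i<k. v $ i * cnj (w $ i) :: complex)"
  using assms by (simp add: scalar_prod_def lessThan_atLeast0 conjugate_complex_def)

lemma vec_norm2_eq:
  assumes "v \<in> carrier_vec k"
  shows "vec_norm2 v = L2_set (\<lambda>i. cmod (v $ i)) {..<k}"
proof -
  have "Re (v \<bullet>c v) = (\<Sum>i<k. (cmod (v $ i))\<^sup>2)"
    unfolding scalar_prod_conjugate[OF assms assms] Re_sum complex_norm_square[symmetric] Re_complex_of_real ..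
  then show ?thesis by (simp add: vec_norm2_def L2_set_def)
qed

lemma mult_mat_vec_nth:
  assumes "M \<in> carrier_mat k k" "v \<in> carrier_vec k" "i < k"
  shows "(M *\<^sub>v v) $ i = (\<Sum>j<k. M $$ (i, j) * v $ j :: complex)"
  using assms by (simp add: scalar_prod_def lessThan_atLeast0)

text \<open>The supremum is an upper bound only once its set is known to be bounded, for which the
  sum of the moduli of the entries is good enough; homogeneity then reduces to unit vectors.\<close>

lemma mat_norm_bound:
  assumes M: "M \<in> carrier_mat k k" and v: "v \<in> carrier_vec k"
  shows "vec_norm2 (M *\<^sub>v v) \<le> mat_norm M * vec_norm2 v"
proof -
  have bdd: "bdd_above ((\<lambda>v. vec_norm2 (M *\<^sub>v v)) ` {v \<in> carrier_vec (dim_col M). vec_norm2 v \<le> 1})"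
  proof (rule bdd_aboveI2)
    fix v assume "v \<in> {v \<in> carrier_vec (dim_col M). vec_norm2 v \<le> 1}"
    then have v: "v \<in> carrier_vec k" "vec_norm2 v \<le> 1" using M by auto
    have v1: "cmod (v $ j) \<le> 1" if "j < k" for j
      using member_le_L2_set[of "{..<k}" j "\<lambda>i. cmod (v $ i)"] that v by (simp add: vec_norm2_eq)
    have "vec_norm2 (M *\<^sub>v v) \<le> (\<Sum>i<k. cmod ((M *\<^sub>v v) $ i))"
      using vec_norm2_eq[of "M *\<^sub>v v" k] mult_mat_vec_carrier[OF M v(1)] by (simp add: L2_set_le_sum)
    also have "\<dots> \<le> (\<Sum>i<k. \<Sum>j<k. cmod (M $$ (i, j)))"
    proof (rule sum_mono)
      fix i assume "i \<in> {..<k}"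
      then have "cmod ((M *\<^sub>v v) $ i) \<le> (\<Sum>j<k. cmod (M $$ (i, j) * v $ j))"
        using norm_sum by (simp add: mult_mat_vec_nth[OF M v(1)] del: norm_mult)
      also have "\<dots> \<le> (\<Sum>j<k. cmod (M $$ (i, j)))"
        by (rule sum_mono) (simp add: norm_mult v1 mult_left_le)
      finally show "cmod ((M *\<^sub>v v) $ i) \<le> (\<Sum>j<k. cmod (M $$ (i, j)))" .
    qed
    finally show "vec_norm2 (M *\<^sub>v v) \<le> (\<Sum>i<k. \<Sum>j<k. cmod (M $$ (i, j)))" .
  qed
  have Mv: "M *\<^sub>v v \<in> carrier_vec k" by (rule mult_mat_vec_carrier[OF M v])
  have nn: "vec_norm2 v \<ge> 0" by (simp add: vec_norm2_eq[OF v] L2_set_nonneg)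
  show ?thesis
  proof (cases "vec_norm2 v = 0")
    case True
    then have "v $ j = 0" if "j < k" for j
      using member_le_L2_set[of "{..<k}" j "\<lambda>i. cmod (v $ i)"] that by (simp add: vec_norm2_eq[OF v])
    then have "vec_norm2 (M *\<^sub>v v) = 0"
      by (simp add: vec_norm2_eq[OF Mv] mult_mat_vec_nth[OF M v] L2_set_def)
    then show ?thesis using True by simp
  next
    case False
    define r where "r = vec_norm2 v"
    have r: "r > 0" using False nn by (simp add: r_def)
    have scale: "vec_norm2 (complex_of_real (1 / r) \<cdot>\<^sub>v w) = (1 / r) * vec_norm2 w" if "w \<in> carrier_vec k" for w
    proof -
      have "vec_norm2 (complex_of_real (1 / r) \<cdot>\<^sub>v w) = L2_set (\<lambda>i. (1 / r) * cmod (w $ i)) {..<k}"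
        using that r by (subst vec_norm2_eq[of _ k]) (auto simp: norm_mult norm_divide intro!: L2_set_cong)
      also have "\<dots> = (1 / r) * vec_norm2 w"
        using r by (subst L2_set_right_distrib[symmetric]) (auto simp: vec_norm2_eq[OF that])
      finally show ?thesis .
    qed
    let ?w = "complex_of_real (1 / r) \<cdot>\<^sub>v v"
    have "vec_norm2 ?w = 1" using scale[OF v] r by (simp add: r_def)
    then have "vec_norm2 (M *\<^sub>v ?w) \<le> mat_norm M"
      unfolding mat_norm_def using v M by (intro cSUP_upper bdd) auto
    moreover have "vec_norm2 (M *\<^sub>v ?w) = (1 / r) * vec_norm2 (M *\<^sub>v v)"
      by (simp only: mult_mat_vec[OF M v] scale[OF Mv])
    ultimately show ?thesis using r by (simp add: r_def pos_divide_le_eq)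
  qed
qed

lemma mat_quadratic_le:
  assumes M: "M \<in> carrier_mat k k"
  shows "cmod (\<Sum>l<k. \<Sum>j<k. M $$ (l, j) * (c j * cnj (c l))) \<le> mat_norm M * (\<Sum>j<k. (cmod (c j))\<^sup>2)"
proof -
  define v where "v = vec k c"
  have v: "v \<in> carrier_vec k" by (simp add: v_def)
  have v2: "vec_norm2 v = L2_set (\<lambda>i. cmod (c i)) {..<k}"
    unfolding vec_norm2_eq[OF v] by (rule L2_set_cong) (simp_all add: v_def)
  have vc: "v $ j = c j" if "j < k" for j using that by (simp add: v_def)
  have "(\<Sum>l<k. \<Sum>j<k. M $$ (l, j) * (c j * cnj (c l))) = (\<Sum>l<k. (M *\<^sub>v v) $ l * cnj (c l))"
    by (rule sum.cong) (simp_all add: mult_mat_vec_nth[OF M v] vc sum_distrib_right mult.assoc)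
  also have "cmod \<dots> \<le> (\<Sum>l<k. \<bar>cmod ((M *\<^sub>v v) $ l)\<bar> * \<bar>cmod (c l)\<bar>)"
    by (rule order_trans[OF norm_sum]) (simp add: norm_mult)
  also have "\<dots> \<le> L2_set (\<lambda>l. cmod ((M *\<^sub>v v) $ l)) {..<k} * L2_set (\<lambda>l. cmod (c l)) {..<k}"
    by (rule L2_set_mult_ineq)
  also have "\<dots> = vec_norm2 (M *\<^sub>v v) * vec_norm2 v"
    using vec_norm2_eq[OF mult_mat_vec_carrier[OF M v]] by (simp add: v2)
  also have "\<dots> \<le> mat_norm M * vec_norm2 v * vec_norm2 v"
    by (intro mult_right_mono mat_norm_bound[OF M v]) (simp add: v2 L2_set_nonneg)
  also have "\<dots> = mat_norm M * (\<Sum>j<k. (cmod (c j))\<^sup>2)"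
    by (simp add: v2 L2_set_def sum_nonneg mult.assoc)
  finally show ?thesis .
qed

text \<open>With \<open>R = span_proj k e\<close>, the squared norm is the form of
  \<open>star T * (1 - R) * T\<close> on the range of \<open>R\<close>. Its matrix in the basis
  \<open>e\<close> is the compression of \<open>star T * T\<close> minus the product of the
  compressions of \<open>star T\<close> and \<open>T\<close>, hence close to
  \<open>M1 - M2 * M3\<close>. One \<open>\<delta>\<close> pays for that matrix, the other for the
  entrywise errors.\<close>

lemma compression_defect:
  fixes T :: "'h::chilbert_space bop"
  assumes e: "onf k e" and M: "M1 \<in> carrier_mat k k" "M2 \<in> carrier_mat k k" "M3 \<in> carrier_mat k k"
    and \<eta>: "0 \<le> \<eta>" "\<eta> \<le> 1" and \<delta>: "mat_norm (M1 - M2 * M3) \<le> \<delta>"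
    and M1: "\<And>i j. i < k \<Longrightarrow> j < k \<Longrightarrow> cmod (cinner (app (star T * T) (e j)) (e i) - M1 $$ (i, j)) \<le> \<eta>"
    and M2: "\<And>i j. i < k \<Longrightarrow> j < k \<Longrightarrow> cmod (cinner (app (star T) (e j)) (e i) - M2 $$ (i, j)) \<le> \<eta>"
    and M3: "\<And>i j. i < k \<Longrightarrow> j < k \<Longrightarrow> cmod (cinner (app T (e j)) (e i) - M3 $$ (i, j)) \<le> \<eta>"
    and \<kappa>: "(real k)\<^sup>2 * (\<eta> * (1 + real k * (2 * norm T + 1))) \<le> \<delta>"
  shows "norm ((1 - span_proj k e) * T * span_proj k e) \<le> sqrt (2 * \<delta>)"
proof (rule norm_bop_le)
  let ?R = "span_proj k e"
  have R: "is_projection ?R" by (rule is_projection_span_proj[OF e])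
  have R': "is_projection (1 - ?R)" using R by (simp add: is_projection_def algebra_simps)
  define a1 where "a1 l j = cinner (app (star T * T) (e j)) (e l)" for l j
  define a2 where "a2 l i = cinner (app (star T) (e i)) (e l)" for l i
  define a3 where "a3 i j = cinner (app T (e j)) (e i)" for i j
  define b where "b l j = a1 l j - (\<Sum>i<k. a2 l i * a3 i j)" for l j
  define D where "D = M1 - M2 * M3"
  have D: "D \<in> carrier_mat k k" unfolding D_def by (rule minus_carrier_mat[OF mult_carrier_mat[OF M(2,3)]])
  \<comment> \<open>The error of an entry of \<open>b\<close> against \<open>D\<close>:
    \<open>\<eta>\<close> from \<open>M1\<close> and \<open>\<eta> * (2 * norm T + 1)\<close> from
    each of the \<open>k\<close> products. The factor \<open>(real k)\<^sup>2\<close> in the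
    hypothesis counts the entries.\<close>
  define \<kappa>' where "\<kappa>' = \<eta> * (1 + real k * (2 * norm T + 1))"
  have \<kappa>'0: "\<kappa>' \<ge> 0" using \<eta> by (simp add: \<kappa>'_def)
  have err: "cmod (b l j - D $$ (l, j)) \<le> \<kappa>'" if lj: "l < k" "j < k" for l j
  proof -
    have "D $$ (l, j) = M1 $$ (l, j) - (\<Sum>i<k. M2 $$ (l, i) * M3 $$ (i, j))"
      using M lj by (simp add: D_def scalar_prod_def lessThan_atLeast0)
    then have "b l j - D $$ (l, j) = (a1 l j - M1 $$ (l, j)) - (\<Sum>i<k. a2 l i * a3 i j - M2 $$ (l, i) * M3 $$ (i, j))"
      by (simp add: b_def sum_subtractf)
    then have "cmod (b l j - D $$ (l, j)) \<le> cmod (a1 l j - M1 $$ (l, j)) + cmod (\<Sum>i<k. a2 l i * a3 i j - M2 $$ (l, i) * M3 $$ (i, j))"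
      by (simp only: norm_triangle_ineq4)
    also have "cmod (\<Sum>i<k. a2 l i * a3 i j - M2 $$ (l, i) * M3 $$ (i, j)) \<le> (\<Sum>i<k. \<eta> * (2 * norm T + 1))"
    proof (rule order_trans[OF norm_sum], rule sum_mono)
      fix i assume "i \<in> {..<k}"
      then have i: "i < k" by simp
      have a: "cmod (cinner (app S (e i)) (e j)) \<le> norm S" if "i < k" "j < k" for S i j
        using norm_cinner_le[of "app S (e i)" "e j"] norm_app_le[of S "e i"] onf_norm[OF e] that by simp
      have "cmod (a2 l i) \<le> norm T" using a[of i l "star T"] i lj by (simp add: a2_def)
      moreover have "cmod (a3 i j) \<le> norm T" using a[of j i T] i lj by (simp add: a3_def)
      moreover have "cmod (M3 $$ (i, j)) \<le> cmod (a3 i j) + \<eta>"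
        using M3[OF i lj(2)] norm_triangle_ineq2[of "M3 $$ (i, j)" "a3 i j"] by (simp add: a3_def norm_minus_commute)
      ultimately have n: "cmod (a2 l i) \<le> norm T" "cmod (M3 $$ (i, j)) \<le> norm T + 1" using \<eta> by auto
      have "a2 l i * a3 i j - M2 $$ (l, i) * M3 $$ (i, j)
        = a2 l i * (a3 i j - M3 $$ (i, j)) + (a2 l i - M2 $$ (l, i)) * M3 $$ (i, j)" by (simp add: algebra_simps)
      then have "cmod (a2 l i * a3 i j - M2 $$ (l, i) * M3 $$ (i, j))
        \<le> cmod (a2 l i) * cmod (a3 i j - M3 $$ (i, j)) + cmod (a2 l i - M2 $$ (l, i)) * cmod (M3 $$ (i, j))"
        by (metis norm_mult norm_triangle_ineq)
      also have "\<dots> \<le> norm T * \<eta> + \<eta> * (norm T + 1)"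
        using n M3[OF i lj(2)] M2[OF lj(1) i] \<eta> by (intro add_mono mult_mono) (auto simp: a2_def a3_def)
      finally show "cmod (a2 l i * a3 i j - M2 $$ (l, i) * M3 $$ (i, j)) \<le> \<eta> * (2 * norm T + 1)"
        by (simp add: algebra_simps)
    qed
    also have "cmod (a1 l j - M1 $$ (l, j)) \<le> \<eta>" using M1[OF lj] by (simp add: a1_def)
    finally show ?thesis by (simp add: \<kappa>'_def algebra_simps)
  qed
  fix x
  define c where "c j = cinner x (e j)" for j
  let ?SD = "\<Sum>l<k. \<Sum>j<k. D $$ (l, j) * (c j * cnj (c l))"
  let ?SE = "\<Sum>l<k. \<Sum>j<k. (b l j - D $$ (l, j)) * (c j * cnj (c l))"
  define y where "y = (\<Sum>j<k. c j *\<^sub>C e j)"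
  have y: "app ?R x = y" by (simp add: app_span_proj y_def c_def)
  have c2: "(\<Sum>j<k. (cmod (c j))\<^sup>2) \<le> (norm x)\<^sup>2"
  proof -
    have "(\<Sum>j<k. (cmod (c j))\<^sup>2) = (norm (app ?R x))\<^sup>2" unfolding y y_def by (simp add: norm_onf_sum[OF e])
    also have "\<dots> \<le> (norm x)\<^sup>2"
      using norm_app_le[of ?R x] mult_right_mono[OF norm_projection_le[OF R] norm_ge_zero[of x]]
      by (intro power_mono) auto
    finally show ?thesis .
  qed
  have Ty: "app S y = (\<Sum>j<k. c j *\<^sub>C app S (e j))" for S by (simp add: y_def app_sum app_scaleC)
  have quad: "cinner (app S y) y = (\<Sum>l<k. \<Sum>j<k. cinner (app S (e j)) (e l) * (c j * cnj (c l)))" for S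
  proof -
    have "cinner (app S y) y = (\<Sum>l<k. cnj (c l) * cinner (app S y) (e l))"
      by (subst (2) y_def) (simp add: cinner_sum_right cinner_scaleC_right)
    also have "\<dots> = (\<Sum>l<k. \<Sum>j<k. cinner (app S (e j)) (e l) * (c j * cnj (c l)))"
      by (simp add: Ty cinner_sum_left cinner_scaleC_left sum_distrib_left mult_ac)
    finally show ?thesis .
  qed
  have defect: "cinner (app (star T * T - star T * ?R * T) (e j)) (e l) = b l j" for l j
  proof -
    have "cinner (app (star T * ?R * T) (e j)) (e l) = (\<Sum>i<k. a2 l i * a3 i j)"
      by (simp add: app_span_proj app_sum app_scaleC cinner_sum_left cinner_scaleC_left a2_def a3_def mult.commute)
    then show ?thesis by (simp add: b_def a1_def cinner_diff_left del: app_bop(6))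
  qed
  have "complex_of_real ((norm (app ((1 - ?R) * T * ?R) x))\<^sup>2)
      = cinner (app (1 - ?R) (app T y)) (app (1 - ?R) (app T y))"
    by (simp only: cinner_self app_bop(6) y)
  also have "\<dots> = cinner (app (star T * T - star T * ?R * T) y) y"
  proof -
    have "cinner (app (1 - ?R) (app T y)) (app (1 - ?R) (app T y)) = cinner (app (1 - ?R) (app T y)) (app T y)"
      by (simp only: projection_sa[OF R', symmetric] projection_idem[OF R'])
    also have "\<dots> = cinner (app (star T) (app (1 - ?R) (app T y))) y" by (rule cinner_star')
    also have "app (star T) (app (1 - ?R) (app T y)) = app (star T * T - star T * ?R * T) y"
      by (simp add: app_diff)
    finally show ?thesis .
  qed
  also have "\<dots> = (\<Sum>l<k. \<Sum>j<k. b l j * (c j * cnj (c l)))" unfolding quad defect ..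
  also have "\<dots> = ?SD
      + ?SE"
    by (simp add: sum.distrib[symmetric] algebra_simps)
  finally have "(norm (app ((1 - ?R) * T * ?R) x))\<^sup>2
      = cmod (?SD + ?SE)"
    by (metis norm_of_real abs_of_nonneg zero_le_power2)
  also have "\<dots> \<le> cmod ?SD
      + cmod ?SE" by (rule norm_triangle_ineq)
  also have "cmod ?SD \<le> \<delta> * (norm x)\<^sup>2"
  proof -
    have "mat_norm D * (\<Sum>j<k. (cmod (c j))\<^sup>2) \<le> \<delta> * (\<Sum>j<k. (cmod (c j))\<^sup>2)"
      using \<delta> by (intro mult_right_mono) (auto simp: D_def intro: sum_nonneg)
    also have "\<dots> \<le> \<delta> * (norm x)\<^sup>2"
      using c2 \<kappa> \<kappa>'0 by (intro mult_left_mono) (auto simp: \<kappa>'_def[symmetric] intro: order_trans[rotated])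
    finally show ?thesis using mat_quadratic_le[OF D, of c] by linarith
  qed
  also have "cmod ?SE \<le> \<delta> * (norm x)\<^sup>2"
  proof -
    have "cmod ?SE \<le> (\<Sum>l<k. \<Sum>j<k. \<kappa>' * (norm x)\<^sup>2)"
    proof (rule order_trans[OF norm_sum], rule sum_mono, rule order_trans[OF norm_sum], rule sum_mono)
      fix l j assume "l \<in> {..<k}" "j \<in> {..<k}"
      then have lj: "l < k" "j < k" by auto
      have n: "cmod (c i) \<le> norm x" if "i < k" for i
        using norm_cinner_le[of x "e i"] onf_norm[OF e that] by (simp add: c_def)
      have "cmod (b l j - D $$ (l, j)) * (cmod (c j) * cmod (c l)) \<le> \<kappa>' * (norm x * norm x)"
        using err[OF lj] n lj \<kappa>'0 by (intro mult_mono) auto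
      then show "cmod ((b l j - D $$ (l, j)) * (c j * cnj (c l))) \<le> \<kappa>' * (norm x)\<^sup>2"
        by (simp add: norm_mult power2_eq_square)
    qed
    also have "\<dots> = (real k)\<^sup>2 * \<kappa>' * (norm x)\<^sup>2" by (simp add: power2_eq_square)
    also have "\<dots> \<le> \<delta> * (norm x)\<^sup>2" using \<kappa> by (intro mult_right_mono) (auto simp: \<kappa>'_def)
    finally show ?thesis .
  qed
  finally have "(norm (app ((1 - ?R) * T * ?R) x))\<^sup>2 \<le> 2 * \<delta> * (norm x)\<^sup>2" by simp
  then have "norm (app ((1 - ?R) * T * ?R) x) \<le> sqrt (2 * \<delta> * (norm x)\<^sup>2)" by (rule real_le_rsqrt)
  then show "norm (app ((1 - ?R) * T * ?R) x) \<le> sqrt (2 * \<delta>) * norm x" by (simp add: real_sqrt_mult)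
next
  have "0 \<le> (real k)\<^sup>2 * (\<eta> * (1 + real k * (2 * norm T + 1)))" using \<eta> by simp
  then have "0 \<le> \<delta>" using \<kappa> by linarith
  then show "0 \<le> sqrt (2 * \<delta>)" by simp
qed

text \<open>The commutator is the difference of two off-diagonal corners. One is
  \<open>(1 - R) * T * R\<close>, the other the adjoint of \<open>(1 - R) * star T * R\<close>;
  hence multiplicativity is required for both orders of \<open>T\<close> and
  \<open>star T\<close>.\<close>

lemma glimm_commutator:
  fixes F G
  assumes A: "cstar_subalgebra (A :: 'h::chilbert_space calkin set)" and ucp: "ucp_to_mat A k \<phi>"
    and G: "finite G" and F: "finite F" "\<And>X. X \<in> F \<Longrightarrow> calkin X \<in> A" and \<epsilon>: "\<epsilon> > 0"
    and T: "calkin T \<in> A" and \<delta>: "\<delta> > 0"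
    and m1: "mat_norm (\<phi> (star (calkin T) * calkin T) - \<phi> (star (calkin T)) * \<phi> (calkin T)) \<le> \<delta>"
    and m2: "mat_norm (\<phi> (calkin T * star (calkin T)) - \<phi> (calkin T) * \<phi> (star (calkin T))) \<le> \<delta>"
  shows "\<exists>e :: nat \<Rightarrow> 'h. onf k e \<and> (\<forall>i<k. \<forall>g\<in>G. cinner (e i) g = 0) \<and>
    (\<forall>X\<in>F. \<forall>i<k. \<forall>j<k. cmod (cinner (app X (e j)) (e i) - \<phi> (calkin X) $$ (i, j)) < \<epsilon>) \<and>
    norm (span_proj k e * T - T * span_proj k e) \<le> 2 * sqrt (2 * \<delta>)"
proof -
  define L where "L = (real k)\<^sup>2 * (1 + real k * (2 * norm T + 1))"
  have L: "L \<ge> 0" by (simp add: L_def)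
  define \<eta> where "\<eta> = min 1 (min \<epsilon> (\<delta> / (L + 1)))"
  have \<eta>: "\<eta> > 0" "\<eta> \<le> 1" "\<eta> \<le> \<epsilon>" "\<eta> \<le> \<delta> / (L + 1)" using \<epsilon> \<delta> L by (auto simp: \<eta>_def)
  have "\<eta> * L \<le> \<eta> * (L + 1)" using \<eta>(1) by (intro mult_left_mono) auto
  also have "\<dots> \<le> \<delta>" using \<eta>(4) L by (simp add: pos_le_divide_eq)
  finally have \<kappa>: "(real k)\<^sup>2 * (\<eta> * (1 + real k * (2 * norm T + 1))) \<le> \<delta>" by (simp add: L_def mult_ac)
  note AD = cstar_subalgebraD[OF A]
  \<comment> \<open>The compressions of these four operators enter
    \<open>compression_defect\<close>, once for \<open>T\<close> and once for
    \<open>star T\<close>.\<close>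
  define F' where "F' = F \<union> {T, star T, star T * T, T * star T}"
  have F': "finite F'" "\<And>X. X \<in> F' \<Longrightarrow> calkin X \<in> A"
    using F T by (auto simp: F'_def calkin_hom intro!: AD(5,6))
  obtain e :: "nat \<Rightarrow> 'h" where e: "onf k e" "\<forall>i<k. \<forall>g\<in>G. cinner (e i) g = 0"
    and ap: "\<And>X i j. X \<in> F' \<Longrightarrow> i < k \<Longrightarrow> j < k \<Longrightarrow> cmod (cinner (app X (e j)) (e i) - \<phi> (calkin X) $$ (i, j)) < \<eta>"
    using glimm[OF A ucp G F' \<eta>(1)] by blast
  have car: "\<phi> a \<in> carrier_mat k k" if "a \<in> A" for a using ucp that by (simp add: ucp_to_mat_def cp_to_mat_def)
  let ?R = "span_proj k e"
  have half: "norm ((1 - ?R) * S * ?R) \<le> sqrt (2 * \<delta>)"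
    if S: "S \<in> F'" "star S \<in> F'" "star S * S \<in> F'" "norm S = norm T"
      and m: "mat_norm (\<phi> (calkin (star S * S)) - \<phi> (calkin (star S)) * \<phi> (calkin S)) \<le> \<delta>" for S
    by (rule compression_defect[OF e(1) car car car _ \<eta>(2) m])
      (use S \<eta>(1) \<kappa> in \<open>auto intro: F'(2) less_imp_le[OF ap] simp del: app_bop(6)\<close>)
  have n1: "norm ((1 - ?R) * T * ?R) \<le> sqrt (2 * \<delta>)"
    using m1 by (intro half) (simp_all add: F'_def calkin_hom)
  have n2: "norm ((1 - ?R) * star T * ?R) \<le> sqrt (2 * \<delta>)"
    using m2 by (intro half) (simp_all add: F'_def calkin_hom star_star)
  have Rs: "star ?R = ?R" using is_projection_span_proj[OF e(1)] by (simp add: is_projection_def)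
  have "star ((1 - ?R) * star T * ?R) = ?R * T * (1 - ?R)"
    by (simp add: star_mult star_star Rs mult.assoc)
  then have n3: "norm (?R * T * (1 - ?R)) \<le> sqrt (2 * \<delta>)" using n2 norm_star by metis
  have "?R * T - T * ?R = ?R * T * (1 - ?R) - (1 - ?R) * T * ?R" by (simp add: algebra_simps)
  then have "norm (?R * T - T * ?R) \<le> 2 * sqrt (2 * \<delta>)"
    using norm_triangle_ineq4[of "?R * T * (1 - ?R)" "(1 - ?R) * T * ?R"] n1 n3 by simp
  moreover have "cmod (cinner (app X (e j)) (e i) - \<phi> (calkin X) $$ (i, j)) < \<epsilon>" if "X \<in> F" "i < k" "j < k" for X i j
    using ap[of X i j] that \<eta>(3) by (simp add: F'_def)
  ultimately show ?thesis using e by blast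
qed

text \<open>The number \<open>N\<close> of orthogonal copies is fixed by \<open>rank Q\<close> alone, before the almost multiplicative
  map is chosen; this keeps the sum of the \<open>N\<close> commutators small.\<close>

lemma quasidiagonal_trace_step:
  fixes F
  assumes A: "cstar_subalgebra (A :: 'h::chilbert_space calkin set)" and T: "calkin T \<in> A"
    and \<tau>: "quasidiagonal_trace A \<tau>" and Q: "finproj Q"
    and F: "finite F" "\<And>X. X \<in> F \<Longrightarrow> calkin X \<in> A" and \<epsilon>: "\<epsilon> > 0"
  shows "\<exists>P. finproj P \<and> P * Q = Q \<and> norm ((P - Q) * T - T * (P - Q)) < \<epsilon> \<and>
    (\<forall>X\<in>F. cmod (section_state P X - \<tau> (calkin X)) < \<epsilon>)"
proof -
  define q where "q = op_rank Q"
  \<comment> \<open>\<open>C\<close> bounds the contribution of the fixed part \<open>Q\<close> to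
    the unnormalized error. Divided by the final rank, which is at least \<open>N\<close>, it falls
    below \<open>\<epsilon> / 2\<close>.\<close>
  define C where "C = (\<Sum>X\<in>F. cmod (ptrace Q X) + real q * cmod (\<tau> (calkin X)))"
  have C: "cmod (ptrace Q X) + real q * cmod (\<tau> (calkin X)) \<le> C" if "X \<in> F" for X
    unfolding C_def using F(1) that by (intro member_le_sum) auto
  obtain N0 where N0: "2 * C / \<epsilon> < real N0" using reals_Archimedean2 by blast
  define N where "N = Suc N0"
  have N: "N > 0" "C / real N < \<epsilon> / 2"
  proof -
    have "2 * C / \<epsilon> < real N" using N0 by (simp add: N_def)
    then show "C / real N < \<epsilon> / 2" using \<epsilon> by (simp add: field_simps N_def)
  qed (simp add: N_def)
  \<comment> \<open>Chosen so that one copy contributes a commutator of at most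
    \<open>\<epsilon> / (2 * real N)\<close>, see \<open>sd\<close>; all \<open>N\<close> copies
    together use half of \<open>\<epsilon>\<close>.\<close>
  define \<delta> where "\<delta> = (\<epsilon> / (4 * real N))\<^sup>2 / 2"
  have \<delta>: "\<delta> > 0" using \<epsilon> N by (simp add: \<delta>_def)
  have sd: "2 * sqrt (2 * \<delta>) = \<epsilon> / (2 * real N)" using \<epsilon> N by (simp add: \<delta>_def real_sqrt_divide real_sqrt_mult)
  obtain k \<phi> where ucp: "\<And>n. ucp_to_mat A (k n) (\<phi> n)"
    and tr: "\<And>a. a \<in> A \<Longrightarrow> (\<lambda>n. normalized_trace (\<phi> n a)) \<longlonglongrightarrow> \<tau> a"
    and mn: "\<And>a b. a \<in> A \<Longrightarrow> b \<in> A \<Longrightarrow> (\<lambda>n. mat_norm (\<phi> n (a * b) - \<phi> n a * \<phi> n b)) \<longlonglongrightarrow> 0"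
    using \<tau> unfolding quasidiagonal_trace_def by blast
  note AD = cstar_subalgebraD[OF A]
  let ?t = "calkin T"
  let ?d1 = "\<lambda>n. mat_norm (\<phi> n (star ?t * ?t) - \<phi> n (star ?t) * \<phi> n ?t)"
  let ?d2 = "\<lambda>n. mat_norm (\<phi> n (?t * star ?t) - \<phi> n ?t * \<phi> n (star ?t))"
  let ?tr = "\<lambda>n X. cmod (normalized_trace (\<phi> n (calkin X)) - \<tau> (calkin X))"
  let ?err = "\<lambda>P r X. cmod (ptrace P X - ptrace Q X - of_nat r * \<tau> (calkin X))"
  have "\<forall>\<^sub>F n in sequentially. \<forall>X\<in>F. ?tr n X < \<epsilon> / 8"
  proof (intro eventually_ball_finite ballI F(1))
    show "\<forall>\<^sub>F n in sequentially. ?tr n X < \<epsilon> / 8" if "X \<in> F" for X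
      using tendstoD[OF tr[OF F(2)[OF that]], of "\<epsilon> / 8"] \<epsilon> by (simp add: dist_norm)
  qed
  moreover have "\<forall>\<^sub>F n in sequentially. cmod (normalized_trace (\<phi> n 1) - \<tau> 1) < 1"
    using tendstoD[OF tr[OF AD(2)], of 1] by (simp add: dist_norm)
  moreover have "\<forall>\<^sub>F n in sequentially. ?d1 n < \<delta>"
    using order_tendstoD(2)[OF mn \<delta>] T AD(6) by blast
  moreover have "\<forall>\<^sub>F n in sequentially. ?d2 n < \<delta>"
    using order_tendstoD(2)[OF mn \<delta>] T AD(6) by blast
  ultimately have "\<forall>\<^sub>F n in sequentially. (\<forall>X\<in>F. ?tr n X < \<epsilon> / 8) \<and>
      cmod (normalized_trace (\<phi> n 1) - \<tau> 1) < 1 \<and>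
      ?d1 n < \<delta> \<and>
      ?d2 n < \<delta>"
    by eventually_elim blast
  then obtain n where n: "\<And>X. X \<in> F \<Longrightarrow> ?tr n X < \<epsilon> / 8"
    "cmod (normalized_trace (\<phi> n 1) - \<tau> 1) < 1"
    "?d1 n \<le> \<delta>"
    "?d2 n \<le> \<delta>"
    using eventually_happens'[OF sequentially_bot] by (metis (no_types, lifting) less_imp_le)
  define m where "m = k n"
  note ucpn = ucp[of n, folded m_def]
  have car: "\<phi> n a \<in> carrier_mat m m" if "a \<in> A" for a using ucpn that by (simp add: ucp_to_mat_def cp_to_mat_def)
  \<comment> \<open>A matrix of size 0 has normalized trace 0 by the convention for division,
    whereas \<open>\<tau> 1 = 1\<close>; closeness of the trace at the unit was arranged to exclude
    this.\<close>
  have m0: "m > 0"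
  proof (rule ccontr)
    assume "\<not> m > 0"
    then have "normalized_trace (\<phi> n 1) = 0" using car[OF AD(2)] by (simp add: normalized_trace_def)
    moreover have "\<tau> 1 = 1" using \<tau> by (simp add: quasidiagonal_trace_def tracial_state_def)
    ultimately show False using n(2) by simp
  qed
  \<comment> \<open>Each copy adds \<open>real m * (\<epsilon> / 4)\<close> to the trace error, half
    for compression against \<open>\<phi> n\<close> and half for \<open>\<phi> n\<close> against
    \<open>\<tau>\<close>. It is taken orthogonal to a basis \<open>b\<close> of the projection
    reached so far.\<close>
  have copies: "\<exists>P. finproj P \<and> P * Q = Q \<and> norm ((P - Q) * T - T * (P - Q)) \<le> real r * (\<epsilon> / (2 * real N)) \<and>
      op_rank P = q + r * m \<and>
      (\<forall>X\<in>F. ?err P (r * m) X \<le> real (r * m) * (\<epsilon> / 4))" for r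
  proof (induction r)
    case 0
    show ?case using Q by (intro exI[of _ Q]) (auto simp: q_def finproj_def is_projection_def)
  next
    case (Suc r)
    then obtain P where P: "finproj P" "P * Q = Q" "norm ((P - Q) * T - T * (P - Q)) \<le> real r * (\<epsilon> / (2 * real N))"
      "op_rank P = q + r * m"
      and Ptr: "\<And>X. X \<in> F \<Longrightarrow> ?err P (r * m) X \<le> real (r * m) * (\<epsilon> / 4)"
      by blast
    obtain l b where b: "onf l b" "P = span_proj l b" using finprojE[OF P(1)] by blast
    have e8: "\<epsilon> / 8 > 0" using \<epsilon> by simp
    obtain e :: "nat \<Rightarrow> 'h" where e: "onf m e" "\<And>i g. i < m \<Longrightarrow> g \<in> b ` {..<l} \<Longrightarrow> cinner (e i) g = 0"
      and ap: "\<And>X i j. X \<in> F \<Longrightarrow> i < m \<Longrightarrow> j < m \<Longrightarrow> cmod (cinner (app X (e j)) (e i) - \<phi> n (calkin X) $$ (i, j)) < \<epsilon> / 8"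
      and comm: "norm (span_proj m e * T - T * span_proj m e) \<le> 2 * sqrt (2 * \<delta>)"
      using glimm_commutator[OF A ucpn finite_imageI[OF finite_lessThan] F e8 T \<delta> n(3,4), of b l] by blast
    define R where "R = span_proj m e"
    have be: "cinner (b i) (e j) = 0" if "i < l" "j < m" for i j
      using e(2)[of j "b i"] that cinner_commute[of "b i" "e j"] by simp
    have R: "finproj R" unfolding R_def by (rule finproj_span_proj[OF e(1)])
    have PR: "P * R = 0" unfolding b(2) R_def by (rule finproj_orthogonal_basis(3)[OF b(1) e(1) be])
    have "R * P = star (P * R)" using P(1) R by (simp add: star_mult finproj_def is_projection_def)
    then have "R * P = 0" by (simp add: PR)
    then have "R * Q = 0" by (metis P(2) mult.assoc mult_zero_left)
    then have "(P + R) * Q = Q" by (simp add: distrib_right P(2))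
    moreover have "finproj (P + R)" by (rule finproj_add[OF P(1) R PR])
    moreover have "op_rank (P + R) = q + Suc r * m"
      using ptrace_add(2)[OF P(1) R PR] P(4) op_rank_span_proj[OF e(1)] by (simp add: R_def)
    moreover have "norm ((P + R - Q) * T - T * (P + R - Q)) \<le> real (Suc r) * (\<epsilon> / (2 * real N))"
    proof -
      have "(P + R - Q) * T - T * (P + R - Q) = ((P - Q) * T - T * (P - Q)) + (R * T - T * R)"
        by (simp add: algebra_simps)
      then have "norm ((P + R - Q) * T - T * (P + R - Q)) \<le> real r * (\<epsilon> / (2 * real N)) + \<epsilon> / (2 * real N)"
        using comm[unfolded sd, folded R_def] P(3) norm_triangle_mono by metis
      then show ?thesis by (simp add: distrib_right add_divide_distrib add.commute)
    qed
    moreover have "?err (P + R) (Suc r * m) X \<le> real (Suc r * m) * (\<epsilon> / 4)"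
      if X: "X \<in> F" for X
    proof -
      let ?M = "\<phi> n (calkin X)"
      have M: "?M \<in> carrier_mat m m" by (rule car[OF F(2)[OF X]])
      have "cmod (ptrace R X - (\<Sum>i<m. ?M $$ (i, i))) \<le> (\<Sum>i<m. cmod (cinner (app X (e i)) (e i) - ?M $$ (i, i)))"
        unfolding R_def ptrace_span_proj[OF e(1)] sum_subtractf[symmetric] by (rule norm_sum)
      also have "\<dots> \<le> (\<Sum>i<m. \<epsilon> / 8)" using ap[OF X] by (intro sum_mono) (auto intro: less_imp_le)
      finally have 1: "cmod (ptrace R X - (\<Sum>i<m. ?M $$ (i, i))) \<le> real m * (\<epsilon> / 8)" by simp
      have "(\<Sum>i<m. ?M $$ (i, i)) - of_nat m * \<tau> (calkin X) = of_nat m * (normalized_trace ?M - \<tau> (calkin X))"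
        using M m0 by (simp add: normalized_trace_def right_diff_distrib)
      then have "cmod ((\<Sum>i<m. ?M $$ (i, i)) - of_nat m * \<tau> (calkin X)) = real m * cmod (normalized_trace ?M - \<tau> (calkin X))"
        by (simp only: norm_mult norm_of_nat)
      also have "\<dots> \<le> real m * (\<epsilon> / 8)" using n(1)[OF X] by (intro mult_left_mono) auto
      finally have 2: "cmod ((\<Sum>i<m. ?M $$ (i, i)) - of_nat m * \<tau> (calkin X)) \<le> real m * (\<epsilon> / 8)" .
      have "ptrace (P + R) X - ptrace Q X - of_nat (Suc r * m) * \<tau> (calkin X)
          = (ptrace P X - ptrace Q X - of_nat (r * m) * \<tau> (calkin X))
            + ((ptrace R X - (\<Sum>i<m. ?M $$ (i, i))) + ((\<Sum>i<m. ?M $$ (i, i)) - of_nat m * \<tau> (calkin X)))"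
        by (simp add: ptrace_add(1)[OF P(1) R PR] algebra_simps)
      then have "?err (P + R) (Suc r * m) X
          \<le> real (r * m) * (\<epsilon> / 4) + (real m * (\<epsilon> / 8) + real m * (\<epsilon> / 8))"
        using 1 2 Ptr[OF X] by (metis (no_types, lifting) add_mono norm_triangle_mono)
      also have "\<dots> = real (Suc r * m) * (\<epsilon> / 4)" by (simp add: field_simps)
      finally show ?thesis .
    qed
    ultimately show ?case by blast
  qed
  obtain P where P: "finproj P" "P * Q = Q" "norm ((P - Q) * T - T * (P - Q)) \<le> real N * (\<epsilon> / (2 * real N))"
    "op_rank P = q + N * m"
    and Ptr: "\<And>X. X \<in> F \<Longrightarrow> ?err P (N * m) X \<le> real (N * m) * (\<epsilon> / 4)"
    using copies[of N] by blast
  have "norm ((P - Q) * T - T * (P - Q)) < \<epsilon>" using P(3) N \<epsilon> by simp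
  moreover have "cmod (section_state P X - \<tau> (calkin X)) < \<epsilon>" if X: "X \<in> F" for X
  proof -
    define s where "s = real (q + N * m)"
    have "1 \<le> m" using m0 by simp
    then have "N * 1 \<le> N * m" by (rule mult_le_mono2)
    then have s: "real N \<le> s" "real (N * m) \<le> s" unfolding s_def by linarith+
    have s0: "s > 0" using s N(1) by simp
    define t where "t = \<tau> (calkin X)"
    have "section_state P X - t = (ptrace P X - of_real s * t) / of_real s"
    proof -
      have "complex_of_nat (op_rank P) = of_real s" by (simp add: P(4) s_def)
      then show ?thesis using s0 by (simp add: section_state_ptrace[OF P(1)] diff_divide_distrib)
    qed
    also have "ptrace P X - of_real s * t = (ptrace P X - ptrace Q X - of_nat (N * m) * t) + (ptrace Q X - of_nat q * t)"
      by (simp add: s_def algebra_simps)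
    finally have "cmod (section_state P X - t)
        = cmod ((ptrace P X - ptrace Q X - of_nat (N * m) * t) + (ptrace Q X - of_nat q * t)) / s"
      using s0 by (simp add: norm_divide)
    also have "\<dots> \<le> (real (N * m) * (\<epsilon> / 4) + C) / s"
    proof (rule divide_right_mono)
      have "cmod (ptrace Q X - of_nat q * t) \<le> C"
        using C[OF X] norm_triangle_ineq4[of "ptrace Q X" "of_nat q * t"] by (simp add: norm_mult t_def)
      then show "cmod ((ptrace P X - ptrace Q X - of_nat (N * m) * t) + (ptrace Q X - of_nat q * t)) \<le> real (N * m) * (\<epsilon> / 4) + C"
        using Ptr[OF X] by (metis add_mono norm_triangle_mono t_def)
    qed (use s0 in simp)
    also have "\<dots> = real (N * m) / s * (\<epsilon> / 4) + C / s" by (simp add: add_divide_distrib)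
    also have "\<dots> \<le> 1 * (\<epsilon> / 4) + C / real N"
    proof (rule add_mono)
      show "real (N * m) / s * (\<epsilon> / 4) \<le> 1 * (\<epsilon> / 4)"
        using s s0 \<epsilon> by (intro mult_right_mono) (auto simp: pos_divide_le_eq)
      have "C \<ge> 0" unfolding C_def by (intro sum_nonneg) auto
      then show "C / s \<le> C / real N" using s N(1) by (intro divide_left_mono) auto
    qed
    also have "\<dots> < \<epsilon>" using N(2) \<epsilon> by simp
    finally show ?thesis by (simp add: t_def)
  qed
  ultimately show ?thesis using P(1,2) by blast
qed

subsection \<open>Generated algebras\<close>

lemma cstar_subalgebra_cstar_gen: "cstar_subalgebra (cstar_gen a)"
proof -
  have "closed (cstar_gen a)" unfolding cstar_gen_def by (rule closed_Inter) (auto intro: cstar_subalgebraD(1))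
  then show ?thesis unfolding cstar_subalgebra_def[of "cstar_gen a"]
    by (auto simp: cstar_gen_def intro: cstar_subalgebraD)
qed

lemma cstar_gen_base: "a \<in> cstar_gen a"
  by (auto simp: cstar_gen_def)

lemma cstar_gen_least: "cstar_subalgebra A \<Longrightarrow> a \<in> A \<Longrightarrow> cstar_gen a \<subseteq> A"
  by (auto simp: cstar_gen_def)

text \<open>The preimage of a C*-subalgebra under the continuous map \<open>calkin\<close> is again
  one, so minimality of \<open>cstar_gen T\<close> applies.\<close>

lemma calkin_cstar_gen:
  assumes "X \<in> cstar_gen T"
  shows "calkin X \<in> cstar_gen (calkin T)"
proof -
  let ?A = "cstar_gen (calkin T)"
  note AD = cstar_subalgebraD[OF cstar_subalgebra_cstar_gen[of "calkin T"]]
  have "closed (calkin -` ?A)"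
    using AD(1) by (rule continuous_closed_vimage)
      (rule linear_continuous_at[OF bounded_linear_calkin])
  then have "cstar_subalgebra (calkin -` ?A)"
    unfolding cstar_subalgebra_def by (auto simp: calkin_hom intro: AD)
  then have "cstar_gen T \<subseteq> calkin -` ?A" by (rule cstar_gen_least) (simp add: cstar_gen_base)
  then show ?thesis using assms by blast
qed

text \<open>Codes for the noncommutative polynomials in an element and its adjoint with Gaussian
  rational coefficients. The codes are countable and, for operators, their values are dense in the
  generated algebra.\<close>

datatype star_expr = Gen | Unit | Add star_expr star_expr | Mul star_expr star_expr | Star star_expr | Scale rat rat star_expr

instance star_expr :: countable
  by countable_datatype

primrec star_eval :: "'a::star_algebra \<Rightarrow> star_expr \<Rightarrow> 'a"
  where "star_eval a Gen = a" | "star_eval a Unit = 1"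
  | "star_eval a (Add x y) = star_eval a x + star_eval a y"
  | "star_eval a (Mul x y) = star_eval a x * star_eval a y"
  | "star_eval a (Star x) = star (star_eval a x)"
  | "star_eval a (Scale p q x) = Complex (of_rat p) (of_rat q) *\<^sub>C star_eval a x"

lemma star_eval_in_cstar_gen: "star_eval a x \<in> cstar_gen a"
  by (induction x) (auto intro: cstar_subalgebraD[OF cstar_subalgebra_cstar_gen] cstar_gen_base)

lemma closure_rational_complex: "closure (range (\<lambda>(p, q). Complex (of_rat p) (of_rat q))) = UNIV"
proof -
  have "z \<in> closure (range (\<lambda>(p, q). Complex (of_rat p) (of_rat q)))" for z
    unfolding closure_approachable
  proof (intro allI impI)
    fix e :: real assume e: "e > 0"
    obtain p where p: "Re z < of_rat p" "of_rat p < Re z + e / 2" using of_rat_dense[of "Re z" "Re z + e / 2"] e by auto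
    obtain q where q: "Im z < of_rat q" "of_rat q < Im z + e / 2" using of_rat_dense[of "Im z" "Im z + e / 2"] e by auto
    have "dist (Complex (of_rat p) (of_rat q)) z < e"
      using cmod_le[of "Complex (of_rat p) (of_rat q) - z"] p q by (simp add: dist_norm)
    then show "\<exists>y\<in>range (\<lambda>(p, q). Complex (of_rat p) (of_rat q)). dist y z < e" by force
  qed
  then show ?thesis by blast
qed

text \<open>The closure of the values is itself a C*-subalgebra: the operations extend from the
  codes by continuity in one variable at a time, and arbitrary scalars are limits of Gaussian
  rationals.\<close>

lemma cstar_gen_subset_closure:
  fixes T :: "'h::chilbert_space bop"
  shows "cstar_gen T \<subseteq> closure (range (star_eval T))"
proof (rule cstar_gen_least)
  let ?S = "range (star_eval T)"
  have base: "star_eval T x \<in> closure ?S" for x by (rule subsetD[OF closure_subset]) simp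
  have img: "f a \<in> closure ?S" if "a \<in> closure ?S" "continuous_on UNIV f" "\<And>x. f (star_eval T x) \<in> closure ?S"
    for f and a :: "'h bop"
  proof -
    have "f ` closure ?S \<subseteq> closure ?S"
      by (rule image_closure_subset) (use that in \<open>auto intro: continuous_on_subset\<close>)
    then show ?thesis using that(1) by blast
  qed
  show "T \<in> closure ?S" using base[of Gen] by simp
  have img2: "f a b \<in> closure ?S" if "a \<in> closure ?S" "b \<in> closure ?S"
    "\<And>b. continuous_on UNIV (\<lambda>a. f a b)" "\<And>a. continuous_on UNIV (f a)"
    "\<And>x y. f (star_eval T x) (star_eval T y) \<in> closure ?S" for f and a b :: "'h bop"
    by (rule img[OF that(1,3)], rule img[OF that(2,4,5)])
  have add: "a + b \<in> closure ?S" if "a \<in> closure ?S" "b \<in> closure ?S" for a b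
  proof (rule img2[OF that])
    show "star_eval T x + star_eval T y \<in> closure ?S" for x y using base[of "Add x y"] by simp
  qed (intro continuous_intros)+
  have mult: "a * b \<in> closure ?S" if "a \<in> closure ?S" "b \<in> closure ?S" for a b
  proof (rule img2[OF that])
    show "star_eval T x * star_eval T y \<in> closure ?S" for x y using base[of "Mul x y"] by simp
  qed (intro continuous_intros)+
  have star: "star a \<in> closure ?S" if "a \<in> closure ?S" for a
  proof (rule img[OF that linear_continuous_on[OF bounded_linear_star]])
    show "star (star_eval T x) \<in> closure ?S" for x
      using base[of "Star x"] by simp
  qed
  have scale: "c *\<^sub>C a \<in> closure ?S" if "a \<in> closure ?S" for c a
  proof -
    have bl: "bounded_linear (\<lambda>c. c *\<^sub>C a)"
      by (rule bounded_linear_intro[where K = "norm a"])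
        (simp_all add: scaleC_add_left scaleR_scaleC scaleC_scaleC norm_scaleC_star_algebra scaleR_conv_of_real)
    have bl': "bounded_linear (\<lambda>b :: 'h bop. c *\<^sub>C b)" for c
      by (rule bounded_linear_intro[where K = "cmod c"])
        (simp_all add: scaleC_add_right scaleR_scaleC scaleC_scaleC norm_scaleC_star_algebra mult.commute)
    have "Complex (of_rat p) (of_rat q) *\<^sub>C a \<in> closure ?S" for p q
    proof (rule img[OF that linear_continuous_on[OF bl']])
      show "Complex (of_rat p) (of_rat q) *\<^sub>C star_eval T x \<in> closure ?S" for x
        using base[of "Scale p q x"] by simp
    qed
    then have "(\<lambda>c. c *\<^sub>C a) ` closure (range (\<lambda>(p, q). Complex (of_rat p) (of_rat q))) \<subseteq> closure ?S"
      by (intro image_closure_subset linear_continuous_on[OF bl]) auto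
    then show ?thesis by (auto simp: closure_rational_complex)
  qed
  have "1 \<in> closure ?S" using base[of Unit] by simp
  then show "cstar_subalgebra (closure ?S)"
    unfolding cstar_subalgebra_def using add mult star scale by simp
qed

lemma cstar_gen_dense_sequence:
  fixes T :: "'h::chilbert_space bop"
  obtains X :: "nat \<Rightarrow> 'h bop" where "\<And>i. X i \<in> cstar_gen T"
    "\<And>Y e. Y \<in> cstar_gen T \<Longrightarrow> e > 0 \<Longrightarrow> \<exists>i. norm (X i - Y) < e"
proof
  define X where "X i = star_eval T (from_nat i)" for i
  show "X i \<in> cstar_gen T" for i by (simp add: X_def star_eval_in_cstar_gen)
  show "\<exists>i. norm (X i - Y) < e" if "Y \<in> cstar_gen T" and e: "e > 0" for Y e
  proof -
    have "Y \<in> closure (range (star_eval T))" using that(1) cstar_gen_subset_closure by blast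
    then obtain x where "norm (star_eval T x - Y) < e"
      using e unfolding closure_approachable dist_norm by blast
    then show ?thesis by (intro exI[of _ "to_nat x"]) (simp add: X_def)
  qed
qed

text \<open>The product topology is second countable, so every set of sequences has a countable
  dense subset of its own. Membership in \<open>S\<close> is essential: only genuine quasidiagonal
  traces can be fed into the construction.\<close>

lemma countable_pointwise_dense:
  fixes S :: "(nat \<Rightarrow> 'a::{metric_space, second_countable_topology}) set"
  assumes "S \<noteq> {}"
  obtains d :: "nat \<Rightarrow> nat \<Rightarrow> 'a" where "\<And>j. d j \<in> S"
    "\<And>f m e. f \<in> S \<Longrightarrow> e > 0 \<Longrightarrow> \<exists>j. \<forall>i\<le>m. dist (d j i) (f i) < e"
proof -
  obtain D where D: "countable D" "D \<subseteq> S" "S \<subseteq> closure D" using separable by blast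
  then have "D \<noteq> {}" using assms by auto
  show thesis
  proof
    show "from_nat_into D j \<in> S" for j using D(2) from_nat_into[OF \<open>D \<noteq> {}\<close>] by blast
    fix f :: "nat \<Rightarrow> 'a" and m :: nat and e :: real assume f: "f \<in> S" and e: "e > 0"
    let ?U = "\<Inter>i\<in>{..m}. {g. dist (g i) (f i) < e}"
    have "open ?U"
      by (intro open_INT finite_atMost ballI open_Collect_less continuous_intros continuous_on_product_coordinates)
    moreover have "f \<in> ?U" using e by simp
    moreover have "f \<in> closure D" using D(3) f by blast
    ultimately obtain g where "g \<in> D" "g \<in> ?U" using closure_iff_nhds_not_empty by blast
    then obtain j where "from_nat_into D j = g" using from_nat_into_surj[OF D(1)] by blast
    then show "\<exists>j. \<forall>i\<le>m. dist (from_nat_into D j i) (f i) < e" using \<open>g \<in> ?U\<close> by auto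
  qed
qed

lemma section_state_diff_le:
  assumes P: "finproj P"
  shows "cmod (section_state P X - section_state P Y) \<le> norm (X - Y)"
proof -
  define n where "n = op_rank P"
  note e = range_onb_onf(1)[OF P]
  have "section_state P X - section_state P Y = (\<Sum>i<n. cinner (app (X - Y) (range_onb P i)) (range_onb P i)) / of_nat n"
    by (simp add: section_state_ptrace[OF P] ptrace_def n_def cinner_diff_left sum_subtractf diff_divide_distrib)
  also have "cmod \<dots> = cmod (\<Sum>i<n. cinner (app (X - Y) (range_onb P i)) (range_onb P i)) / real n"
    by (simp add: norm_divide)
  also have "\<dots> \<le> (\<Sum>i<n. norm (X - Y)) / real n"
  proof (intro divide_right_mono order_trans[OF norm_sum] sum_mono)
    fix i assume "i \<in> {..<n}"
    then have "norm (range_onb P i) = 1" using onf_norm[OF e] by (simp add: n_def)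
    then show "cmod (cinner (app (X - Y) (range_onb P i)) (range_onb P i)) \<le> norm (X - Y)"
      using norm_cinner_le[of "app (X - Y) (range_onb P i)" "range_onb P i"] norm_app_le[of "X - Y" "range_onb P i"] by simp
  qed simp
  also have "\<dots> \<le> norm (X - Y)" by (cases "n = 0") auto
  finally show ?thesis .
qed

subsection \<open>Construction of the filtration\<close>

text \<open>Moving close to \<open>Q n\<close> disturbs the trace, so the trace is corrected
  afterwards, on top of the auxiliary projection \<open>R\<close>. In the conclusion
  \<open>R\<close> is kept because it forces strong convergence to the identity; the trace clause is
  conditional so that any \<open>\<tau>\<close> may be supplied.\<close>

lemma quasidiagonal_step:
  fixes T :: "'h::chilbert_space bop" and X :: "nat \<Rightarrow> 'h bop"
  assumes Q: "filtration Q" "(\<lambda>n. norm (T * Q n - Q n * T)) \<longlonglongrightarrow> 0" and P: "finproj P"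
    and X: "\<And>i. X i \<in> cstar_gen T" and \<epsilon>: "\<epsilon> > 0"
  shows "\<exists>P'. finproj P' \<and> P' * P = P \<and> norm (T * P' - P' * T) < \<epsilon> \<and>
    (\<exists>n\<ge>N. \<exists>R. P' * R = R \<and> norm (R - Q n) < \<epsilon>) \<and>
    (quasidiagonal_trace (cstar_gen (calkin T)) \<tau> \<longrightarrow>
      (\<forall>i\<le>N. cmod (section_state P' (X i) - \<tau> (calkin (X i))) < \<epsilon>))"
proof -
  have "\<forall>\<^sub>F n in sequentially. norm (T * Q n - Q n * T) < \<epsilon> / 4"
    by (rule order_tendstoD(2)[OF Q(2)]) (use \<epsilon> in simp)
  then obtain M where M: "\<And>n. n \<ge> M \<Longrightarrow> norm (T * Q n - Q n * T) < \<epsilon> / 4"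
    unfolding eventually_sequentially by blast
  \<comment> \<open>Passing from \<open>Q n\<close> to \<open>R\<close> changes the commutator by at
    most \<open>2 * norm T * d\<close>, a quarter of \<open>\<epsilon>\<close>. With another quarter
    for \<open>Q n\<close>, half remains for the trace enlargement.\<close>
  define d where "d = \<epsilon> / (8 * (norm T + 1))"
  have T1: "norm T + 1 > 0" by (simp add: add_nonneg_pos)
  have d: "d > 0" "d \<le> \<epsilon>" "2 * norm T * d \<le> \<epsilon> / 4"
  proof -
    show d0: "d > 0" using \<epsilon> T1 by (simp add: d_def)
    have e: "8 * (norm T + 1) * d = \<epsilon>" using T1 by (simp add: d_def)
    have Td: "0 \<le> norm T * d" using d0 by simp
    have e': "8 * (norm T * d) + 8 * d = \<epsilon>" unfolding e[symmetric] by (simp add: algebra_simps)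
    show "d \<le> \<epsilon>" using e' d0 Td by linarith
    show "2 * norm T * d \<le> \<epsilon> / 4" using e' d0 Td by (simp add: mult.assoc)
  qed
  obtain n R where n: "n \<ge> max N M" and R: "finproj R" "R * P = P" "norm (R - Q n) < d"
    using filtration_dominate[OF Q(1) P d(1), of "max N M"] by blast
  have RT: "norm (T * R - R * T) < \<epsilon> / 2"
  proof -
    have "T * R - R * T = (T * Q n - Q n * T) + (T * (R - Q n) - (R - Q n) * T)" by (simp add: algebra_simps)
    also have "norm \<dots> \<le> norm (T * Q n - Q n * T) + (norm (T * (R - Q n)) + norm ((R - Q n) * T))"
      by (rule order_trans[OF norm_triangle_ineq add_left_mono[OF norm_triangle_ineq4]])
    also have "norm (T * (R - Q n)) \<le> norm T * d"
      using norm_mult_ineq[of T "R - Q n"] R(3) by (meson less_imp_le mult_left_mono norm_ge_zero order_trans)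
    also have "norm ((R - Q n) * T) \<le> d * norm T"
      using norm_mult_ineq[of "R - Q n" T] R(3) by (meson less_imp_le mult_right_mono norm_ge_zero order_trans)
    finally show ?thesis using M[of n] n d(3) by (simp add: mult.commute)
  qed
  show ?thesis
  proof (cases "quasidiagonal_trace (cstar_gen (calkin T)) \<tau>")
    case False
    have "R * R = R" using R(1) by (simp add: finproj_def is_projection_def)
    moreover have "norm (R - Q n) < \<epsilon>" using R(3) d(2) by simp
    ultimately show ?thesis using False R RT n \<epsilon> by (intro exI[of _ R]) auto
  next
    case True
    have XA: "calkin Y \<in> cstar_gen (calkin T)" if "Y \<in> X ` {..N}" for Y
      using that X calkin_cstar_gen by blast
    have e2: "\<epsilon> / 2 > 0" using \<epsilon> by simp
    obtain P' where P': "finproj P'" "P' * R = R" "norm ((P' - R) * T - T * (P' - R)) < \<epsilon> / 2"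
      "\<And>i. i \<le> N \<Longrightarrow> cmod (section_state P' (X i) - \<tau> (calkin (X i))) < \<epsilon> / 2"
      using quasidiagonal_trace_step[OF cstar_subalgebra_cstar_gen cstar_gen_base True R(1) finite_imageI[OF finite_atMost] XA e2]
      by blast
    have "P' * P = P" using P'(2) R(2) by (metis mult.assoc)
    moreover have "norm (T * P' - P' * T) < \<epsilon>"
    proof -
      have "T * P' - P' * T = (T * R - R * T) - ((P' - R) * T - T * (P' - R))" by (simp add: algebra_simps)
      then have "norm (T * P' - P' * T) \<le> norm (T * R - R * T) + norm ((P' - R) * T - T * (P' - R))"
        by (metis norm_triangle_ineq4)
      then show ?thesis using RT P'(3) by linarith
    qed
    moreover have "norm (R - Q n) < \<epsilon>" using R(3) d(2) by simp
    moreover have "cmod (section_state P' (X i) - \<tau> (calkin (X i))) < \<epsilon>" if "i \<le> N" for i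
      using P'(4)[OF that] \<epsilon> by simp
    ultimately show ?thesis using P'(1,2) n by (intro exI[of _ P']) auto
  qed
qed

lemma quasidiagonal_filtration:
  fixes T :: "'h::chilbert_space bop" and X :: "nat \<Rightarrow> 'h bop" and \<tau> :: "nat \<Rightarrow> 'h calkin \<Rightarrow> complex"
  assumes inf: "\<nexists>B :: 'h set. finite B \<and> cspan B = UNIV" and qd: "quasidiagonal T"
    and X: "\<And>i. X i \<in> cstar_gen T"
  obtains P where "filtration P" "\<And>n. P n \<noteq> 0" "(\<lambda>n. norm (T * P n - P n * T)) \<longlonglongrightarrow> 0"
    "\<And>n i. quasidiagonal_trace (cstar_gen (calkin T)) (\<tau> n) \<Longrightarrow> i \<le> n \<Longrightarrow>
      cmod (section_state (P n) (X i) - \<tau> n (calkin (X i))) < 1 / real (Suc n)"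
proof -
  obtain Q where Q: "filtration Q" "(\<lambda>n. norm (T * Q n - Q n * T)) \<longlonglongrightarrow> 0"
    using qd unfolding quasidiagonal_def by blast
  have "cspan {} \<noteq> (UNIV :: 'h set)" using inf by blast
  then obtain h :: 'h where "h \<noteq> 0" by auto
  define u where "u = complex_of_real (inverse (norm h)) *\<^sub>C h"
  have u: "norm u = 1" using \<open>h \<noteq> 0\<close> by (simp add: u_def norm_scaleC norm_inverse)
  \<comment> \<open>A projection of rank one is kept below all later ones, so none of them is
    0.\<close>
  define P0 where "P0 = span_proj 1 (\<lambda>_. u)"
  have on: "onf 1 (\<lambda>_. u)" using u by (simp add: onf_def cinner_self)
  have P0: "finproj P0" unfolding P0_def by (rule finproj_span_proj[OF on])
  have "app P0 u = u" by (simp add: P0_def app_span_proj cinner_self u)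
  then have P0n: "P0 \<noteq> 0" using u by force
  define good where "good n P P' \<longleftrightarrow> P' * P = P \<and> norm (T * P' - P' * T) < 1 / real (Suc n) \<and>
    (\<exists>m\<ge>n. \<exists>R. P' * R = R \<and> norm (R - Q m) < 1 / real (Suc n)) \<and>
    (quasidiagonal_trace (cstar_gen (calkin T)) (\<tau> n) \<longrightarrow>
      (\<forall>i\<le>n. cmod (section_state P' (X i) - \<tau> n (calkin (X i))) < 1 / real (Suc n)))" for n P P'
  have "\<exists>f. \<forall>n. (finproj (f n) \<and> f n * P0 = P0) \<and> good n (f n) (f (Suc n))"
  proof (rule dependent_nat_choice)
    show "\<exists>P. finproj P \<and> P * P0 = P0" using P0 by (auto simp: finproj_def is_projection_def)
    fix P :: "'h bop" and n :: nat assume P: "finproj P \<and> P * P0 = P0"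
    have "\<exists>P'. finproj P' \<and> good n P P'"
      unfolding good_def by (rule quasidiagonal_step[OF Q conjunct1[OF P] X]) simp
    then obtain P' where P': "finproj P'" "good n P P'" by blast
    then have "P' * P0 = P0" using P by (metis good_def mult.assoc)
    then show "\<exists>P'. (finproj P' \<and> P' * P0 = P0) \<and> good n P P'" using P' by blast
  qed
  then obtain f where f: "\<And>n. finproj (f n)" "\<And>n. f n * P0 = P0" "\<And>n. good n (f n) (f (Suc n))" by blast
  show thesis
  proof
    \<comment> \<open>The shift is needed because \<open>good n\<close> estimates
      \<open>f (Suc n)\<close>, while \<open>f 0\<close> satisfies no estimate.\<close>
    let ?P = "\<lambda>n. f (Suc n)"
    have lim0: "(\<lambda>n. 1 / real (Suc n)) \<longlonglongrightarrow> 0" by (rule LIMSEQ_Suc[OF lim_1_over_n])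
    show "filtration ?P"
      unfolding filtration_def
    proof (intro conjI allI)
      show "is_projection (?P n)" "finite_rank (?P n)" for n using f(1) by (simp_all add: finproj_def)
      show "op_le (?P n) (?P (Suc n))" for n
        using f(1) f(3)[of "Suc n"] by (intro op_le_projI) (auto simp: finproj_def good_def)
      show "(\<lambda>n. norm (app (?P n) x - x)) \<longlonglongrightarrow> 0" for x
      proof (rule LIMSEQ_I)
        fix e :: real assume e: "e > 0"
        obtain M where M: "\<And>m. m \<ge> M \<Longrightarrow> norm (app (Q m) x - x) < e / 2"
          using LIMSEQ_D[OF filtrationD(2)[OF Q(1), of x], of "e / 2"] e by auto
        have "(\<lambda>n. 1 / real (Suc n) * norm x) \<longlonglongrightarrow> 0" using tendsto_mult_left_zero[OF lim0] by simp
        then obtain L where L: "\<And>n. n \<ge> L \<Longrightarrow> 1 / real (Suc n) * norm x < e / 2"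
          using LIMSEQ_D[of "\<lambda>n. 1 / real (Suc n) * norm x" 0 "e / 2"] e by auto
        have "norm (app (?P n) x - x) < e" if n: "n \<ge> max M L" for n
        proof -
          obtain m R where m: "m \<ge> n" and R: "?P n * R = R" "norm (R - Q m) < 1 / real (Suc n)"
            using f(3)[of n] unfolding good_def by blast
          have "app (?P n) (app R x) = app R x" using R(1) by (metis app_bop(6))
          \<comment> \<open>As \<open>?P n\<close> fixes \<open>app R x\<close>, its error at
            \<open>x\<close> is at most the distance from \<open>x\<close> to
            \<open>app R x\<close>, and \<open>R\<close> is close to \<open>Q m\<close>.\<close>
          then have "app (?P n) x - x = - app (1 - ?P n) (x - app R x)"
            by (simp only: app_diff app_bop) simp
          then have "norm (app (?P n) x - x) = norm (app (1 - ?P n) (x - app R x))" by (simp only: norm_minus_cancel)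
          also have "\<dots> \<le> 1 * norm (x - app R x)"
            using norm_app_le[of "1 - ?P n"] norm_compl_projection_le[of "?P n"] f(1)[of "Suc n"]
            by (meson finproj_def mult_right_mono norm_ge_zero order_trans)
          also have "1 * norm (x - app R x) = norm (x - app R x)" by simp
          also have "x - app R x = - (app (Q m) x - x) - app (R - Q m) x" by simp
          also have "norm \<dots> \<le> norm (app (Q m) x - x) + norm (app (R - Q m) x)"
            using norm_triangle_ineq4[of "- (app (Q m) x - x)"] by (simp only: norm_minus_cancel)
          also have "norm (app (R - Q m) x) \<le> 1 / real (Suc n) * norm x"
            by (rule order_trans[OF norm_app_le mult_right_mono[OF less_imp_le[OF R(2)]]]) simp
          finally show ?thesis using M[of m] L[of n] m n by linarith
        qed
        then show "\<exists>no. \<forall>n\<ge>no. norm (norm (app (?P n) x - x) - 0) < e" by (intro exI[of _ "max M L"]) simp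
      qed
    qed
    show "?P n \<noteq> 0" for n using f(2)[of "Suc n"] P0n by force
    show "(\<lambda>n. norm (T * ?P n - ?P n * T)) \<longlonglongrightarrow> 0"
      by (rule tendsto_sandwich[OF _ _ tendsto_const lim0])
        (use f(3) in \<open>auto simp: good_def intro!: always_eventually less_imp_le simp del: of_nat_Suc\<close>)
    show "cmod (section_state (?P n) (X i) - \<tau> n (calkin (X i))) < 1 / real (Suc n)"
      if "quasidiagonal_trace (cstar_gen (calkin T)) (\<tau> n)" "i \<le> n" for n i
      using f(3)[of n] that unfolding good_def by blast
  qed
qed

text \<open>A diagonal choice of accuracies gives convergence on the dense sequence. Section states
  and the trace are Lipschitz for the operator norm, with constants 1 and 2, so convergence extends
  to the whole algebra.\<close>

lemma traces_along_subsequences: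
  fixes T :: "'h::chilbert_space bop"
  assumes P: "\<And>n. finproj (P n)" and X: "\<And>i. X i \<in> cstar_gen T"
    and dense: "\<And>Y e. Y \<in> cstar_gen T \<Longrightarrow> e > 0 \<Longrightarrow> \<exists>i. norm (X i - Y) < e"
    and \<tau>: "tracial_state (cstar_gen (calkin T)) \<tau>"
    and near: "\<And>m. \<exists>n\<ge>m. \<forall>i\<le>m. cmod (section_state (P n) (X i) - \<tau> (calkin (X i))) < 2 / real (Suc m)"
  shows "\<exists>r :: nat \<Rightarrow> nat. strict_mono r \<and>
    (\<forall>Y\<in>cstar_gen T. (\<lambda>k. section_state (P (r k)) Y) \<longlonglongrightarrow> \<tau> (calkin Y))"
proof -
  let ?close = "\<lambda>m n. \<forall>i\<le>m. cmod (section_state (P n) (X i) - \<tau> (calkin (X i))) < 2 / real (Suc m)"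
  have "\<exists>r. \<forall>m. ?close m (r m) \<and> r m < r (Suc m)"
  proof (rule dependent_nat_choice)
    show "\<exists>n. ?close 0 n" using near[of 0] by blast
    fix n m assume "?close m n"
    \<comment> \<open>The level \<open>max (Suc m) (Suc n)\<close> yields both the next accuracy and
      an index above \<open>n\<close>.\<close>
    obtain n' where n': "n' \<ge> max (Suc m) (Suc n)" "?close (max (Suc m) (Suc n)) n'" using near by blast
    have "2 / real (Suc (max (Suc m) (Suc n))) \<le> 2 / real (Suc (Suc m))"
      by (intro divide_left_mono) auto
    then have "?close (Suc m) n'" using n'(2) by (meson less_le_trans max.coboundedI1)
    then show "\<exists>n'. ?close (Suc m) n' \<and> n < n'" using n'(1) by (intro exI[of _ n']) auto
  qed
  then obtain r where r: "\<And>m. ?close m (r m)" "\<And>m. r m < r (Suc m)" by blast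
  let ?s = "\<lambda>k. section_state (P (r k))"
  have "(\<lambda>k. ?s k Y) \<longlonglongrightarrow> \<tau> (calkin Y)" if Y: "Y \<in> cstar_gen T" for Y
  proof (rule LIMSEQ_I)
    fix e :: real assume e: "e > 0"
    \<comment> \<open>Exchanging \<open>Y\<close> for \<open>X i\<close> costs \<open>e / 6\<close>
      in the section state and twice that in the trace; \<open>e / 2\<close> is left for the
      approximation at \<open>X i\<close>.\<close>
    obtain i where i: "norm (X i - Y) < e / 6" using dense[OF Y, of "e / 6"] e by auto
    obtain M where M: "4 / e < real M" using reals_Archimedean2 by blast
    have "cmod (?s k Y - \<tau> (calkin Y)) < e" if k: "k \<ge> max i M" for k
    proof -
      have "4 / e < real (Suc k)" using M k by linarith
      then have "2 / real (Suc k) < e / 2" using e by (simp add: field_simps)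
      then have 1: "cmod (?s k (X i) - \<tau> (calkin (X i))) < e / 2"
        using r(1)[of k] k by (meson less_trans max.bounded_iff)
      have 2: "cmod (?s k Y - ?s k (X i)) \<le> norm (X i - Y)"
        using section_state_diff_le[OF P] by (simp add: norm_minus_commute)
      have cX: "calkin (X i) \<in> cstar_gen (calkin T)" "calkin Y \<in> cstar_gen (calkin T)"
        using X Y by (auto intro: calkin_cstar_gen)
      have add: "\<tau> (a + b) = \<tau> a + \<tau> b" if "a \<in> cstar_gen (calkin T)" "b \<in> cstar_gen (calkin T)" for a b
        using \<tau> that by (simp add: tracial_state_def)
      have cd: "calkin (X i - Y) \<in> cstar_gen (calkin T)"
        unfolding calkin_hom using cX by (intro cstar_subalgebraD(9)[OF cstar_subalgebra_cstar_gen])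
      have "\<tau> (calkin (X i)) = \<tau> (calkin (X i - Y)) + \<tau> (calkin Y)"
        using add[OF cd cX(2)] by (simp add: calkin_hom)
      then have 3: "cmod (\<tau> (calkin (X i)) - \<tau> (calkin Y)) \<le> 2 * norm (X i - Y)"
        using tracial_state_bound[OF cstar_subalgebra_cstar_gen \<tau> cd] by simp
      have "?s k Y - \<tau> (calkin Y) = (?s k Y - ?s k (X i))
          + ((?s k (X i) - \<tau> (calkin (X i))) + (\<tau> (calkin (X i)) - \<tau> (calkin Y)))" by simp
      then have "cmod (?s k Y - \<tau> (calkin Y)) \<le> norm (X i - Y) + (e / 2 + 2 * norm (X i - Y))"
        using 1 2 3 by (metis (no_types, lifting) add_mono less_imp_le norm_triangle_mono)
      then show ?thesis using i by simp
    qed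
    then show "\<exists>no. \<forall>k\<ge>no. norm (?s k Y - \<tau> (calkin Y)) < e" by blast
  qed
  then show ?thesis using r(2) by (intro exI[of _ r]) (auto simp: strict_mono_Suc_iff)
qed

subsection \<open>Finite sections along an asymptotically commuting filtration\<close>

lemma commutator_shift:
  "(z *\<^sub>C 1 - T) * P - P * (z *\<^sub>C 1 - T) = P * T - T * P" for T P :: "'h::chilbert_space bop"
  by (simp add: algebra_simps scaleC_mult_left scaleC_mult_right)

lemma section_shift:
  assumes "is_projection P" "x \<in> range (app P)"
  shows "app (z *\<^sub>C 1 - P * T * P) x = app (P * (z *\<^sub>C 1 - T) * P) x"
proof -
  have "app P x = x" using assms projection_idem by auto
  then show ?thesis by (simp add: app_diff app_scaleC)
qed

lemma inverse_on_norm_on_unique: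
  assumes "inverse_on M S R" "inverse_on M S R'"
  shows "norm_on M R = norm_on M R'"
proof -
  have "app R x = app R' x" if "x \<in> M" for x
    using assms that unfolding inverse_on_def by metis
  then show ?thesis unfolding norm_on_def by (intro SUP_cong) auto
qed

text \<open>The constant shift \<open>d = 0\<close> gives stability; a shift tending to 0 covers
  spectral parameters that converge to a point outside the spectrum.\<close>

lemma eventually_section_inverse:
  fixes S R :: "'h::chilbert_space bop"
  assumes P: "\<And>n. is_projection (P n)" and comm: "(\<lambda>n. norm (S * P n - P n * S)) \<longlonglongrightarrow> 0"
    and R: "inverse_on UNIV S R" and d: "d \<longlonglongrightarrow> 0"
  shows "\<forall>\<^sub>F n in sequentially. \<exists>G. inverse_on (range (app (P n))) (P n * (S + d n *\<^sub>C 1) * P n) G \<and>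
    norm_on (range (app (P n))) G \<le> 2 * (norm R + 1)"
proof -
  have "(\<lambda>n. (norm (S * P n - P n * S) + cmod (d n)) * norm R) \<longlonglongrightarrow> (0 + 0) * norm R"
    by (intro tendsto_mult tendsto_add comm tendsto_norm_zero d tendsto_const)
  then have "\<forall>\<^sub>F n in sequentially. (norm (S * P n - P n * S) + cmod (d n)) * norm R < 1 / 2"
    by (rule order_tendstoD(2)) simp
  then show ?thesis
  proof eventually_elim
    case (elim n)
    then show ?case
      using R P by (intro section_inverse) (auto simp: inverse_on_UNIV_iff)
  qed
qed

lemma finite_section_stable_iff:
  fixes T :: "'h::chilbert_space bop"
  assumes P: "filtration P" and comm: "(\<lambda>n. norm (T * P n - P n * T)) \<longlonglongrightarrow> 0"
  shows "finite_section_stable P T \<longleftrightarrow> invertible_on UNIV T"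
proof
  assume "finite_section_stable P T"
  then obtain n0 C where "\<forall>n\<ge>n0. \<exists>R. inverse_on (range (app (P n))) (P n * T * P n) R \<and> norm_on (range (app (P n))) R \<le> C"
    unfolding finite_section_stable_def by blast
  then have "\<forall>\<^sub>F n in sequentially. \<exists>R. inverse_on (range (app (P n))) (P n * T * P n) R \<and> norm_on (range (app (P n))) R \<le> C"
    unfolding eventually_sequentially by blast
  then show "invertible_on UNIV T"
    by (intro invertible_of_sections[OF P comm] eventually_frequently) simp_all
next
  assume "invertible_on UNIV T"
  then obtain R where R: "inverse_on UNIV T R" unfolding invertible_on_def by blast
  show "finite_section_stable P T"
    using eventually_section_inverse[OF _ comm R tendsto_const] filtrationD(1)[OF P]
    unfolding finite_section_stable_def finproj_def eventually_sequentially by simp blast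
qed

text \<open>If some \<open>P\<^sub>n\<close> were \<open>0\<close>, its pseudospectrum and hence the whole upper limit would be empty.\<close>

lemma spectrum_eq_limsup_pseudospectrum:
  fixes T :: "'h::chilbert_space bop"
  assumes P: "filtration P" "\<And>n. P n \<noteq> 0" and comm: "(\<lambda>n. norm (T * P n - P n * T)) \<longlonglongrightarrow> 0"
  shows "spectrum_on UNIV T =
    (\<Inter>\<epsilon>\<in>{0<..}. limsup_sets (\<lambda>n. pseudospectrum_on \<epsilon> (range (app (P n))) (P n * T * P n)))"
proof -
  let ?M = "\<lambda>n. range (app (P n))"
  have proj: "is_projection (P n)" for n using filtrationD(1)[OF P(1)] by (simp add: finproj_def)
  have comm': "(\<lambda>n. norm ((z *\<^sub>C 1 - T) * P n - P n * (z *\<^sub>C 1 - T))) \<longlonglongrightarrow> 0" for z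
    unfolding commutator_shift using comm by (simp add: norm_minus_commute)
  have inv_iff: "inverse_on (?M n) (z *\<^sub>C 1 - P n * T * P n) R
      \<longleftrightarrow> inverse_on (?M n) (P n * (z *\<^sub>C 1 - T) * P n) R" for n z R
    by (rule inverse_on_cong) (rule section_shift[OF proj])
  show ?thesis
  proof (intro equalityI subsetI INT_I)
    fix z and \<epsilon> :: real assume z: "z \<in> spectrum_on UNIV T" and "\<epsilon> \<in> {0<..}"
    then have \<epsilon>: "\<epsilon> > 0" by simp
    let ?X = "\<lambda>n. pseudospectrum_on \<epsilon> (?M n) (P n * T * P n)"
    \<comment> \<open>Otherwise infinitely many sections would have inverses bounded by
      \<open>1 / \<epsilon>\<close>, which would make \<open>z *\<^sub>C 1 - T\<close>
      invertible.\<close>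
    have ev: "\<forall>\<^sub>F n in sequentially. z \<in> ?X n"
    proof (rule ccontr)
      assume "\<not> (\<forall>\<^sub>F n in sequentially. z \<in> ?X n)"
      then have "\<exists>\<^sub>F n in sequentially. z \<notin> ?X n" by (simp add: not_eventually)
      then have "\<exists>\<^sub>F n in sequentially. \<exists>R. inverse_on (?M n) (P n * (z *\<^sub>C 1 - T) * P n) R \<and>
          norm_on (?M n) R \<le> 1 / \<epsilon>"
      proof (rule frequently_elim1)
        fix n assume "z \<notin> ?X n"
        then show "\<exists>R. inverse_on (?M n) (P n * (z *\<^sub>C 1 - T) * P n) R \<and>
          norm_on (?M n) R \<le> 1 / \<epsilon>"
          unfolding pseudospectrum_on_def spectrum_on_def invertible_on_def inv_iff
          by (auto simp: not_le intro: less_imp_le)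
      qed
      then have "invertible_on UNIV (z *\<^sub>C 1 - T)" by (rule invertible_of_sections[OF P(1) comm'])
      then show False using z by (simp add: spectrum_on_def)
    qed
    have ne: "?X n \<noteq> {}" for n
      using section_spectrum_nonempty[OF filtrationD(1)[OF P(1)] P(2)] unfolding pseudospectrum_on_def by blast
    \<comment> \<open>\<open>limsup_sets\<close> asks for a point of every set; the finitely many
      sets missing \<open>z\<close> contribute an arbitrary one.\<close>
    define x where "x n = (if z \<in> ?X n then z else SOME w. w \<in> ?X n)" for n
    have "x n \<in> ?X n" for n using ne[of n] some_in_eq[of "?X n"] by (simp add: x_def)
    moreover have "x \<longlonglongrightarrow> z"
      by (rule tendsto_eventually) (use ev in \<open>eventually_elim, simp add: x_def\<close>)
    ultimately show "z \<in> limsup_sets ?X"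
      unfolding limsup_sets_def by (auto intro!: exI[of _ x] exI[of _ id] simp: strict_mono_def)
  next
    fix z assume z: "z \<in> (\<Inter>\<epsilon>\<in>{0<..}. limsup_sets (\<lambda>n. pseudospectrum_on \<epsilon> (?M n) (P n * T * P n)))"
    show "z \<in> spectrum_on UNIV T"
    proof (rule ccontr)
      assume "z \<notin> spectrum_on UNIV T"
      then obtain R where R: "inverse_on UNIV (z *\<^sub>C 1 - T) R" by (auto simp: spectrum_on_def invertible_on_def)
      define C where "C = 2 * (norm R + 1)"
      have C: "C > 0" by (simp add: C_def add_nonneg_pos)
      \<comment> \<open>At a point of this pseudospectrum the section has no inverse, or one of norm
        at least \<open>2 * C\<close>; both contradict the bound \<open>C\<close>.\<close>
      define \<epsilon> where "\<epsilon> = 1 / (2 * C)"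
      have \<epsilon>: "\<epsilon> > 0" "1 / \<epsilon> > C" using C by (simp_all add: \<epsilon>_def)
      obtain x r where x: "\<And>n. x n \<in> pseudospectrum_on \<epsilon> (?M n) (P n * T * P n)"
        and r: "strict_mono (r :: nat \<Rightarrow> nat)" "(x \<circ> r) \<longlonglongrightarrow> z"
        using z \<epsilon>(1) unfolding limsup_sets_def by blast
      \<comment> \<open>The spectral parameter drifts along the sequence, and
        \<open>eventually_section_inverse\<close> absorbs the drift as its shift.\<close>
      define d where "d m = x (r m) - z" for m
      have d: "d \<longlonglongrightarrow> 0" using LIM_zero[OF r(2)] by (simp add: d_def[abs_def] o_def)
      have cr: "(\<lambda>m. norm ((z *\<^sub>C 1 - T) * (P \<circ> r) m - (P \<circ> r) m * (z *\<^sub>C 1 - T))) \<longlonglongrightarrow> 0"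
        using LIMSEQ_subseq_LIMSEQ[OF comm' r(1)] by (simp add: o_def)
      have "\<forall>\<^sub>F m in sequentially. \<exists>G. inverse_on (range (app ((P \<circ> r) m))) ((P \<circ> r) m * (z *\<^sub>C 1 - T + d m *\<^sub>C 1) * (P \<circ> r) m) G \<and>
          norm_on (range (app ((P \<circ> r) m))) G \<le> 2 * (norm R + 1)"
        by (rule eventually_section_inverse[OF _ cr R d]) (simp add: proj)
      then obtain m G where G: "inverse_on (?M (r m)) (P (r m) * (z *\<^sub>C 1 - T + d m *\<^sub>C 1) * P (r m)) G"
        "norm_on (?M (r m)) G \<le> C"
        using eventually_happens'[OF sequentially_bot] by (fastforce simp: C_def)
      have shift: "z *\<^sub>C 1 - T + d m *\<^sub>C 1 = x (r m) *\<^sub>C 1 - T"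
        by (simp add: d_def complex_vector.scale_left_diff_distrib)
      have G': "inverse_on (?M (r m)) (x (r m) *\<^sub>C 1 - P (r m) * T * P (r m)) G"
        unfolding inv_iff using G(1) by (simp only: shift)
      then have "norm_on (?M (r m)) R' \<le> C"
        if "inverse_on (?M (r m)) (x (r m) *\<^sub>C 1 - P (r m) * T * P (r m)) R'" for R'
        using inverse_on_norm_on_unique[OF G' that] G(2) by simp
      then show False
        using x[of "r m"] G' \<epsilon>(2) unfolding pseudospectrum_on_def spectrum_on_def invertible_on_def by force
    qed
  qed
qed

theorem theorem6p4p4:
  fixes T :: "'h::chilbert_space bop"
  assumes separable: "\<exists>D :: 'h set. countable D \<and> closure D = UNIV"
    and infinite_dimensional: "\<nexists>B :: 'h set. finite B \<and> cspan B = UNIV"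
    and qd: "quasidiagonal T"
    and exact: "exact_cstar TYPE('k::chilbert_space) (cstar_gen T)"
  shows "\<exists>P :: nat \<Rightarrow> 'h bop. filtration P \<and>
    (finite_section_stable P T \<longleftrightarrow> invertible_on UNIV T) \<and>
    spectrum_on UNIV T =
      (\<Inter>\<epsilon>\<in>{0<..}. limsup_sets (\<lambda>n. pseudospectrum_on \<epsilon> (range (app (P n))) (P n * T * P n))) \<and>
    (\<forall>\<tau>. quasidiagonal_trace (cstar_gen (calkin T)) \<tau> \<longrightarrow>
      (\<exists>r :: nat \<Rightarrow> nat. strict_mono r \<and>
        (\<forall>X\<in>cstar_gen T. (\<lambda>k. section_state (P (r k)) X) \<longlonglongrightarrow> \<tau> (calkin X))))"
proof -
  obtain X :: "nat \<Rightarrow> 'h bop" where X: "\<And>i. X i \<in> cstar_gen T"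
    and dense: "\<And>Y e. Y \<in> cstar_gen T \<Longrightarrow> e > 0 \<Longrightarrow> \<exists>i. norm (X i - Y) < e"
    by (rule cstar_gen_dense_sequence[of T]) blast
  define QT where "QT = {\<tau>. quasidiagonal_trace (cstar_gen (calkin T)) \<tau>}"
  \<comment> \<open>A trace is seen through its values on the dense sequence alone, a point of a
    second countable product space.\<close>
  define ev where "ev \<tau> i = \<tau> (calkin (X i))" for \<tau> :: "'h calkin \<Rightarrow> complex" and i
  \<comment> \<open>Keeping \<open>\<sigma> j \<in> QT\<close> inside the existential lets the
    statement hold also when there are no quasidiagonal traces.\<close>
  have "\<exists>\<sigma> :: nat \<Rightarrow> 'h calkin \<Rightarrow> complex. (\<forall>\<tau>\<in>QT. \<forall>m. \<forall>e>0. \<exists>j. \<sigma> j \<in> QT \<and> (\<forall>i\<le>m. dist (ev (\<sigma> j) i) (ev \<tau> i) < e))"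
  proof (cases "QT = {}")
    case False
    obtain d :: "nat \<Rightarrow> nat \<Rightarrow> complex" where d: "\<And>j. d j \<in> ev ` QT"
      "\<And>f m e. f \<in> ev ` QT \<Longrightarrow> e > 0 \<Longrightarrow> \<exists>j. \<forall>i\<le>m. dist (d j i) (f i) < e"
      using countable_pointwise_dense[of "ev ` QT"] False by blast
    obtain \<sigma> where "\<And>j. \<sigma> j \<in> QT" "\<And>j. d j = ev (\<sigma> j)" using d(1) unfolding image_iff by metis
    then show ?thesis using d(2) by (intro exI[of _ \<sigma>]) fastforce
  qed simp
  then obtain \<sigma> :: "nat \<Rightarrow> 'h calkin \<Rightarrow> complex" where \<sigma>: "\<forall>\<tau>\<in>QT. \<forall>m. \<forall>e>0.
    \<exists>j. \<sigma> j \<in> QT \<and> (\<forall>i\<le>m. dist (ev (\<sigma> j) i) (ev \<tau> i) < e)" by (rule exE)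
  \<comment> \<open>Through the pairing each \<open>\<sigma> j\<close> is prescribed at all stages
    \<open>prod_encode (j, m)\<close>, which are at least \<open>m\<close>; so it is approximated
    again and again, with growing accuracy.\<close>
  define \<rho> where "\<rho> n = \<sigma> (fst (prod_decode n))" for n
  obtain P where P: "filtration P" "\<And>n. P n \<noteq> 0" "(\<lambda>n. norm (T * P n - P n * T)) \<longlonglongrightarrow> 0"
    and tr: "\<And>n i. quasidiagonal_trace (cstar_gen (calkin T)) (\<rho> n) \<Longrightarrow> i \<le> n \<Longrightarrow> cmod (section_state (P n) (X i) - \<rho> n (calkin (X i))) < 1 / real (Suc n)"
    by (rule quasidiagonal_filtration[where X = X and \<tau> = \<rho>, OF infinite_dimensional qd X]) (rule that; blast)
  have "\<exists>r :: nat \<Rightarrow> nat. strict_mono r \<and>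
      (\<forall>X\<in>cstar_gen T. (\<lambda>k. section_state (P (r k)) X) \<longlonglongrightarrow> \<tau> (calkin X))"
    if \<tau>: "quasidiagonal_trace (cstar_gen (calkin T)) \<tau>" for \<tau>
  proof (rule traces_along_subsequences[OF filtrationD(1)[OF P(1)] X dense])
    show "tracial_state (cstar_gen (calkin T)) \<tau>" using \<tau> by (simp add: quasidiagonal_trace_def)
    fix m
    obtain j where j: "\<sigma> j \<in> QT" "\<And>i. i \<le> m \<Longrightarrow> dist (ev (\<sigma> j) i) (ev \<tau> i) < 1 / real (Suc m)"
      using \<sigma>[rule_format, of \<tau> "1 / real (Suc m)" m] \<tau> by (auto simp: QT_def simp del: of_nat_Suc)
    define n where "n = prod_encode (j, m)"
    have n: "n \<ge> m" "\<rho> n = \<sigma> j" by (simp_all add: n_def \<rho>_def le_prod_encode_2)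
    have "cmod (section_state (P n) (X i) - \<tau> (calkin (X i))) < 2 / real (Suc m)" if i: "i \<le> m" for i
    proof -
      have "cmod (section_state (P n) (X i) - \<sigma> j (calkin (X i))) < 1 / real (Suc n)"
        using tr[of n i] n j(1) i by (simp add: QT_def)
      also have "\<dots> \<le> 1 / real (Suc m)" using n(1) by (intro divide_left_mono) auto
      finally have "cmod (section_state (P n) (X i) - \<sigma> j (calkin (X i))) < 1 / real (Suc m)" .
      moreover have "cmod (\<sigma> j (calkin (X i)) - \<tau> (calkin (X i))) < 1 / real (Suc m)"
        using j(2)[OF i] by (simp add: ev_def dist_norm)
      ultimately show ?thesis
        using norm_triangle_ineq[of "section_state (P n) (X i) - \<sigma> j (calkin (X i))" "\<sigma> j (calkin (X i)) - \<tau> (calkin (X i))"]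
        by simp
    qed
    then show "\<exists>n\<ge>m. \<forall>i\<le>m. cmod (section_state (P n) (X i) - \<tau> (calkin (X i))) < 2 / real (Suc m)"
      using n(1) by blast
  qed
  then show ?thesis
    using P finite_section_stable_iff[OF P(1,3)] spectrum_eq_limsup_pseudospectrum[OF P] by blast
qed

end
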